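(* Let $\widetilde{\mathcal V}=(\widehat{\mathcal V},(V,O),\iota)$ be a smooth formal-analytic arithmetic surface over $\operatorname{Spec}\mathbb Z$ such that $V$ is simply connected. If it satisfies the condition $$\widehat{\deg}\,\overline N_P\widetilde{\mathcal V}<0,$$ then the algebra $\mathcal O(\widetilde{\mathcal V})$ contains a non-constant element $\alpha=(\widehat\alpha,\alpha^{\mathrm{an}})$ such that $\widehat\alpha(P)=0$ and $\alpha^{\mathrm{an}}(V)$ is contained in the open unit disk $\mathring D(0;1)$.
   Context: Riemann surface with boundary: a closed $C^\infty$ submanifold with boundary $V$, of codimension $0$, of a (germ along $V$ of a) Riemann surface $V^+$; holomorphic functions on $V$ are understood to be defined on a neighbourhood of $V$ in $V^+$. A smooth formal-analytic arithmetic surface over $\operatorname{Spec}\mathbb Z$ is a triple $\widetilde{\mathcal V}=(\widehat{\mathcal V},(V,O),\iota)$ where: $\widehat{\mathcal V}$ is a formal scheme isomorphic to $\operatorname{Spf}\mathbb Z[[X]]$; $V$ is a connected compact Riemann surface with non-empty boundary, endowed with an antiholomorphic involution (complex conjugation), and $O$ is a point of the interior $\mathring V$ fixed by it; $\iota:\widehat{\mathcal V}_{\mathbb C}\to\widehat V_O$ is an isomorphism of complex formal curves (onto the formal completion of $V$ at $O$), compatible with the real structures. $P$ is the section $X=0$ of $\widehat{\mathcal V}\to\operatorname{Spec}\mathbb Z$; $\widehat\alpha(P)=0$ means that $\widehat\alpha$ has zero constant term. $\mathcal O(\widetilde{\mathcal V})$ is the ring of pairs $(\widehat\alpha,\alpha^{\mathrm{an}})$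 with $\widehat\alpha\in\Gamma(\widehat{\mathcal V},\mathcal O)\simeq\mathbb Z[[X]]$ and $\alpha^{\mathrm{an}}$ holomorphic on $V$ (up to the boundary) such that $\widehat\alpha_{\mathbb C}=\widehat\alpha^{\mathrm{an}}\circ\iota$, where $\widehat\alpha^{\mathrm{an}}$ is the Taylor expansion of $\alpha^{\mathrm{an}}$ at $O$. Let $g_{V,O}$ be the unique continuous function on $V^+\setminus\{O\}$ vanishing outside $\mathring V$, harmonic on $\mathring V\setminus\{O\}$, with $g_{V,O}+\log|z|$ bounded near $O$ for $z$ a local coordinate vanishing at $O$. The capacitary norm on $T_OV$ is $\|(\partial/\partial z)_O\|^{\mathrm{cap}}=\exp\bigl(-\lim_{O}(g_{V,O}+\log|z|)\bigr)$, and $\widehat{\deg}\,\overline N_P\widetilde{\mathcal V}:=-\log\|D\iota(\partial/\partial X)\|^{\mathrm{cap}}$, where $\partial/\partial X$ generates the normal bundle of $P$ in $\widehat{\mathcal V}$. *)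

theory Defs
  imports "HOL-Complex_Analysis.Complex_Analysis"
begin

section \<open>Riemann surfaces\<close>

text \<open>A chart is a pair of its domain \<open>U\<close> and a function \<open>\<phi>\<close>, of which only the
  restriction to \<open>U\<close> matters; the inverse chart is \<^term>\<open>inv_into U \<phi>\<close>.\<close>

type_synonym 'a chart = "'a set \<times> ('a \<Rightarrow> complex)"

definition topological_chart :: "'a::t2_space set \<Rightarrow> 'a chart \<Rightarrow> bool" where
  "topological_chart M = (\<lambda>(U, \<phi>). open U \<and> U \<subseteq> M \<and> open (\<phi> ` U) \<and>
     homeomorphism U (\<phi> ` U) \<phi> (inv_into U \<phi>))"

definition holomorphically_compatible :: "'a::t2_space chart \<Rightarrow> 'a chart \<Rightarrow> bool" where
  "holomorphically_compatible = (\<lambda>(U, \<phi>) (U', \<phi>').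
     (\<phi>' \<circ> inv_into U \<phi>) holomorphic_on \<phi> ` (U \<inter> U') \<and>
     (\<phi> \<circ> inv_into U' \<phi>') holomorphic_on \<phi>' ` (U \<inter> U'))"

locale riemann_surface =
  fixes M :: "'a::t2_space set" and atlas :: "'a chart set"
  assumes open_carrier: "open M"
    and covers: "(\<Union>(U, \<phi>)\<in>atlas. U) = M"
    and charts: "\<And>C. C \<in> atlas \<Longrightarrow> topological_chart M C"
    and compatible: "\<And>C C'. C \<in> atlas \<Longrightarrow> C' \<in> atlas \<Longrightarrow> holomorphically_compatible C C'"

definition holomorphic_on_surface ::
    "'a::t2_space chart set \<Rightarrow> ('a \<Rightarrow> complex) \<Rightarrow> 'a set \<Rightarrow> bool" where
  "holomorphic_on_surface atlas f W \<longleftrightarrow>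
     (\<forall>(U, \<phi>)\<in>atlas. (f \<circ> inv_into U \<phi>) holomorphic_on \<phi> ` (U \<inter> W))"

definition antiholomorphic_map_on ::
    "'a::t2_space set \<Rightarrow> 'a chart set \<Rightarrow> ('a \<Rightarrow> 'a) \<Rightarrow> 'a set \<Rightarrow> bool" where
  "antiholomorphic_map_on M atlas c W \<longleftrightarrow>
     continuous_on W c \<and> c ` W \<subseteq> M \<and>
     (\<forall>(U, \<phi>)\<in>atlas. \<forall>(U', \<phi>')\<in>atlas.
        (cnj \<circ> \<phi>' \<circ> c \<circ> inv_into U \<phi>) holomorphic_on \<phi> ` {x \<in> U \<inter> W. c x \<in> U'})"

text \<open>A local coordinate vanishing at \<open>pt\<close>: a chart of the maximal atlas centred at \<open>pt\<close>.\<close>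

definition local_coordinate_at ::
    "'a::t2_space set \<Rightarrow> 'a chart set \<Rightarrow> 'a \<Rightarrow> 'a chart \<Rightarrow> bool" where
  "local_coordinate_at M atlas pt = (\<lambda>(U, z).
     topological_chart M (U, z) \<and> (\<forall>C\<in>atlas. holomorphically_compatible (U, z) C) \<and>
     pt \<in> U \<and> z pt = 0)"


section \<open>Smoothness, harmonicity, and smooth boundaries\<close>

text \<open>Differentiability is over the reals, with \<open>complex\<close> regarded as the real plane;
  the definitions are meant for open sets \<open>S\<close>.\<close>

primrec Ck_on :: "nat \<Rightarrow> (complex \<Rightarrow> 'b::real_normed_vector) \<Rightarrow> complex set \<Rightarrow> bool" where
  "Ck_on 0 f S \<longleftrightarrow> continuous_on S f"
| "Ck_on (Suc k) f S \<longleftrightarrow> (\<forall>x\<in>S. f differentiable (at x)) \<and>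
     (\<forall>v. Ck_on k (\<lambda>x. frechet_derivative f (at x) v) S)"

definition smooth_on :: "(complex \<Rightarrow> 'b::real_normed_vector) \<Rightarrow> complex set \<Rightarrow> bool" where
  "smooth_on f S \<longleftrightarrow> (\<forall>k. Ck_on k f S)"

definition partial_deriv :: "complex \<Rightarrow> (complex \<Rightarrow> real) \<Rightarrow> complex \<Rightarrow> real" where
  "partial_deriv v u x = frechet_derivative u (at x) v"

definition laplacian :: "(complex \<Rightarrow> real) \<Rightarrow> complex \<Rightarrow> real" where
  "laplacian u x = partial_deriv 1 (partial_deriv 1 u) x +
                   partial_deriv \<i> (partial_deriv \<i> u) x"

definition harmonic_on :: "(complex \<Rightarrow> real) \<Rightarrow> complex set \<Rightarrow> bool" where
  "harmonic_on u S \<longleftrightarrow> Ck_on 2 u S \<and> (\<forall>x\<in>S. laplacian u x = 0)"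

definition harmonic_on_surface ::
    "'a::t2_space chart set \<Rightarrow> ('a \<Rightarrow> real) \<Rightarrow> 'a set \<Rightarrow> bool" where
  "harmonic_on_surface atlas u W \<longleftrightarrow>
     (\<forall>(U, \<phi>)\<in>atlas. harmonic_on (u \<circ> inv_into U \<phi>) (\<phi> ` (U \<inter> W)))"

text \<open>A smooth chart \<open>(W, \<psi>)\<close> of the underlying real surface is adapted to \<open>V\<close> if it
  straightens \<open>V\<close> to the closed upper half plane. Having such a chart around every point of
  \<open>V\<close> is the definition of a submanifold with boundary of codimension 0; charts around
  interior points have values in the open upper half plane, and the boundary of \<open>V\<close> as a
  manifold is its topological frontier.\<close>

definition adapted_chart ::
    "'a::t2_space set \<Rightarrow> 'a chart set \<Rightarrow> 'a set \<Rightarrow> 'a chart \<Rightarrow> bool" where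
  "adapted_chart M atlas V = (\<lambda>(W, \<psi>).
     topological_chart M (W, \<psi>) \<and>
     (\<forall>(U, \<phi>)\<in>atlas. smooth_on (\<psi> \<circ> inv_into U \<phi>) (\<phi> ` (U \<inter> W)) \<and>
                      smooth_on (\<phi> \<circ> inv_into W \<psi>) (\<psi> ` (U \<inter> W))) \<and>
     V \<inter> W = {x \<in> W. Im (\<psi> x) \<ge> 0})"

text \<open>\<open>M\<close> is a representative of the germ of Riemann surface containing \<open>V\<close>.\<close>

locale compact_riemann_surface_with_boundary = riemann_surface M atlas
  for M :: "'a::t2_space set" and atlas :: "'a chart set" +
  fixes V :: "'a set"
  assumes V_subset: "V \<subseteq> M"
    and V_compact: "compact V"
    and V_connected: "connected V"
    and V_submanifold: "\<And>x. x \<in> V \<Longrightarrow> \<exists>W \<psi>. x \<in> W \<and> adapted_chart M atlas V (W, \<psi>)"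
    and V_boundary: "frontier V \<noteq> {}"


section \<open>Smooth formal-analytic arithmetic surfaces over the integers\<close>

text \<open>
  The formal scheme is taken to be the formal spectrum of \<open>\<int>[[X]]\<close> itself, so that its
  functions are elements of \<^typ>\<open>int fps\<close>.

  The formal completion of \<open>V\<close> at \<open>pt\<close> is described in an arbitrary local coordinate
  \<open>(U, z)\<close> vanishing at \<open>pt\<close>: an isomorphism \<open>j\<close> onto it from the complexified formal
  scheme amounts to the series \<open>\<iota> = z \<circ> j\<close> in \<open>X\<close>, with zero constant term and
  non-zero linear term.

  The antiholomorphic involution \<open>c\<close> of \<open>V\<close> is, like the holomorphic functions on \<open>V\<close>,
  defined on a neighbourhood of \<open>V\<close> in \<open>M\<close>. In the coordinate \<open>z\<close> it reads
  \<open>w \<mapsto> F (cnj w)\<close> with \<open>F\<close> holomorphic near 0, so the compatibility of \<open>j\<close> with the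
  real structures, \<open>j \<circ> cnj = c \<circ> j\<close>, becomes \<open>\<iota> = F \<circ> \<kappa>\<close>, where \<open>\<kappa>\<close> is
  \<open>\<iota>\<close> with conjugate coefficients.
\<close>

definition taylor_at :: "'a chart \<Rightarrow> ('a \<Rightarrow> complex) \<Rightarrow> complex fps" where
  "taylor_at = (\<lambda>(U, z) f. fps_expansion (f \<circ> inv_into U z) 0)"

definition conj_in_coordinate :: "'a chart \<Rightarrow> ('a \<Rightarrow> 'a) \<Rightarrow> complex fps" where
  "conj_in_coordinate = (\<lambda>(U, z) c. fps_expansion (z \<circ> c \<circ> inv_into U z \<circ> cnj) 0)"

definition cnj_fps :: "complex fps \<Rightarrow> complex fps" where
  "cnj_fps f = Abs_fps (\<lambda>n. cnj (fps_nth f n))"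

definition complexify :: "int fps \<Rightarrow> complex fps" where
  "complexify f = Abs_fps (\<lambda>n. of_int (fps_nth f n))"

locale smooth_formal_analytic_surface = compact_riemann_surface_with_boundary M atlas V
  for M :: "'a::t2_space set" and atlas :: "'a chart set" and V :: "'a set" +
  fixes c :: "'a \<Rightarrow> 'a" and pt :: 'a and coord :: "'a chart" and \<iota> :: "complex fps"
  assumes c_antiholomorphic:
      "\<exists>W. open W \<and> V \<subseteq> W \<and> W \<subseteq> M \<and> antiholomorphic_map_on M atlas c W"
    and c_maps: "c ` V \<subseteq> V"
    and c_involution: "\<And>x. x \<in> V \<Longrightarrow> c (c x) = x"
    and pt_interior: "pt \<in> interior V"
    and pt_real: "c pt = pt"
    and coordinate: "local_coordinate_at M atlas pt coord"
    and iota_0: "fps_nth \<iota> 0 = 0"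
    and iota_1: "fps_nth \<iota> 1 \<noteq> 0"
    and iota_real: "fps_compose (conj_in_coordinate coord c) (cnj_fps \<iota>) = \<iota>"

text \<open>In a pair \<open>(f, h)\<close> below, the function \<open>h\<close> represents its germ along \<open>V\<close>.\<close>

definition fa_functions :: "'a::t2_space set \<Rightarrow> 'a chart set \<Rightarrow> 'a set \<Rightarrow> 'a chart \<Rightarrow>
    complex fps \<Rightarrow> (int fps \<times> ('a \<Rightarrow> complex)) set" where
  "fa_functions M atlas V coord \<iota> = {(f, h).
     (\<exists>W. open W \<and> V \<subseteq> W \<and> W \<subseteq> M \<and> holomorphic_on_surface atlas h W) \<and>
     complexify f = fps_compose (taylor_at coord h) \<iota>}"

text \<open>The constant elements are those of the image of the structure map from the integers.\<close>

definition fa_constant :: "'a set \<Rightarrow> int fps \<times> ('a \<Rightarrow> complex) \<Rightarrow> bool" where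
  "fa_constant V = (\<lambda>(f, h). \<exists>n. f = fps_const n \<and> (\<forall>x\<in>V. h x = of_int n))"


section \<open>Capacitary norm and Arakelov degree of the normal bundle\<close>

definition is_green_function :: "'a::t2_space set \<Rightarrow> 'a chart set \<Rightarrow> 'a set \<Rightarrow> 'a \<Rightarrow>
    'a chart \<Rightarrow> ('a \<Rightarrow> real) \<Rightarrow> bool" where
  "is_green_function M atlas V pt = (\<lambda>(U, z) g.
     continuous_on (M - {pt}) g \<and>
     (\<forall>x\<in>M - interior V. g x = 0) \<and>
     harmonic_on_surface atlas g (interior V - {pt}) \<and>
     (\<exists>B. \<forall>\<^sub>F x in at pt. \<bar>g x + ln (cmod (z x))\<bar> \<le> B))"

text \<open>The conditions determine the function on \<open>M - {pt}\<close>; its values elsewhere are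
  irrelevant.\<close>

definition green_function :: "'a::t2_space set \<Rightarrow> 'a chart set \<Rightarrow> 'a set \<Rightarrow> 'a \<Rightarrow>
    'a chart \<Rightarrow> 'a \<Rightarrow> real" where
  "green_function M atlas V pt coord = (SOME g. is_green_function M atlas V pt coord g)"

text \<open>The capacitary norm of the tangent vector \<open>t \<cdot> (\<partial>/\<partial>z)\<close> at \<open>pt\<close>.\<close>

definition capacitary_norm :: "'a::t2_space set \<Rightarrow> 'a chart set \<Rightarrow> 'a set \<Rightarrow> 'a \<Rightarrow>
    'a chart \<Rightarrow> complex \<Rightarrow> real" where
  "capacitary_norm M atlas V pt coord t =
     cmod t * exp (- Lim (at pt)
       (\<lambda>x. green_function M atlas V pt coord x + ln (cmod (snd coord x))))"

text \<open>The differential of \<open>j\<close> maps \<open>\<partial>/\<partial>X\<close> to \<open>\<iota>'(0) \<cdot> (\<partial>/\<partial>z)\<close>.\<close>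

definition degree_normal_bundle :: "'a::t2_space set \<Rightarrow> 'a chart set \<Rightarrow> 'a set \<Rightarrow> 'a \<Rightarrow>
    'a chart \<Rightarrow> complex fps \<Rightarrow> real" where
  "degree_normal_bundle M atlas V pt coord \<iota> =
     - ln (capacitary_norm M atlas V pt coord (fps_nth \<iota> 1))"

end

theory Submission
  imports Defs
begin

text \<open>
  Let \<open>L\<close> be the limit of \<open>g + ln \<bar>z\<bar>\<close> at the base point \<open>pt\<close>, where \<open>g\<close> is the Green function of
  \<open>V\<close>. The hypothesis on the degree says \<open>\<bar>\<iota>'(0)\<bar> * exp (- L) > 1\<close>. The idea is to find a function
  \<open>v\<close>, holomorphic near \<open>V\<close>, with \<open>v pt = 0\<close> and \<open>\<bar>v\<bar> < 1\<close> on \<open>V\<close>, such that the linear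
  coefficient \<open>\<lambda>\<close> of the series \<open>\<psi> = v \<circ> \<iota>\<close> in \<open>X\<close> still satisfies \<open>\<bar>\<lambda>\<bar> > 1\<close>. A power series
  \<open>A(v)\<close> in \<open>v\<close> whose \<open>k\<close>-th coefficient is of size at most \<open>\<bar>\<lambda>\<bar> ^ (- k) / 2\<close> then converges near
  \<open>V\<close>, and the freedom of choosing the \<open>k\<close>-th coefficient suffices to round the \<open>k\<close>-th coefficient of
  the resulting series in \<open>X\<close> (\<open>integral_coeffs\<close>). Starting at a large order \<open>m\<close> makes \<open>\<bar>A(v)\<bar>\<close>
  small on \<open>V\<close>, and a coefficient 1 at \<open>X ^ m\<close> makes it nonconstant. Rounding needs real
  coefficients; therefore the conjugate under the involution \<open>c\<close> is added, whose series in \<open>X\<close> is the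
  complex conjugate (\<open>taylor_conjugate\<close>).

  If \<open>v\<close> were only needed on the interior of \<open>V\<close>, one would take \<open>exp (- (g + i g*))\<close>, a Riemann map
  with derivative of modulus \<open>exp (- L)\<close>. It does not extend holomorphically across the boundary, which
  is merely smooth. Instead \<open>g\<close> is approximated from above by functions that are harmonic on
  neighbourhoods of \<open>V\<close>, with values of the limit at \<open>pt\<close> arbitrarily close to \<open>L\<close>
  (\<open>green_approximation\<close>). This comes for free if \<open>g\<close> itself is constructed by the Perron method as the
  infimum of all superharmonic functions with a logarithmic pole at \<open>pt\<close> that live on any
  neighbourhood of \<open>V\<close>. The construction also proves the existence of the Green function: its boundary
  values vanish because \<open>V\<close> has barriers, functions \<open>Re (sqrt (t + \<delta>))\<close> with the slit placed outside
  \<open>V\<close> (\<open>barrier\<close>), and there are competitors at all because the boundary is not negligible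
  (\<open>capacity_function\<close>). Uniqueness of the Green function (\<open>green_function_eq\<close>) then links this
  infimum to the capacitary norm.

  Finally, a function that is locally the modulus of a holomorphic function is globally so near a
  simply connected compact set (\<open>global_modulus\<close>): local solutions are unique up to constants of modulus
  1 and can be continued along paths in \<open>V\<close>, with no monodromy.
\<close>

section \<open>The Dirichlet problem on a disc and harmonicity in the plane\<close>

text \<open>Limits of harmonic functions are reduced to Montel's theorem: the holomorphic functions
  \<open>exp (- f n)\<close> are uniformly bounded, and the modulus of any locally uniform limit of them is
  \<open>exp (- u)\<close>. Since this never vanishes, the limit has a logarithm on the disc.\<close>

lemma Re_holomorphic_limit:
  fixes f :: "nat \<Rightarrow> complex \<Rightarrow> complex"
  assumes hol: "\<And>n. f n holomorphic_on ball a r"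
    and below: "\<And>n z. z \<in> ball a r \<Longrightarrow> B \<le> Re (f n z)"
    and lim: "\<And>z. z \<in> ball a r \<Longrightarrow> (\<lambda>n. Re (f n z)) \<longlonglongrightarrow> u z"
  obtains F where "F holomorphic_on ball a r" "\<And>z. z \<in> ball a r \<Longrightarrow> u z = Re (F z)"
proof -
  define e where "e n z = exp (- f n z)" for n z
  have hole: "h holomorphic_on ball a r" if "h \<in> range e" for h
    using that hol by (auto simp: e_def[abs_def] intro!: holomorphic_intros)
  have bnd: "\<exists>B. \<forall>h\<in>range e. \<forall>z\<in>K. norm (h z) \<le> B" if "K \<subseteq> ball a r" for K
    by (rule exI[of _ "exp (-B)"]) (use below that in \<open>auto simp: e_def\<close>)
  obtain g s where g: "g holomorphic_on ball a r" and s: "strict_mono (s :: nat \<Rightarrow> nat)"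
    and lim_g: "\<And>x. x \<in> ball a r \<Longrightarrow> (\<lambda>n. e (s n) x) \<longlonglongrightarrow> g x"
    by (rule Montel[of "ball a r" "range e" e]) (use hole bnd in auto)
  have norm_g: "norm (g z) = exp (- u z)" if z: "z \<in> ball a r" for z
  proof (rule LIMSEQ_unique)
    show "(\<lambda>n. norm (e (s n) z)) \<longlonglongrightarrow> norm (g z)"
      by (intro tendsto_intros lim_g z)
    have "(\<lambda>n. exp (- Re (f (s n) z))) \<longlonglongrightarrow> exp (- u z)"
      using LIMSEQ_subseq_LIMSEQ[OF lim[OF z] s] by (intro tendsto_intros) (simp add: o_def)
    then show "(\<lambda>n. norm (e (s n) z)) \<longlonglongrightarrow> exp (- u z)"
      by (simp add: e_def)
  qed
  have "contractible (ball a r)"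
    by (simp add: convex_imp_contractible)
  then obtain l where l: "l holomorphic_on ball a r" "\<And>z. z \<in> ball a r \<Longrightarrow> g z = exp (l z)"
    using contractible_imp_holomorphic_log[OF g] norm_g
    by (metis exp_not_eq_zero norm_zero)
  show thesis
  proof
    show "(\<lambda>z. - l z) holomorphic_on ball a r"
      by (intro holomorphic_intros l)
    show "u z = Re (- l z)" if "z \<in> ball a r" for z
      using norm_g[OF that] l(2)[OF that] by simp
  qed
qed

text \<open>On the unit circle \<open>cnj z = inverse z\<close>, so that a product of real parts of monomials is again
  a sum of real parts of monomials. Hence the boundary values of harmonic polynomials form an
  algebra and comprise all polynomials in the two real coordinates, which are dense.\<close>

lemma circle_Re_poly_mult:
  fixes p q :: "complex poly"
  shows "\<exists>s. \<forall>z\<in>sphere 0 1. Re (poly p z) * Re (poly q z) = Re (poly s z)"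
proof -
  have inv: "cnj z = inverse z" if "z \<in> sphere 0 1" for z :: complex
    using that by (metis complex_div_cnj dist_0_norm div_by_1 divide_inverse inverse_1
        mem_sphere mult_1 of_real_1 power_one mult.commute complex_cnj_cnj)
  have mono: "\<exists>s. \<forall>z\<in>sphere 0 1. Re (a * z^i) * Re (b * z^j) = Re (poly s z)"
    for a b :: complex and i j :: nat
  proof -
    have 1: "Re x * Re y = (Re (x * y) + Re (x * cnj y)) / 2" for x y :: complex
      by (simp add: algebra_simps)
    have 2: "\<exists>s. \<forall>z\<in>sphere 0 1. Re (a * z^i * cnj (b * z^j)) = Re (poly s z)"
    proof (cases "j \<le> i")
      case True
      have "Re (a * z^i * cnj (b * z^j)) = Re (poly (monom (a * cnj b) (i - j)) z)"
        if "z \<in> sphere 0 1" for z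
      proof -
        have "z^i * cnj z^j = z^(i-j)"
          using True inv[OF that] that
          by (metis mem_sphere dist_0_norm norm_zero zero_neq_one power_diff power_inverse divide_inverse)
        then show ?thesis by (simp add: poly_monom mult_ac)
      qed
      then show ?thesis by blast
    next
      case False
      have "Re (a * z^i * cnj (b * z^j)) = Re (poly (monom (cnj a * b) (j - i)) z)"
        if "z \<in> sphere 0 1" for z
      proof -
        have *: "z^j * cnj z^i = z^(j-i)"
          using False inv[OF that] that
          by (metis mem_sphere dist_0_norm norm_zero zero_neq_one power_diff power_inverse
              divide_inverse nat_le_linear)
        have "Re (a * z^i * cnj (b * z^j)) = Re (cnj (a * z^i * cnj (b * z^j)))"
          by (simp only: complex_cnj cnj.sel) 
        also have "cnj (a * z^i * cnj (b * z^j)) = cnj a * b * (z^j * cnj z^i)"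
          by (simp add: mult_ac)
        finally show ?thesis by (simp only: * poly_monom)
      qed
      then show ?thesis by blast
    qed
    then obtain s where s: "\<forall>z\<in>sphere 0 1. Re (a * z^i * cnj (b * z^j)) = Re (poly s z)" ..
    have "Re (a * z^i) * Re (b * z^j) = Re (poly (smult (1/2) (monom (a * b) (i + j) + s)) z)"
      if "z \<in> sphere 0 1" for z
      using s that unfolding 1 by (simp add: poly_monom power_add mult_ac)
    then show ?thesis by blast
  qed
  have sums: "\<exists>s. \<forall>z\<in>sphere 0 1. (\<Sum>i\<in>A. g i z) = Re (poly s z)"
    if "finite A" "\<And>i. i \<in> A \<Longrightarrow> \<exists>s. \<forall>z\<in>sphere 0 1. g i z = Re (poly s z)"
    for A :: "nat set" and g :: "nat \<Rightarrow> complex \<Rightarrow> real"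
    using that
  proof (induction A rule: finite_induct)
    case empty
    show ?case by (rule exI[of _ 0]) simp
  next
    case (insert x F)
    then obtain s t where "\<forall>z\<in>sphere 0 1. (\<Sum>i\<in>F. g i z) = Re (poly s z)"
      "\<forall>z\<in>sphere 0 1. g x z = Re (poly t z)" by (metis insertCI)
    with insert show ?case by (intro exI[of _ "t + s"]) simp
  qed
  have expand: "Re (poly p z) * Re (poly q z) =
      (\<Sum>i\<le>degree p. \<Sum>j\<le>degree q. Re (coeff p i * z^i) * Re (coeff q j * z^j))" for z
    by (simp add: poly_altdef sum_product del: times_complex.sel)
  show ?thesis
    unfolding expand by (intro sums mono) auto
qed

lemma real_polynomial_on_circle:
  assumes "real_polynomial_function (g :: complex \<Rightarrow> real)"
  shows "\<exists>p. \<forall>z\<in>sphere 0 1. g z = Re (poly p z)"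
  using assms
proof induction
  case (linear f)
  then interpret bounded_linear f .
  have "f z = Re (poly [:0, Complex (f 1) (- f \<i>):] z)" for z
  proof -
    have "f z = f (Re z *\<^sub>R 1 + Im z *\<^sub>R \<i>)"
      by (metis complex_eq scaleR_conv_of_real mult.commute mult.right_neutral)
    then show ?thesis by (simp add: add scaleR)
  qed
  then show ?case by blast
next
  case (const c)
  show ?case by (rule exI[of _ "[:of_real c:]"]) simp
next
  case (add f g)
  then obtain p q where "\<forall>z\<in>sphere 0 1. f z = Re (poly p z)" "\<forall>z\<in>sphere 0 1. g z = Re (poly q z)"
    by blast
  then show ?case by (intro exI[of _ "p + q"]) simp
next
  case (mult f g)
  then show ?case using circle_Re_poly_mult by (metis (no_types, lifting))
qed

text \<open>For boundary values of harmonic polynomials the solution is known. The maximum principle turns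
  uniform approximation on the circle into uniform approximation on the closed disc, so that the
  solutions for approximating polynomials converge.\<close>

lemma Dirichlet_unit_disc:
  fixes g :: "complex \<Rightarrow> real"
  assumes "continuous_on (sphere 0 1) g"
  obtains h F where "continuous_on (cball 0 1) h" "\<And>z. z \<in> sphere 0 1 \<Longrightarrow> h z = g z"
    "F holomorphic_on ball 0 1" "\<And>z. z \<in> ball 0 1 \<Longrightarrow> h z = Re (F z)"
proof -
  have "\<exists>p. \<forall>z\<in>sphere 0 1. \<bar>g z - Re (poly p z)\<bar> < inverse (real (Suc n))" for n
    by (metis Stone_Weierstrass_real_polynomial_function[OF compact_sphere assms]
        real_polynomial_on_circle inverse_positive_iff_positive of_nat_0_less_iff zero_less_Suc)
  then obtain p where p: "\<And>n z. z \<in> sphere 0 1 \<Longrightarrow> \<bar>g z - Re (poly (p n) z)\<bar> < inverse (real (Suc n))"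
    by metis
  have mp: "Re (poly q z) \<le> B"
    if "z \<in> cball 0 1" and "\<And>z. z \<in> sphere 0 1 \<Longrightarrow> Re (poly q z) \<le> B" for q B and z :: complex
    by (rule maximum_real_frontier[of "poly q" "cball 0 1"])
       (use that in \<open>auto intro!: continuous_intros holomorphic_intros\<close>)
  have mp2: "\<bar>Re (poly q z) - Re (poly q' z)\<bar> \<le> B"
    if "z \<in> cball 0 1" and "\<And>z. z \<in> sphere 0 1 \<Longrightarrow> \<bar>Re (poly q z) - Re (poly q' z)\<bar> \<le> B"
    for q q' B and z :: complex
    using mp[OF that(1), of "q - q'" B] mp[OF that(1), of "q' - q" B] that(2)
    by (fastforce simp: abs_le_iff)
  have "uniformly_Cauchy_on (cball 0 1) (\<lambda>n z. Re (poly (p n) z))"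
  proof (rule uniformly_Cauchy_onI)
    fix e :: real assume "e > 0"
    obtain N where N: "inverse (real (Suc N)) < e / 2"
      using \<open>e > 0\<close> reals_Archimedean half_gt_zero by blast
    have "dist (Re (poly (p m) z)) (Re (poly (p n) z)) < e"
      if "z \<in> cball 0 1" "m \<ge> N" "n \<ge> N" for z m n
    proof -
      have "\<bar>Re (poly (p m) z) - Re (poly (p n) z)\<bar> \<le> 2 * inverse (real (Suc N))"
      proof (rule mp2[OF that(1)])
        fix w :: complex assume "w \<in> sphere 0 1"
        have "inverse (real (Suc m)) \<le> inverse (real (Suc N))" "inverse (real (Suc n)) \<le> inverse (real (Suc N))"
          using that by (auto intro!: le_imp_inverse_le)
        with p[OF \<open>w \<in> sphere 0 1\<close>, of m] p[OF \<open>w \<in> sphere 0 1\<close>, of n]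
        show "\<bar>Re (poly (p m) w) - Re (poly (p n) w)\<bar> \<le> 2 * inverse (real (Suc N))" by linarith
      qed
      with N show ?thesis by (simp add: dist_real_def)
    qed
    then show "\<exists>M. \<forall>x\<in>cball 0 1. \<forall>m\<ge>M. \<forall>n\<ge>M. dist (Re (poly (p m) x)) (Re (poly (p n) x)) < e"
      by blast
  qed
  then obtain h where h: "uniform_limit (cball 0 1) (\<lambda>n z. Re (poly (p n) z)) h sequentially"
    using uniformly_convergent_on_def Cauchy_uniformly_convergent by blast
  have hlim: "(\<lambda>n. Re (poly (p n) z)) \<longlonglongrightarrow> h z" if "z \<in> cball 0 1" for z
    using tendsto_uniform_limitI[OF h that] .
  have conth: "continuous_on (cball 0 1) h"
    by (rule uniform_limit_theorem[OF _ h]) (auto intro!: always_eventually continuous_intros)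
  obtain M where M: "\<And>z. z \<in> sphere 0 1 \<Longrightarrow> \<bar>g z\<bar> \<le> M"
    using compact_imp_bounded[OF compact_continuous_image[OF assms compact_sphere]]
    unfolding bounded_iff by (metis imageI real_norm_def)
  have low: "- (M + 1) \<le> Re (poly (p n) z)" if "z \<in> cball 0 1" for n z
  proof -
    have "Re (poly (- p n) z) \<le> M + 1"
    proof (rule mp[OF that])
      fix w :: complex assume w: "w \<in> sphere 0 1"
      have "inverse (real (Suc n)) \<le> 1"
        by (simp add: inverse_le_1_iff)
      with p[OF w, of n] M[OF w] show "Re (poly (- p n) w) \<le> M + 1" by simp
    qed
    then show ?thesis by simp
  qed
  obtain F where F: "F holomorphic_on ball 0 1" "\<And>z. z \<in> ball 0 1 \<Longrightarrow> h z = Re (F z)"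
    by (rule Re_holomorphic_limit[of "\<lambda>n. poly (p n)" 0 1 "- (M + 1)" h])
       (use low hlim in \<open>auto intro!: holomorphic_intros simp: less_eq_real_def\<close>)
  have "h z = g z" if z: "z \<in> sphere 0 1" for z
  proof (rule LIMSEQ_unique)
    show "(\<lambda>n. Re (poly (p n) z)) \<longlonglongrightarrow> h z" using hlim z by auto
    have "(\<lambda>n. Re (poly (p n) z) - g z) \<longlonglongrightarrow> 0"
      by (rule tendsto_norm_zero_cancel, rule tendsto_sandwich[OF _ _ tendsto_const LIMSEQ_inverse_real_of_nat])
         (use p[OF z] in \<open>auto intro!: always_eventually simp: abs_minus_commute less_imp_le simp del: of_nat_Suc\<close>)
    then show "(\<lambda>n. Re (poly (p n) z)) \<longlonglongrightarrow> g z"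
      by (simp add: LIM_zero_iff)
  qed
  with conth F show thesis using that by blast
qed

proposition Dirichlet_disc:
  fixes g :: "complex \<Rightarrow> real"
  assumes r: "r > 0" and g: "continuous_on (sphere a r) g"
  obtains h F where "continuous_on (cball a r) h" "\<And>z. z \<in> sphere a r \<Longrightarrow> h z = g z"
    "F holomorphic_on ball a r" "\<And>z. z \<in> ball a r \<Longrightarrow> h z = Re (F z)"
proof -
  define A where "A z = a + of_real r * z" for z
  define S where "S w = (w - a) / of_real r" for w
  have AS: "A (S w) = w" for w using r by (simp add: A_def S_def)
  have Anorm: "dist a (A z) = r * norm z" for z
    using r by (simp add: A_def dist_norm norm_mult)
  have Snorm: "norm (S w) = dist a w / r" for w
    using r by (simp add: S_def dist_norm norm_divide norm_minus_commute)
  have "continuous_on (sphere 0 1) (g \<circ> A)"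
  proof (rule continuous_on_compose[OF _ continuous_on_subset[OF g]])
    show "continuous_on (sphere 0 1) A"
      unfolding A_def by (intro continuous_intros)
    show "A ` sphere 0 1 \<subseteq> sphere a r"
      using Anorm by auto
  qed
  then obtain h F where h: "continuous_on (cball 0 1) h" "\<And>z. z \<in> sphere 0 1 \<Longrightarrow> h z = (g \<circ> A) z"
    "F holomorphic_on ball 0 1" "\<And>z. z \<in> ball 0 1 \<Longrightarrow> h z = Re (F z)"
    using Dirichlet_unit_disc by blast
  have cS: "continuous_on X S" for X
    unfolding S_def using r by (intro continuous_intros) auto
  have hS: "S holomorphic_on X" for X
    unfolding S_def using r by (intro holomorphic_intros) auto
  have Sb: "S ` cball a r \<subseteq> cball 0 1" "S ` ball a r \<subseteq> ball 0 1"
    using r by (auto simp: Snorm)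
  show thesis
  proof
    show "continuous_on (cball a r) (h \<circ> S)"
      by (rule continuous_on_compose[OF cS continuous_on_subset[OF h(1) Sb(1)]])
    show "(F \<circ> S) holomorphic_on ball a r"
      using holomorphic_on_compose_gen[OF hS h(3) Sb(2)] by simp
    show "(h \<circ> S) z = g z" if "z \<in> sphere a r" for z
      using h(2)[of "S z"] that r AS Snorm[of z] by simp
    show "(h \<circ> S) z = Re ((F \<circ> S) z)" if "z \<in> ball a r" for z
    proof -
      have "S z \<in> ball 0 1" using that Sb(2) by blast
      then show ?thesis using h(4) by simp
    qed
  qed
qed

lemma second_derivative_local_max:
  fixes f :: "real \<Rightarrow> real"
  assumes d: "\<delta> > 0" and f': "\<And>t. \<bar>t\<bar> < \<delta> \<Longrightarrow> (f has_real_derivative f' t) (at t)"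
    and f'': "(f' has_real_derivative D) (at 0)" and max: "\<And>t. \<bar>t\<bar> < \<delta> \<Longrightarrow> f t \<le> f 0"
  shows "D \<le> 0"
proof (rule ccontr)
  assume "\<not> D \<le> 0"
  have "f' 0 = 0"
    by (rule DERIV_local_max[OF f'[of 0] d]) (use d max in auto)
  with DERIV_pos_inc_right[OF f''] \<open>\<not> D \<le> 0\<close> obtain e where e: "e > 0" "\<And>h. 0 < h \<Longrightarrow> h < e \<Longrightarrow> 0 < f' h"
    by auto
  define t where "t = min e \<delta> / 2"
  have t: "0 < t" "t < e" "t < \<delta>" using d e by (auto simp: t_def)
  obtain z where "0 < z" "z < t" "f t - f 0 = (t - 0) * f' z"
    using MVT2[of 0 t f f'] f' t by auto
  with e(2)[of z] t max[of t] show False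
    by (smt (verit) mult_pos_pos)
qed

text \<open>The two notions of harmonicity agree on open sets in the plane. Real parts of holomorphic functions
  are the convenient one: they are preserved by holomorphic changes of coordinates, and pass to
  limits by \<open>Re_holomorphic_limit\<close>.\<close>

definition locally_Re :: "(complex \<Rightarrow> real) \<Rightarrow> complex set \<Rightarrow> bool" where
  "locally_Re u T \<longleftrightarrow> (\<forall>z\<in>T. \<exists>r>0. \<exists>F. F holomorphic_on ball z r \<and> (\<forall>w\<in>ball z r. u w = Re (F w)))"

lemma has_derivative_Re_holomorphic:
  assumes "F holomorphic_on T" "open T" "z \<in> T" "\<And>w. w \<in> T \<Longrightarrow> u w = Re (F w)"
  shows "(u has_derivative (\<lambda>v. Re (deriv F z * v))) (at z)"
proof -
  have "(F has_derivative (\<lambda>v. deriv F z * v)) (at z)"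
    using holomorphic_derivI[OF assms(1-3)] by (simp add: has_field_derivative_def)
  then have "((\<lambda>w. Re (F w)) has_derivative (\<lambda>v. Re (deriv F z * v))) (at z)"
    by (rule has_derivative_Re)
  then show ?thesis
    by (rule has_derivative_transform_within_open[OF _ assms(2,3)]) (use assms in auto)
qed

lemma partial_deriv_Re_holomorphic:
  assumes "F holomorphic_on T" "open T" "z \<in> T" "\<And>w. w \<in> T \<Longrightarrow> u w = Re (F w)"
  shows "partial_deriv v u z = Re (deriv F z * v)"
  unfolding partial_deriv_def
  by (rule fun_cong[OF frechet_derivative_at[OF has_derivative_Re_holomorphic], symmetric])
     (use assms in auto)

lemma locally_Re_partial_deriv:
  assumes "locally_Re u T"
  shows "locally_Re (partial_deriv v u) T"
  unfolding locally_Re_def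
proof
  fix z assume "z \<in> T"
  then obtain r F where r: "r > 0" "F holomorphic_on ball z r" "\<And>w. w \<in> ball z r \<Longrightarrow> u w = Re (F w)"
    using assms unfolding locally_Re_def by metis
  show "\<exists>r>0. \<exists>F. F holomorphic_on ball z r \<and> (\<forall>w\<in>ball z r. partial_deriv v u w = Re (F w))"
  proof (intro exI conjI ballI)
    show "(\<lambda>w. deriv F w * v) holomorphic_on ball z r"
      using r by (intro holomorphic_intros) auto
    show "partial_deriv v u w = Re (deriv F w * v)" if "w \<in> ball z r" for w
      by (rule partial_deriv_Re_holomorphic[OF r(2) _ that]) (use r in auto)
  qed (use r in auto)
qed

lemma locally_Re_has_derivative:
  assumes "locally_Re u T" "z \<in> T"
  shows "(u has_derivative (\<lambda>v. partial_deriv v u z)) (at z)"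
proof -
  obtain r F where r: "r > 0" "F holomorphic_on ball z r" "\<And>w. w \<in> ball z r \<Longrightarrow> u w = Re (F w)"
    using assms unfolding locally_Re_def by metis
  have *: "(u has_derivative (\<lambda>v. Re (deriv F z * v))) (at z)"
    by (rule has_derivative_Re_holomorphic[OF r(2)]) (use r in auto)
  then show ?thesis
    using frechet_derivative_at[OF *] by (simp add: partial_deriv_def)
qed

lemma locally_Re_Ck: "locally_Re u T \<Longrightarrow> Ck_on k u T"
proof (induction k arbitrary: u)
  case 0
  then show ?case
    using locally_Re_has_derivative
    by (auto intro!: continuous_at_imp_continuous_on has_derivative_continuous)
next
  case (Suc k)
  then show ?case
    using locally_Re_has_derivative[OF Suc.prems] locally_Re_partial_deriv[OF Suc.prems]
    by (auto simp: differentiable_def partial_deriv_def[abs_def])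
qed

lemma laplacian_Re_holomorphic:
  assumes "F holomorphic_on T" "open T" "z \<in> T" "\<And>w. w \<in> T \<Longrightarrow> u w = Re (F w)"
  shows "laplacian u z = 0"
proof -
  have 1: "partial_deriv v u w = Re (deriv F w * v)" if "w \<in> T" for v w
    using partial_deriv_Re_holomorphic[OF assms(1,2) that assms(4)] by blast
  have "partial_deriv v (partial_deriv v u) z = Re (deriv (\<lambda>w. deriv F w * v) z * v)" for v
    by (rule partial_deriv_Re_holomorphic[OF _ assms(2,3)])
       (use 1 assms in \<open>auto intro!: holomorphic_intros\<close>)
  moreover have "deriv (\<lambda>w. deriv F w * v) z = deriv (deriv F) z * v" for v
    using assms holomorphic_deriv[OF assms(1,2)] holomorphic_on_imp_differentiable_at
    by (intro deriv_cmult_right) blast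
  ultimately show ?thesis
    by (simp add: laplacian_def)
qed

lemma harmonic_on_locally_Re:
  assumes "locally_Re u T"
  shows "harmonic_on u T"
  unfolding harmonic_on_def
proof (intro conjI ballI locally_Re_Ck assms)
  fix z assume "z \<in> T"
  then obtain r F where r: "r > 0" "F holomorphic_on ball z r" "\<And>w. w \<in> ball z r \<Longrightarrow> u w = Re (F w)"
    using assms unfolding locally_Re_def by metis
  then show "laplacian u z = 0"
    by (intro laplacian_Re_holomorphic[of F "ball z r"]) auto
qed

lemma C2_has_derivative:
  assumes "Ck_on 2 u S" "z \<in> S"
  shows "(u has_derivative (\<lambda>v. partial_deriv v u z)) (at z)"
    and "(partial_deriv w u has_derivative (\<lambda>v. partial_deriv v (partial_deriv w u) z)) (at z)"
proof -
  have "u differentiable (at z)" "partial_deriv w u differentiable (at z)"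
    using assms by (auto simp: numeral_2_eq_2 partial_deriv_def[abs_def])
  then show "(u has_derivative (\<lambda>v. partial_deriv v u z)) (at z)"
    "(partial_deriv w u has_derivative (\<lambda>v. partial_deriv v (partial_deriv w u) z)) (at z)"
    using frechet_derivative_works by (auto simp: partial_deriv_def[abs_def])
qed

lemma has_derivative_along_line:
  assumes "(u has_derivative D) (at (z + of_real t * v))"
  shows "((\<lambda>t. u (z + of_real t * v)) has_real_derivative D v) (at t)"
proof -
  have "((\<lambda>t. z + of_real t * v) has_derivative (\<lambda>s. of_real s * v)) (at t)"
    using has_derivative_add[OF has_derivative_const
        bounded_linear_imp_has_derivative[OF bounded_linear_scaleR_left[of v]]]
    by (simp add: scaleR_conv_of_real)
  then have "((\<lambda>t. u (z + of_real t * v)) has_derivative (\<lambda>s. D (of_real s * v))) (at t)"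
    using has_derivative_compose assms by blast
  moreover have "D (of_real s * v) = D v * s" for s
    using has_derivative_bounded_linear[OF assms] linear_scale[OF bounded_linear.linear, of D s v]
    by (simp add: scaleR_conv_of_real)
  ultimately show ?thesis by (simp add: has_field_derivative_def)
qed

text \<open>Conversely, a \<open>C\<^sup>2\<close> function with vanishing Laplacian agrees on a disc with the solution of
  the Dirichlet problem: the difference \<open>d\<close> cannot be positive at an interior point, since
  otherwise \<open>d + \<epsilon> \<bar>z - a\<bar>\<^sup>2\<close> would have an interior maximum for small \<open>\<epsilon>\<close>, although its Laplacian
  is \<open>4 \<epsilon> > 0\<close>.\<close>

lemma harmonic_le_on_disc:
  assumes u: "Ck_on 2 u S" "Ck_on 2 h S" and lap: "\<And>z. z \<in> S \<Longrightarrow> laplacian u z = laplacian h z"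
    and S: "ball a r \<subseteq> S" and r: "r > 0"
    and cont: "continuous_on (cball a r) u" "continuous_on (cball a r) h"
    and bd: "\<And>z. z \<in> sphere a r \<Longrightarrow> u z \<le> h z" and z: "z \<in> cball a r"
  shows "u z \<le> h z"
proof (rule ccontr)
  assume less: "\<not> u z \<le> h z"
  define \<epsilon> where "\<epsilon> = (u z - h z) / (2 * r\<^sup>2)"
  have \<epsilon>: "\<epsilon> > 0" "\<epsilon> * r\<^sup>2 < u z - h z" using less r by (auto simp: \<epsilon>_def)
  define w where "w x = u x - h x + \<epsilon> * ((x - a) \<bullet> (x - a))" for x
  have "continuous_on (cball a r) w"
    unfolding w_def by (intro continuous_intros cont)
  then obtain m where m: "m \<in> cball a r" "\<And>x. x \<in> cball a r \<Longrightarrow> w x \<le> w m"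
    using continuous_attains_sup[of "cball a r" w] r by auto
  have "m \<notin> sphere a r"
  proof
    assume ms: "m \<in> sphere a r"
    then have "w m \<le> \<epsilon> * r\<^sup>2"
      using bd[OF ms] by (simp add: w_def dot_square_norm dist_norm norm_minus_commute)
    moreover have "w z \<ge> u z - h z" using \<epsilon> by (simp add: w_def)
    ultimately show False using m(2)[OF z] \<epsilon> by simp
  qed
  then have mb: "m \<in> ball a r" using m by auto
  then obtain \<delta> where \<delta>: "\<delta> > 0" "ball m \<delta> \<subseteq> ball a r"
    by (meson open_ball open_contains_ball)
  have le0: "partial_deriv v (partial_deriv v u) m - partial_deriv v (partial_deriv v h) m + 2 * \<epsilon> \<le> 0"
    if v: "norm v = 1" for v
  proof (rule second_derivative_local_max[OF \<delta>(1)])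
    define f where "f t = w (m + of_real t * v)" for t
    define f' where "f' t = partial_deriv v u (m + of_real t * v) - partial_deriv v h (m + of_real t * v)
      + \<epsilon> * (2 * ((m + of_real t * v - a) \<bullet> v))" for t
    have line: "((\<lambda>t. k (m + of_real t * v)) has_real_derivative partial_deriv v k (m + of_real t * v)) (at t)"
      "((\<lambda>t. partial_deriv v k (m + of_real t * v)) has_real_derivative
          partial_deriv v (partial_deriv v k) (m + of_real t * v)) (at t)"
      if "Ck_on 2 k S" "\<bar>t\<bar> < \<delta>" for k t
    proof -
      have "m + of_real t * v \<in> ball m \<delta>"
        using that v by (simp add: dist_norm norm_mult)
      then have "m + of_real t * v \<in> S" using \<delta> S by blast
      from C2_has_derivative[OF that(1) this] show
        "((\<lambda>t. k (m + of_real t * v)) has_real_derivative partial_deriv v k (m + of_real t * v)) (at t)"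
        "((\<lambda>t. partial_deriv v k (m + of_real t * v)) has_real_derivative
          partial_deriv v (partial_deriv v k) (m + of_real t * v)) (at t)"
        using has_derivative_along_line by blast+
    qed
    have ip: "((\<lambda>t. (m + of_real t * v - a) \<bullet> y) has_real_derivative v \<bullet> y) (at t)" for t y
      by (simp add: inner_add_left inner_diff_left inner_mult_left scaleR_conv_of_real[symmetric])
         (auto intro!: derivative_eq_intros)
    have vv: "v \<bullet> v = 1" using v by (simp add: dot_square_norm)
    have shift: "m + of_real t * v - a = (m - a) + t *\<^sub>R v" for t
      by (simp add: scaleR_conv_of_real)
    have quad: "(m + of_real t * v - a) \<bullet> (m + of_real t * v - a) =
       (m - a) \<bullet> (m - a) + 2 * t * ((m - a) \<bullet> v) + t\<^sup>2" for t
      unfolding shift inner_add_left inner_add_right inner_scaleR_left inner_scaleR_right vv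
      by (simp add: inner_commute power2_eq_square algebra_simps)
    have lin: "(m + of_real t * v - a) \<bullet> v = (m - a) \<bullet> v + t" for t
      unfolding shift inner_add_left inner_scaleR_left vv by simp
    show "(f has_real_derivative f' t) (at t)" if "\<bar>t\<bar> < \<delta>" for t
      unfolding f_def w_def f'_def quad lin
      by (auto intro!: derivative_eq_intros line u that)
    show "(f' has_real_derivative partial_deriv v (partial_deriv v u) m
        - partial_deriv v (partial_deriv v h) m + 2 * \<epsilon>) (at 0)"
      unfolding f'_def lin
      using line(2)[OF u(1), of 0] line(2)[OF u(2), of 0] \<delta>
      by (auto intro!: derivative_eq_intros)
    show "f t \<le> f 0" if "\<bar>t\<bar> < \<delta>" for t
    proof -
      have "m + of_real t * v \<in> ball m \<delta>"
        using that v by (simp add: dist_norm norm_mult)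
      then show ?thesis using \<delta> m(2) by (auto simp: f_def)
    qed
  qed
  have "m \<in> S" using mb S by auto
  have "laplacian u m - laplacian h m + 4 * \<epsilon> \<le> 0"
    using le0[of 1] le0[of \<i>] by (simp add: laplacian_def)
  then show False using lap[OF \<open>m \<in> S\<close>] \<epsilon> by simp
qed

lemma harmonic_on_imp_locally_Re:
  assumes u: "harmonic_on u S" and S: "open S"
  shows "locally_Re u S"
  unfolding locally_Re_def
proof
  fix a assume "a \<in> S"
  then obtain r where r: "r > 0" "cball a r \<subseteq> S" using S open_contains_cball by blast
  have contS: "continuous_on S u"
    using u by (auto simp: harmonic_on_def intro!: continuous_at_imp_continuous_on
        has_derivative_continuous[OF C2_has_derivative(1)])
  then have cont: "continuous_on (cball a r) u"
    using r continuous_on_subset by blast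
  then have "continuous_on (sphere a r) u"
    by (rule continuous_on_subset) auto
  then obtain h F where h: "continuous_on (cball a r) h" "\<And>z. z \<in> sphere a r \<Longrightarrow> h z = u z"
    and F: "F holomorphic_on ball a r" "\<And>z. z \<in> ball a r \<Longrightarrow> h z = Re (F z)"
    using Dirichlet_disc r by blast
  have "locally_Re h (ball a r)"
    unfolding locally_Re_def
  proof
    fix z assume "z \<in> ball a r"
    then obtain \<delta> where "\<delta> > 0" "ball z \<delta> \<subseteq> ball a r"
      by (meson open_ball open_contains_ball)
    then show "\<exists>r>0. \<exists>F. F holomorphic_on ball z r \<and> (\<forall>w\<in>ball z r. h w = Re (F w))"
      using F holomorphic_on_subset by blast
  qed
  then have hh: "harmonic_on h (ball a r)" by (rule harmonic_on_locally_Re)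
  have Ck_sub: "Ck_on k v S' \<Longrightarrow> S'' \<subseteq> S' \<Longrightarrow> Ck_on k v S''" for k S' S'' and v :: "complex \<Rightarrow> real"
    by (induction k arbitrary: v) (auto intro: continuous_on_subset)
  have "ball a r \<subseteq> S" using r ball_subset_cball[of a r] by blast
  then have C2: "Ck_on 2 u (ball a r)" "Ck_on 2 h (ball a r)"
    using u hh Ck_sub[of 2 u S "ball a r"] unfolding harmonic_on_def by blast+
  have lap: "laplacian u z = laplacian h z" if "z \<in> ball a r" for z
    using u hh that \<open>ball a r \<subseteq> S\<close> unfolding harmonic_on_def by (metis subsetD)
  have "u z = h z" if "z \<in> ball a r" for z
  proof (rule antisym)
    show "u z \<le> h z"
      by (rule harmonic_le_on_disc[OF C2 lap order_refl r(1) cont h(1)]) (use h that in auto)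
    show "h z \<le> u z"
      by (rule harmonic_le_on_disc[OF C2(2,1) lap[symmetric] order_refl r(1) h(1) cont]) (use h that in auto)
  qed
  then show "\<exists>r>0. \<exists>F. F holomorphic_on ball a r \<and> (\<forall>w\<in>ball a r. u w = Re (F w))"
    using F r by (intro exI[of _ r] conjI exI[of _ F] ballI) auto
qed

section \<open>Superharmonic functions and the Perron method on a Riemann surface\<close>

context riemann_surface
begin

text \<open>The charts of the maximal atlas. They are needed besides the given atlas because a local coordinate
  at a point is a chart of this kind.\<close>

definition compatible_chart :: "'a chart \<Rightarrow> bool" where
  "compatible_chart C \<longleftrightarrow> topological_chart M C \<and> (\<forall>C'\<in>atlas. holomorphically_compatible C C')"

abbreviation hol :: "('a \<Rightarrow> complex) \<Rightarrow> 'a set \<Rightarrow> bool" where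
  "hol \<equiv> holomorphic_on_surface atlas"

lemma compatible_chart_atlas: "C \<in> atlas \<Longrightarrow> compatible_chart C"
  using charts compatible by (auto simp: compatible_chart_def)

lemma
  assumes "compatible_chart (U, \<phi>)"
  shows compatible_chart_open: "open U" and compatible_chart_sub: "U \<subseteq> M" and compatible_chart_image: "open (\<phi> ` U)"
    and compatible_chart_homeo: "homeomorphism U (\<phi> ` U) \<phi> (inv_into U \<phi>)"
  using assms by (auto simp: compatible_chart_def topological_chart_def)

lemma compatible_chart_inv: "compatible_chart (U, \<phi>) \<Longrightarrow> x \<in> U \<Longrightarrow> inv_into U \<phi> (\<phi> x) = x"
  using compatible_chart_homeo by (auto simp: homeomorphism_def)

lemma compatible_chart_inj: "compatible_chart (U, \<phi>) \<Longrightarrow> x \<in> U \<Longrightarrow> y \<in> U \<Longrightarrow> \<phi> x = \<phi> y \<Longrightarrow> x = y"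
  using compatible_chart_inv by metis

lemma compatible_chart_cont: "compatible_chart (U, \<phi>) \<Longrightarrow> continuous_on U \<phi>"
  using compatible_chart_homeo by (auto simp: homeomorphism_def)

lemma compatible_chart_inv_cont: "compatible_chart (U, \<phi>) \<Longrightarrow> continuous_on (\<phi> ` U) (inv_into U \<phi>)"
  using compatible_chart_homeo by (auto simp: homeomorphism_def)

lemma compatible_chart_open_image:
  assumes "compatible_chart (U, \<phi>)" "open N"
  shows "open (\<phi> ` (U \<inter> N))"
proof -
  have "\<phi> ` (U \<inter> N) = \<phi> ` U \<inter> inv_into U \<phi> -` N"
    using compatible_chart_inv[OF assms(1)] by force
  then show ?thesis
    using continuous_on_open_vimage[OF compatible_chart_image[OF assms(1)]] compatible_chart_inv_cont[OF assms(1)] assms(2)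
    by (metis inf_commute)
qed

lemma compatible_chart_open_vimage:
  assumes "compatible_chart (U, \<phi>)" "open S"
  shows "open (U \<inter> \<phi> -` S)"
  using continuous_on_open_vimage[OF compatible_chart_open[OF assms(1)]] compatible_chart_cont[OF assms(1)] assms(2)
  by (metis inf_commute)

lemma compatible_chart_inv_image_open:
  assumes C: "compatible_chart (U, \<phi>)" and "open S" "S \<subseteq> \<phi> ` U"
  shows "open (inv_into U \<phi> ` S)"
proof -
  have "inv_into U \<phi> ` S = U \<inter> \<phi> -` S"
    using compatible_chart_inv[OF C] assms(3) by (force simp: f_inv_into_f)
  then show ?thesis using compatible_chart_open_vimage[OF C assms(2)] by simp
qed

lemma atlas_at:
  assumes "x \<in> M" obtains U \<phi> where "(U, \<phi>) \<in> atlas" "x \<in> U"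
  using assms covers by blast

lemma hol_subset: "hol f W \<Longrightarrow> W' \<subseteq> W \<Longrightarrow> hol f W'"
  unfolding holomorphic_on_surface_def
  by (force intro: holomorphic_on_subset)

lemma hol_cong:
  assumes "\<And>x. x \<in> W \<Longrightarrow> f x = g x" shows "hol f W \<longleftrightarrow> hol g W"
proof -
  have "(f \<circ> inv_into U \<phi>) holomorphic_on \<phi> ` (U \<inter> W) \<longleftrightarrow> (g \<circ> inv_into U \<phi>) holomorphic_on \<phi> ` (U \<inter> W)"
    if "(U, \<phi>) \<in> atlas" for U \<phi>
    by (rule holomorphic_cong) (use assms compatible_chart_inv[OF compatible_chart_atlas[OF that]] in auto)
  then show ?thesis unfolding holomorphic_on_surface_def by auto
qed

lemma hol_local:
  assumes "\<And>x. x \<in> W \<Longrightarrow> \<exists>N. open N \<and> x \<in> N \<and> hol f N"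
  shows "hol f W"
  unfolding holomorphic_on_surface_def
proof safe
  fix U \<phi> assume U: "(U, \<phi>) \<in> atlas"
  show "(f \<circ> inv_into U \<phi>) holomorphic_on \<phi> ` (U \<inter> W)"
    unfolding holomorphic_on_def
  proof (safe)
    fix x assume x: "x \<in> U" "x \<in> W"
    then obtain N where N: "open N" "x \<in> N" "hol f N" using assms by blast
    then have "(f \<circ> inv_into U \<phi>) holomorphic_on \<phi> ` (U \<inter> N)"
      using U unfolding holomorphic_on_surface_def by blast
    then have "(f \<circ> inv_into U \<phi>) field_differentiable at (\<phi> x)"
      using compatible_chart_open_image[OF compatible_chart_atlas[OF U] N(1)] x N(2)
      by (auto simp: holomorphic_on_open field_differentiable_def)
    then show "(f \<circ> inv_into U \<phi>) field_differentiable at (\<phi> x) within \<phi> ` (U \<inter> W)"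
      by (rule field_differentiable_at_within)
  qed
qed

text \<open>Holomorphy is tested by the charts of the atlas; by compatibility it may be read off in any
  chart of the maximal atlas.\<close>

lemma hol_compatible_chart:
  assumes C: "compatible_chart (U, \<phi>)" and N: "open N" "N \<subseteq> M" and f: "hol f N"
  shows "(f \<circ> inv_into U \<phi>) holomorphic_on \<phi> ` (U \<inter> N)"
  unfolding holomorphic_on_def
proof safe
  fix x assume x: "x \<in> U" "x \<in> N"
  obtain U' \<phi>' where A: "(U', \<phi>') \<in> atlas" "x \<in> U'" using atlas_at x N by blast
  have L: "compatible_chart (U', \<phi>')" using A compatible_chart_atlas by blast
  have 1: "(\<phi>' \<circ> inv_into U \<phi>) holomorphic_on \<phi> ` (U \<inter> U')"
    using C A unfolding compatible_chart_def holomorphically_compatible_def by blast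
  have 2: "(f \<circ> inv_into U' \<phi>') holomorphic_on \<phi>' ` (U' \<inter> N)"
    using f A unfolding holomorphic_on_surface_def by blast
  have "((f \<circ> inv_into U' \<phi>') \<circ> (\<phi>' \<circ> inv_into U \<phi>)) holomorphic_on \<phi> ` (U \<inter> (U' \<inter> N))"
    by (rule holomorphic_on_compose_gen[OF holomorphic_on_subset[OF 1] 2])
       (use compatible_chart_inv[OF C] in auto)
  then have "(f \<circ> inv_into U \<phi>) holomorphic_on \<phi> ` (U \<inter> (U' \<inter> N))"
    by (rule holomorphic_transform) (use compatible_chart_inv[OF C] compatible_chart_inv[OF L] in auto)
  moreover have "open (\<phi> ` (U \<inter> (U' \<inter> N)))"
    by (rule compatible_chart_open_image[OF C open_Int[OF compatible_chart_open[OF L] N(1)]])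
  ultimately have "(f \<circ> inv_into U \<phi>) field_differentiable at (\<phi> x)"
    using x A(2) by (auto simp: holomorphic_on_open field_differentiable_def)
  then show "(f \<circ> inv_into U \<phi>) field_differentiable at (\<phi> x) within \<phi> ` (U \<inter> N)"
    by (rule field_differentiable_at_within)
qed

lemma hol_of_compatible_chart:
  assumes C: "compatible_chart (U, \<phi>)" and F: "F holomorphic_on S" and N: "N \<subseteq> U" "\<phi> ` N \<subseteq> S"
  shows "hol (F \<circ> \<phi>) N"
  unfolding holomorphic_on_surface_def
proof safe
  fix U' \<phi>' assume A: "(U', \<phi>') \<in> atlas"
  have 1: "(\<phi> \<circ> inv_into U' \<phi>') holomorphic_on \<phi>' ` (U \<inter> U')"
    using C A unfolding compatible_chart_def holomorphically_compatible_def by blast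
  have "(F \<circ> (\<phi> \<circ> inv_into U' \<phi>')) holomorphic_on \<phi>' ` (U' \<inter> N)"
    by (rule holomorphic_on_compose_gen[OF holomorphic_on_subset[OF 1] F])
       (use N compatible_chart_inv[OF compatible_chart_atlas[OF A]] in auto)
  then show "(F \<circ> \<phi> \<circ> inv_into U' \<phi>') holomorphic_on \<phi>' ` (U' \<inter> N)"
    by (simp add: o_assoc)
qed

lemma hol_chart: "compatible_chart (U, \<phi>) \<Longrightarrow> N \<subseteq> U \<Longrightarrow> hol \<phi> N"
  using hol_of_compatible_chart[of U \<phi> id UNIV N] by simp

lemma hol_compose:
  assumes "hol f W" "F holomorphic_on S" "f ` W \<subseteq> S"
  shows "hol (\<lambda>x. F (f x)) W"
  unfolding holomorphic_on_surface_def
proof safe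
  fix U \<phi> assume U: "(U, \<phi>) \<in> atlas"
  have "(F \<circ> (f \<circ> inv_into U \<phi>)) holomorphic_on \<phi> ` (U \<inter> W)"
    by (rule holomorphic_on_compose_gen[OF _ assms(2)])
       (use assms U compatible_chart_inv[OF compatible_chart_atlas[OF U]] in \<open>auto simp: holomorphic_on_surface_def\<close>)
  then show "((\<lambda>x. F (f x)) \<circ> inv_into U \<phi>) holomorphic_on \<phi> ` (U \<inter> W)"
    by (simp add: o_def)
qed

lemma hol_const: "hol (\<lambda>x. k) W"
  by (auto simp: holomorphic_on_surface_def o_def)

lemma hol_add: "hol f W \<Longrightarrow> hol g W \<Longrightarrow> hol (\<lambda>x. f x + g x) W"
  and hol_mult: "hol f W \<Longrightarrow> hol g W \<Longrightarrow> hol (\<lambda>x. f x * g x) W"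
  unfolding holomorphic_on_surface_def o_def by (auto intro!: holomorphic_intros)

lemma hol_isCont:
  assumes f: "hol f N" and N: "open N" "N \<subseteq> M" "x \<in> N"
  shows "isCont f x"
proof -
  obtain U \<phi> where A: "(U, \<phi>) \<in> atlas" "x \<in> U" using atlas_at N by blast
  have L: "compatible_chart (U, \<phi>)" using A compatible_chart_atlas by blast
  have "(f \<circ> inv_into U \<phi>) holomorphic_on \<phi> ` (U \<inter> N)"
    using f A unfolding holomorphic_on_surface_def by blast
  then have "continuous_on (U \<inter> N) ((f \<circ> inv_into U \<phi>) \<circ> \<phi>)"
    by (intro continuous_on_compose holomorphic_on_imp_continuous_on continuous_on_subset[OF compatible_chart_cont[OF L]]) auto
  then have "continuous_on (U \<inter> N) f"
    by (rule continuous_on_eq) (use compatible_chart_inv[OF L] in auto)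
  then show ?thesis
    using continuous_on_eq_continuous_at[of "U \<inter> N" f] compatible_chart_open[OF L] N A by blast
qed

text \<open>Harmonicity at a point is defined by real parts of holomorphic functions, which makes it
  evidently independent of coordinates.\<close>

definition harmonic_at :: "('a \<Rightarrow> real) \<Rightarrow> 'a \<Rightarrow> bool" where
  "harmonic_at h x \<longleftrightarrow> (\<exists>N f. open N \<and> x \<in> N \<and> N \<subseteq> M \<and> hol f N \<and> (\<forall>y\<in>N. h y = Re (f y)))"

lemma harmonic_atI: "open N \<Longrightarrow> x \<in> N \<Longrightarrow> N \<subseteq> M \<Longrightarrow> hol f N \<Longrightarrow> (\<And>y. y \<in> N \<Longrightarrow> h y = Re (f y)) \<Longrightarrow> harmonic_at h x"
  unfolding harmonic_at_def by blast

lemma harmonic_at_cong: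
  assumes "\<forall>\<^sub>F y in nhds x. h y = h' y" "harmonic_at h x"
  shows "harmonic_at h' x"
proof -
  obtain S where S: "open S" "x \<in> S" "\<And>y. y \<in> S \<Longrightarrow> h y = h' y"
    using assms(1) unfolding eventually_nhds by blast
  obtain N f where N: "open N" "x \<in> N" "N \<subseteq> M" "hol f N" "\<And>y. y \<in> N \<Longrightarrow> h y = Re (f y)"
    using assms(2) unfolding harmonic_at_def by blast
  show ?thesis
  proof (rule harmonic_atI[of "N \<inter> S" x f])
    show "h' y = Re (f y)" if "y \<in> N \<inter> S" for y
      using S(3)[of y] N(5)[of y] that by simp
  qed (use S(1,2) N(1-4) hol_subset[of f N] in auto)
qed

lemma harmonic_at_const: "x \<in> M \<Longrightarrow> harmonic_at (\<lambda>x. k) x"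
  by (rule harmonic_atI[of M x "\<lambda>x. of_real k"]) (auto simp: open_carrier hol_const)

lemma harmonic_at_add:
  assumes "harmonic_at h x" "harmonic_at h' x" shows "harmonic_at (\<lambda>x. h x + h' x) x"
proof -
  obtain N f where N: "open N" "x \<in> N" "N \<subseteq> M" "hol f N" "\<And>y. y \<in> N \<Longrightarrow> h y = Re (f y)"
    using assms(1) unfolding harmonic_at_def by blast
  obtain N' f' where N': "open N'" "x \<in> N'" "N' \<subseteq> M" "hol f' N'" "\<And>y. y \<in> N' \<Longrightarrow> h' y = Re (f' y)"
    using assms(2) unfolding harmonic_at_def by blast
  show ?thesis
    by (rule harmonic_atI[of "N \<inter> N'" x "\<lambda>x. f x + f' x"])
       (use N N' hol_subset[of f N] hol_subset[of f' N'] in \<open>auto intro!: hol_add\<close>)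
qed

lemma harmonic_at_cmult:
  assumes "harmonic_at h x" shows "harmonic_at (\<lambda>x. k * h x) x"
proof -
  obtain N f where N: "open N" "x \<in> N" "N \<subseteq> M" "hol f N" "\<And>y. y \<in> N \<Longrightarrow> h y = Re (f y)"
    using assms(1) unfolding harmonic_at_def by blast
  show ?thesis
    by (rule harmonic_atI[of N x "\<lambda>x. of_real k * f x"]) (use N in \<open>auto intro!: hol_mult hol_const\<close>)
qed

lemma harmonic_at_minus: "harmonic_at h x \<Longrightarrow> harmonic_at (\<lambda>x. - h x) x"
  using harmonic_at_cmult[of h x "-1"] by simp

lemma harmonic_at_diff: "harmonic_at h x \<Longrightarrow> harmonic_at h' x \<Longrightarrow> harmonic_at (\<lambda>x. h x - h' x) x"
  using harmonic_at_add[OF _ harmonic_at_minus, of h x h'] by simp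

lemma harmonic_at_isCont:
  assumes "harmonic_at h x" shows "isCont h x"
proof -
  obtain N f where N: "open N" "x \<in> N" "N \<subseteq> M" "hol f N" "\<And>y. y \<in> N \<Longrightarrow> h y = Re (f y)"
    using assms unfolding harmonic_at_def by blast
  have "isCont (\<lambda>y. Re (f y)) x"
    by (rule isCont_Re[OF hol_isCont[OF N(4,1,3,2)]])
  moreover have "\<forall>\<^sub>F y in nhds x. h y = Re (f y)"
    using N eventually_nhds by blast
  ultimately show ?thesis
    using isCont_cong[of h "\<lambda>y. Re (f y)" x] by blast
qed

lemma harmonic_at_ln:
  assumes N: "open N" "x \<in> N" "N \<subseteq> M" and f: "hol f N" "f x \<noteq> 0"
  shows "harmonic_at (\<lambda>y. ln (cmod (f y))) x"
proof -
  define d where "d = cmod (f x)"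
  have d: "d > 0" using f by (simp add: d_def)
  have cont: "continuous_on N f"
    using hol_isCont[OF f(1) N(1,3)] by (simp add: continuous_at_imp_continuous_on)
  define N' where "N' = f -` ball (f x) d \<inter> N"
  have N': "open N'" "x \<in> N'" "N' \<subseteq> M"
    using continuous_on_open_vimage[OF N(1)] cont N d by (auto simp: N'_def)
  have nz: "w \<noteq> 0" if "w \<in> ball (f x) d" for w
    using that by (auto simp: d_def)
  obtain l where l: "l holomorphic_on ball (f x) d" "\<And>w. w \<in> ball (f x) d \<Longrightarrow> w = exp (l w)"
    using contractible_imp_holomorphic_log[of "\<lambda>w. w" "ball (f x) d"] nz
    by (metis convex_ball convex_imp_contractible holomorphic_on_ident)
  show ?thesis
  proof (rule harmonic_atI[of N' x "\<lambda>y. l (f y)"])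
    show "hol (\<lambda>y. l (f y)) N'"
      by (rule hol_compose[OF hol_subset[OF f(1)] l(1)]) (auto simp: N'_def)
    show "ln (cmod (f y)) = Re (l (f y))" if "y \<in> N'" for y
    proof -
      have "f y = exp (l (f y))" using that l(2) by (simp add: N'_def)
      then have "cmod (f y) = exp (Re (l (f y)))" by (metis norm_exp_eq_Re)
      then show ?thesis by simp
    qed
  qed (use N' in auto)
qed

lemma harmonic_at_local_min:
  assumes h: "harmonic_at h x" and min: "\<forall>\<^sub>F y in nhds x. h x \<le> h y"
  shows "\<forall>\<^sub>F y in nhds x. h y = h x"
proof -
  obtain N f where N: "open N" "x \<in> N" "N \<subseteq> M" "hol f N" "\<And>y. y \<in> N \<Longrightarrow> h y = Re (f y)"
    using h unfolding harmonic_at_def by blast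
  obtain S where S: "open S" "x \<in> S" "\<And>y. y \<in> S \<Longrightarrow> h x \<le> h y"
    using min unfolding eventually_nhds by blast
  obtain U \<phi> where A: "(U, \<phi>) \<in> atlas" "x \<in> U" using atlas_at N by blast
  have L: "compatible_chart (U, \<phi>)" using A compatible_chart_atlas by blast
  have op: "open (\<phi> ` (U \<inter> (N \<inter> S)))"
    using compatible_chart_open_image[OF L] N S by blast
  moreover have "\<phi> x \<in> \<phi> ` (U \<inter> (N \<inter> S))" using A N S by blast
  ultimately obtain r where r: "r > 0" "ball (\<phi> x) r \<subseteq> \<phi> ` (U \<inter> (N \<inter> S))"
    by (rule openE)
  define e where "e w = exp (- f (inv_into U \<phi> w))" for w
  have "(f \<circ> inv_into U \<phi>) holomorphic_on ball (\<phi> x) r"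
    by (rule holomorphic_on_subset[OF hol_compatible_chart[OF L N(1,3,4)]]) (use r in auto)
  then have hole: "e holomorphic_on ball (\<phi> x) r"
    unfolding e_def o_def by (intro holomorphic_intros)
  have val: "cmod (e w) = exp (- h (inv_into U \<phi> w))" if "w \<in> ball (\<phi> x) r" for w
  proof -
    have "inv_into U \<phi> w \<in> N" using r(2) that compatible_chart_inv[OF L] by auto
    then show ?thesis using N(5) by (simp add: e_def)
  qed
  have "e constant_on ball (\<phi> x) r"
  proof (rule maximum_modulus_principle[OF hole _ _ _ order_refl])
    show "cmod (e w) \<le> cmod (e (\<phi> x))" if "w \<in> ball (\<phi> x) r" for w
    proof -
      have "inv_into U \<phi> w \<in> S" using r(2) that compatible_chart_inv[OF L] by auto
      then show ?thesis
        using S(3) val[OF that] val[of "\<phi> x"] r compatible_chart_inv[OF L A(2)] by simp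
    qed
  qed (use r in auto)
  then have const: "e w = e (\<phi> x)" if "w \<in> ball (\<phi> x) r" for w
    using that r unfolding constant_on_def by (metis centre_in_ball)
  have "h y = h x" if y: "y \<in> U \<inter> \<phi> -` ball (\<phi> x) r" for y
    using y val[of "\<phi> y"] val[of "\<phi> x"] const[of "\<phi> y"] r compatible_chart_inv[OF L] A(2) by simp
  moreover have "open (U \<inter> \<phi> -` ball (\<phi> x) r)"
    by (rule compatible_chart_open_vimage[OF L]) auto
  moreover have "x \<in> U \<inter> \<phi> -` ball (\<phi> x) r" using A(2) r by simp
  ultimately show ?thesis
    unfolding eventually_nhds by blast
qed

text \<open>The set where the minimum is attained is closed, and open by the local maximum modulus
  principle.\<close>

lemma harmonic_at_nonneg_zero:
  assumes D: "connected D" "open D" "x0 \<in> D" and h: "\<And>x. x \<in> D \<Longrightarrow> harmonic_at h x"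
    and nn: "\<And>x. x \<in> D \<Longrightarrow> c \<le> h x" and z: "h x0 = c" and y: "y \<in> D"
  shows "h y = c"
proof -
  define A where "A = {x \<in> D. h x = c}"
  have "open A"
    unfolding open_subopen[of A]
  proof
    fix x assume x: "x \<in> A"
    then have xD: "x \<in> D" "h x = c" by (auto simp: A_def)
    have "\<forall>\<^sub>F y in nhds x. y \<in> D" using D xD eventually_nhds by blast
    then have "\<forall>\<^sub>F y in nhds x. h x \<le> h y"
      by (rule eventually_mono) (use nn xD in auto)
    from harmonic_at_local_min[OF h[OF xD(1)] this] have "\<forall>\<^sub>F y in nhds x. y \<in> A"
      using \<open>\<forall>\<^sub>F y in nhds x. y \<in> D\<close> by eventually_elim (use xD in \<open>auto simp: A_def\<close>)
    then show "\<exists>T. open T \<and> x \<in> T \<and> T \<subseteq> A" unfolding eventually_nhds by blast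
  qed
  moreover have "open (D \<inter> h -` (- {c}))"
    using continuous_on_open_vimage[OF D(2)] h harmonic_at_isCont
    by (metis continuous_at_imp_continuous_on inf_commute open_delete open_UNIV Compl_eq_Diff_UNIV)
  moreover have "D \<subseteq> A \<union> (D \<inter> h -` (- {c}))" "A \<inter> (D \<inter> h -` (- {c})) \<inter> D = {}" "A \<inter> D \<noteq> {}"
    using D z by (auto simp: A_def)
  ultimately have "(D \<inter> h -` (- {c})) \<inter> D = {}"
    using connectedD[OF D(1)] by blast
  then show ?thesis using y by auto
qed

text \<open>Superharmonicity is expressed by the strict minimum principle against harmonic functions rather than
  by mean values over circles: mean values depend on the coordinate, whereas this form is invariant,
  and it is all that the Perron method uses. In \<open>superharmonic_at_dominated\<close> it yields at once that minima,
  gluings and modifications on discs are superharmonic.\<close>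

definition superharmonic_at :: "('a \<Rightarrow> real) \<Rightarrow> 'a \<Rightarrow> bool" where
  "superharmonic_at u x \<longleftrightarrow> (\<forall>h. harmonic_at h x \<and> (\<forall>\<^sub>F y in nhds x. u x - h x \<le> u y - h y) \<longrightarrow>
     (\<forall>\<^sub>F y in nhds x. u y - h y = u x - h x))"

lemma superharmonic_atD:
  "superharmonic_at u x \<Longrightarrow> harmonic_at h x \<Longrightarrow> \<forall>\<^sub>F y in nhds x. u x - h x \<le> u y - h y \<Longrightarrow>
   \<forall>\<^sub>F y in nhds x. u y - h y = u x - h x"
  by (simp add: superharmonic_at_def)

lemma harmonic_at_imp_superharmonic_at: "harmonic_at u x \<Longrightarrow> superharmonic_at u x"
  unfolding superharmonic_at_def using harmonic_at_local_min[OF harmonic_at_diff] by blast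

lemma superharmonic_at_dominated:
  assumes u: "superharmonic_at u x" and le: "\<forall>\<^sub>F y in nhds x. v y \<le> u y" and eq: "v x = u x"
  shows "superharmonic_at v x"
  unfolding superharmonic_at_def
proof (intro allI impI, elim conjE)
  fix h assume h: "harmonic_at h x" and m: "\<forall>\<^sub>F y in nhds x. v x - h x \<le> v y - h y"
  have "\<forall>\<^sub>F y in nhds x. u x - h x \<le> u y - h y"
    using m le by eventually_elim (use eq in linarith)
  then have "\<forall>\<^sub>F y in nhds x. u y - h y = u x - h x" by (rule superharmonic_atD[OF u h])
  then show "\<forall>\<^sub>F y in nhds x. v y - h y = v x - h x"
    using m le by eventually_elim (use eq in linarith)
qed

lemma superharmonic_at_cong:
  assumes "superharmonic_at u x" "\<forall>\<^sub>F y in nhds x. v y = u y"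
  shows "superharmonic_at v x"
  using assms eventually_nhds_x_imp_x[OF assms(2)]
  by (intro superharmonic_at_dominated[OF assms(1)]) (auto elim: eventually_mono)

lemma superharmonic_at_min:
  assumes "superharmonic_at u x" "superharmonic_at v x" shows "superharmonic_at (\<lambda>y. min (u y) (v y)) x"
proof (cases "u x \<le> v x")
  case True
  then show ?thesis by (intro superharmonic_at_dominated[OF assms(1)]) auto
next
  case False
  then show ?thesis by (intro superharmonic_at_dominated[OF assms(2)]) auto
qed

lemma superharmonic_at_add_harm:
  assumes u: "superharmonic_at u x" and k: "harmonic_at k x" shows "superharmonic_at (\<lambda>y. u y + k y) x"
  unfolding superharmonic_at_def
proof (intro allI impI, elim conjE)
  fix h assume h: "harmonic_at h x" and m: "\<forall>\<^sub>F y in nhds x. u x + k x - h x \<le> u y + k y - h y"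
  have "harmonic_at (\<lambda>y. h y - k y) x" by (rule harmonic_at_diff[OF h k])
  moreover have "\<forall>\<^sub>F y in nhds x. u x - (h x - k x) \<le> u y - (h y - k y)"
    using m by eventually_elim linarith
  ultimately have "\<forall>\<^sub>F y in nhds x. u y - (h y - k y) = u x - (h x - k x)"
    by (rule superharmonic_atD[OF u])
  then show "\<forall>\<^sub>F y in nhds x. u y + k y - h y = u x + k x - h x"
    by eventually_elim linarith
qed

lemma superharmonic_at_cmult:
  assumes u: "superharmonic_at u x" and k: "k > 0" shows "superharmonic_at (\<lambda>y. k * u y) x"
  unfolding superharmonic_at_def
proof (intro allI impI, elim conjE)
  fix h assume h: "harmonic_at h x" and m: "\<forall>\<^sub>F y in nhds x. k * u x - h x \<le> k * u y - h y"
  have "harmonic_at (\<lambda>y. (1/k) * h y) x" by (rule harmonic_at_cmult[OF h])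
  moreover have "\<forall>\<^sub>F y in nhds x. u x - (1/k) * h x \<le> u y - (1/k) * h y"
    using m
  proof eventually_elim
    case (elim y)
    then have "(1/k) * (k * u x - h x) \<le> (1/k) * (k * u y - h y)"
      by (rule mult_left_mono) (use k in simp)
    then show ?case using k by (simp add: right_diff_distrib)
  qed
  ultimately have "\<forall>\<^sub>F y in nhds x. u y - (1/k) * h y = u x - (1/k) * h x"
    by (rule superharmonic_atD[OF u])
  then show "\<forall>\<^sub>F y in nhds x. k * u y - h y = k * u x - h x"
    by eventually_elim (use k in \<open>simp add: field_simps\<close>)
qed

text \<open>If the minimum of \<open>u\<close> were less than \<open>c\<close>, the set where it is attained would be a nonempty
  subset of \<open>I\<close> that is open and closed in the connected set \<open>K\<close>.\<close>

lemma min_principle: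
  assumes K: "compact K" "connected K" and I: "I \<subseteq> K" "open I" "K - I \<noteq> {}" "I \<subseteq> M"
    and u: "continuous_on K u" "\<And>x. x \<in> I \<Longrightarrow> superharmonic_at u x" "\<And>x. x \<in> K - I \<Longrightarrow> c \<le> u x"
    and x: "x \<in> K"
  shows "c \<le> u x"
proof (rule ccontr)
  assume less: "\<not> c \<le> u x"
  obtain m where m: "m \<in> K" "\<And>y. y \<in> K \<Longrightarrow> u m \<le> u y"
    using continuous_attains_inf[OF K(1) _ u(1)] x by blast
  define A where "A = K \<inter> u -` {u m}"
  have AI: "A \<subseteq> I" using u(3) less m(2)[OF x] by (force simp: A_def)
  have "openin (top_of_set K) A"
  proof (subst openin_subopen, safe)
    fix y assume y: "y \<in> A"
    then have yI: "y \<in> I" and uy: "u y = u m" using AI by (auto simp: A_def)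
    have ev: "\<forall>\<^sub>F z in nhds y. z \<in> I" using yI I eventually_nhds by blast
    then have "\<forall>\<^sub>F z in nhds y. u y - 0 \<le> u z - 0"
      by (rule eventually_mono) (use m uy I in auto)
    moreover have "harmonic_at (\<lambda>x. 0) y" using harmonic_at_const yI I by blast
    ultimately have "\<forall>\<^sub>F z in nhds y. u z - 0 = u y - 0"
      by (intro superharmonic_atD[OF u(2)[OF yI]])
    with ev have "\<forall>\<^sub>F z in nhds y. z \<in> A"
      by eventually_elim (use uy I in \<open>auto simp: A_def\<close>)
    then obtain S where S: "open S" "y \<in> S" "S \<subseteq> A" unfolding eventually_nhds by blast
    then show "\<exists>T. openin (top_of_set K) T \<and> y \<in> T \<and> T \<subseteq> A"
      by (intro exI[of _ S] conjI open_subset) (auto simp: A_def)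
  qed
  moreover have "closedin (top_of_set K) A"
    unfolding A_def by (rule continuous_closedin_preimage[OF u(1)]) auto
  ultimately have "A = {} \<or> A = K" using K(2) connected_clopen by blast
  then show False using m(1) AI I by (auto simp: A_def)
qed

definition superharmonic_on :: "('a \<Rightarrow> real) \<Rightarrow> 'a set \<Rightarrow> bool" where
  "superharmonic_on u W \<longleftrightarrow> continuous_on W u \<and> (\<forall>x\<in>W. superharmonic_at u x)"

definition regular_disc :: "'a set \<Rightarrow> 'a set \<Rightarrow> bool" where
  "regular_disc D K \<longleftrightarrow> (\<exists>U \<phi> a r. compatible_chart (U, \<phi>) \<and> r > 0 \<and> cball a r \<subseteq> \<phi> ` U \<and>
     D = inv_into U \<phi> ` ball a r \<and> K = inv_into U \<phi> ` cball a r)"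

lemma regular_disc_ex:
  assumes "x \<in> M" "open N" "x \<in> N"
  obtains D K where "regular_disc D K" "x \<in> D" "K \<subseteq> N"
proof -
  obtain U \<phi> where A: "(U, \<phi>) \<in> atlas" "x \<in> U" using atlas_at assms by blast
  have L: "compatible_chart (U, \<phi>)" using A compatible_chart_atlas by blast
  obtain r where r: "r > 0" "cball (\<phi> x) r \<subseteq> \<phi> ` (U \<inter> N)"
    using compatible_chart_open_image[OF L assms(2)] A assms open_contains_cball by blast
  show thesis
  proof
    show "regular_disc (inv_into U \<phi> ` ball (\<phi> x) r) (inv_into U \<phi> ` cball (\<phi> x) r)"
      unfolding regular_disc_def using L r by blast
    show "x \<in> inv_into U \<phi> ` ball (\<phi> x) r"
      by (rule image_eqI[of _ _ "\<phi> x"]) (use compatible_chart_inv[OF L A(2)] r in auto)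
    show "inv_into U \<phi> ` cball (\<phi> x) r \<subseteq> N"
      using r compatible_chart_inv[OF L] by fastforce
  qed
qed

lemma
  assumes "regular_disc D K"
  shows regular_disc_open: "open D" and regular_disc_compact: "compact K"
    and regular_disc_connected: "connected D" "connected K"
    and regular_disc_sub: "D \<subseteq> K" "K \<subseteq> M" and regular_disc_boundary: "K - D \<noteq> {}"
proof -
  obtain U \<phi> a r where L: "compatible_chart (U, \<phi>)" and r: "r > 0" "cball a r \<subseteq> \<phi> ` U"
    and D: "D = inv_into U \<phi> ` ball a r" and K: "K = inv_into U \<phi> ` cball a r"
    using assms unfolding regular_disc_def by blast
  have bs: "ball a r \<subseteq> \<phi> ` U" using r ball_subset_cball[of a r] by blast
  show "open D" unfolding D by (rule compatible_chart_inv_image_open[OF L open_ball bs])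
  have cont: "continuous_on (cball a r) (inv_into U \<phi>)" "continuous_on (ball a r) (inv_into U \<phi>)"
    using continuous_on_subset[OF compatible_chart_inv_cont[OF L]] r bs by blast+
  show "compact K" unfolding K by (rule compact_continuous_image[OF cont(1) compact_cball])
  show "connected D" "connected K"
    unfolding D K using cont by (auto intro!: connected_continuous_image)
  show "D \<subseteq> K" unfolding D K by auto
  show "K \<subseteq> M" unfolding K using r compatible_chart_inv[OF L] compatible_chart_sub[OF L] by fastforce
  define b where "b = a + of_real r"
  have b: "b \<in> sphere a r" using r by (simp add: b_def dist_norm)
  then have "inv_into U \<phi> b \<notin> D"
    unfolding D using r bs by (auto dest!: inv_into_injective)
  moreover have "inv_into U \<phi> b \<in> K" unfolding K using b by auto
  ultimately show "K - D \<noteq> {}" by blast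
qed

lemma regular_disc_Dirichlet:
  assumes "regular_disc D K" "continuous_on K u"
  obtains h where "continuous_on K h" "\<And>x. x \<in> K - D \<Longrightarrow> h x = u x" "\<And>x. x \<in> D \<Longrightarrow> harmonic_at h x"
proof -
  obtain U \<phi> a r where L: "compatible_chart (U, \<phi>)" and r: "r > 0" "cball a r \<subseteq> \<phi> ` U"
    and D: "D = inv_into U \<phi> ` ball a r" and K: "K = inv_into U \<phi> ` cball a r"
    using assms unfolding regular_disc_def by blast
  have KU: "K \<subseteq> U" unfolding K using r compatible_chart_inv[OF L] by fastforce
  have im: "\<phi> x \<in> cball a r" if "x \<in> K" for x
    using that r unfolding K by (auto simp: f_inv_into_f subset_eq)
  have imD: "x \<in> D \<longleftrightarrow> \<phi> x \<in> ball a r" if "x \<in> K" for x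
    using that r KU compatible_chart_inv[OF L] unfolding K D
    by (smt (verit, ccfv_threshold) ball_subset_cball f_inv_into_f image_iff subset_eq)
  have "continuous_on (sphere a r) (u \<circ> inv_into U \<phi>)"
    by (intro continuous_on_compose continuous_on_subset[OF compatible_chart_inv_cont[OF L]]
        continuous_on_subset[OF assms(2)]) (use r in \<open>auto simp: K\<close>)
  then obtain h F where h: "continuous_on (cball a r) h" "\<And>z. z \<in> sphere a r \<Longrightarrow> h z = (u \<circ> inv_into U \<phi>) z"
    and F: "F holomorphic_on ball a r" "\<And>z. z \<in> ball a r \<Longrightarrow> h z = Re (F z)"
    using Dirichlet_disc r(1) by blast
  show thesis
  proof (rule that[of "h \<circ> \<phi>"])
    show "continuous_on K (h \<circ> \<phi>)"
      by (intro continuous_on_compose continuous_on_subset[OF compatible_chart_cont[OF L] KU]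
          continuous_on_subset[OF h(1)]) (use im in auto)
    show "(h \<circ> \<phi>) x = u x" if "x \<in> K - D" for x
    proof -
      have "\<phi> x \<in> sphere a r" using that im[of x] imD[of x] by auto
      then show ?thesis using h(2) KU that compatible_chart_inv[OF L] by auto
    qed
    show "harmonic_at (h \<circ> \<phi>) x" if "x \<in> D" for x
    proof (rule harmonic_atI[of D x "F \<circ> \<phi>"])
      show "open D" "D \<subseteq> M" using regular_disc_open regular_disc_sub assms(1) by blast+
      have DK: "D \<subseteq> K" using regular_disc_sub(1)[OF assms(1)] .
      show "hol (F \<circ> \<phi>) D"
        by (rule hol_of_compatible_chart[OF L F(1)]) (use KU imD DK in auto)
      show "(h \<circ> \<phi>) y = Re ((F \<circ> \<phi>) y)" if "y \<in> D" for y
        using F(2) imD that DK by auto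
    qed (use that in auto)
  qed
qed

lemma regular_disc_harm_unique:
  assumes "regular_disc D K" "continuous_on K h" "continuous_on K h'"
    "\<And>x. x \<in> D \<Longrightarrow> harmonic_at h x" "\<And>x. x \<in> D \<Longrightarrow> harmonic_at h' x" "\<And>x. x \<in> K - D \<Longrightarrow> h x = h' x" "x \<in> K"
  shows "h x = h' x"
proof -
  note R = regular_disc_open[OF assms(1)] regular_disc_compact[OF assms(1)] regular_disc_connected(2)[OF assms(1)]
    regular_disc_sub[OF assms(1)] regular_disc_boundary[OF assms(1)]
  have "0 \<le> h x - h' x"
    by (rule min_principle[OF R(2,3) R(4,1,6) _ _ _ _ assms(7)])
       (use assms R in \<open>auto intro!: continuous_intros harmonic_at_imp_superharmonic_at harmonic_at_diff\<close>)
  moreover have "0 \<le> h' x - h x"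
    by (rule min_principle[OF R(2,3) R(4,1,6) _ _ _ _ assms(7)])
       (use assms R in \<open>auto intro!: continuous_intros harmonic_at_imp_superharmonic_at harmonic_at_diff\<close>)
  ultimately show ?thesis by simp
qed

text \<open>A harmonic function on the disc that is continuous up to the boundary coincides with the solution of
  the Dirichlet problem, and so is the real part of a single holomorphic function on the disc. This
  gives access to the limit theorem in the plane.\<close>

lemma regular_disc_limit:
  assumes R: "regular_disc D K"
    and u: "\<And>n. continuous_on K (u n)" "\<And>n x. x \<in> D \<Longrightarrow> harmonic_at (u n) x"
    and B: "\<And>n x. x \<in> D \<Longrightarrow> B \<le> u n x"
    and lim: "\<And>x. x \<in> D \<Longrightarrow> (\<lambda>n. u n x) \<longlonglongrightarrow> v x" and x: "x \<in> D"
  shows "harmonic_at v x"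
proof -
  obtain U \<phi> a r where L: "compatible_chart (U, \<phi>)" and r: "r > 0" "cball a r \<subseteq> \<phi> ` U"
    and D: "D = inv_into U \<phi> ` ball a r" and K: "K = inv_into U \<phi> ` cball a r"
    using R unfolding regular_disc_def by blast
  have bs: "ball a r \<subseteq> \<phi> ` U" using r ball_subset_cball[of a r] by blast
  have KU: "K \<subseteq> U" unfolding K using r compatible_chart_inv[OF L] by fastforce
  have DK: "D \<subseteq> K" "D \<subseteq> M" using regular_disc_sub[OF R] by blast+
  have im: "\<phi> x \<in> cball a r" if "x \<in> K" for x
    using that r unfolding K by (auto simp: f_inv_into_f subset_eq)
  have imD: "\<phi> x \<in> ball a r" if "x \<in> D" for x
    using that bs unfolding D by (auto simp: f_inv_into_f subset_eq)
  have inD: "inv_into U \<phi> z \<in> D" if "z \<in> ball a r" for z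
    using that unfolding D by auto
  have "\<exists>F. F holomorphic_on ball a r \<and> (\<forall>z\<in>ball a r. u n (inv_into U \<phi> z) = Re (F z))" for n
  proof -
    have "continuous_on (sphere a r) (u n \<circ> inv_into U \<phi>)"
      by (intro continuous_on_compose continuous_on_subset[OF compatible_chart_inv_cont[OF L]]
          continuous_on_subset[OF u(1)]) (use r in \<open>auto simp: K\<close>)
    then obtain h F where h: "continuous_on (cball a r) h" "\<And>z. z \<in> sphere a r \<Longrightarrow> h z = (u n \<circ> inv_into U \<phi>) z"
      and F: "F holomorphic_on ball a r" "\<And>z. z \<in> ball a r \<Longrightarrow> h z = Re (F z)"
      using Dirichlet_disc r(1) by blast
    have "h (\<phi> x) = u n x" if "x \<in> K" for x
    proof (rule regular_disc_harm_unique[OF R _ u(1) _ u(2) _ that])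
      show "continuous_on K (\<lambda>x. h (\<phi> x))"
        by (intro continuous_on_compose2[OF h(1)] continuous_on_subset[OF compatible_chart_cont[OF L] KU])
           (use im in auto)
      show "harmonic_at (\<lambda>x. h (\<phi> x)) x" if "x \<in> D" for x
      proof (rule harmonic_atI[of D x "F \<circ> \<phi>"])
        show "hol (F \<circ> \<phi>) D"
          by (rule hol_of_compatible_chart[OF L F(1)]) (use KU imD DK in auto)
      qed (use that regular_disc_open[OF R] DK F(2) imD in auto)
      show "h (\<phi> y) = u n y" if "y \<in> K - D" for y
      proof -
        have yU: "y \<in> U" using KU that by auto
        have "\<phi> y \<notin> ball a r" using inD[of "\<phi> y"] that compatible_chart_inv[OF L yU] by auto
        then have "\<phi> y \<in> sphere a r" using im[of y] that by auto
        then show ?thesis using h(2) compatible_chart_inv[OF L yU] by auto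
      qed
    qed
    then have "u n (inv_into U \<phi> z) = Re (F z)" if "z \<in> ball a r" for z
      using F(2)[OF that] inD[OF that] DK bs that by (metis f_inv_into_f subset_eq)
    with F(1) show ?thesis by blast
  qed
  then obtain F where F: "\<And>n. F n holomorphic_on ball a r"
    "\<And>n z. z \<in> ball a r \<Longrightarrow> u n (inv_into U \<phi> z) = Re (F n z)" by metis
  obtain G where G: "G holomorphic_on ball a r" "\<And>z. z \<in> ball a r \<Longrightarrow> v (inv_into U \<phi> z) = Re (G z)"
  proof (rule Re_holomorphic_limit[OF F(1), where B = B and u = "\<lambda>z. v (inv_into U \<phi> z)"])
    show "B \<le> Re (F n z)" if "z \<in> ball a r" for n z
      using F(2)[OF that, of n] B[OF inD[OF that], of n] by simp
    show "(\<lambda>n. Re (F n z)) \<longlonglongrightarrow> v (inv_into U \<phi> z)" if "z \<in> ball a r" for z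
      using lim[OF inD[OF that]] F(2)[OF that] by simp
  qed blast
  show ?thesis
  proof (rule harmonic_atI[of D x "G \<circ> \<phi>"])
    show "hol (G \<circ> \<phi>) D"
      by (rule hol_of_compatible_chart[OF L G(1)]) (use KU imD DK in auto)
    show "v y = Re ((G \<circ> \<phi>) y)" if "y \<in> D" for y
      using G(2)[OF imD[OF that]] compatible_chart_inv[OF L, of y] that KU DK by auto
  qed (use x regular_disc_open[OF R] DK in auto)
qed

text \<open>On the disc, \<open>u\<close> is replaced by the solution of the Dirichlet problem with boundary values
  \<open>u\<close>. The modification is superharmonic at the boundary of the disc because it lies below \<open>u\<close> and
  agrees with \<open>u\<close> there.\<close>

lemma superharmonic_on_modification:
  assumes W: "open W" "superharmonic_on u W" and R: "regular_disc D K" "K \<subseteq> W"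
  obtains w where "superharmonic_on w W" "\<And>x. x \<in> W \<Longrightarrow> w x \<le> u x" "\<And>x. x \<notin> D \<Longrightarrow> w x = u x"
    "\<And>x. x \<in> D \<Longrightarrow> harmonic_at w x"
    "\<And>v. \<forall>x\<in>W. v x \<le> u x \<Longrightarrow> superharmonic_on (\<lambda>x. - v x) W \<Longrightarrow> \<forall>x\<in>W. v x \<le> w x"
proof -
  note T = regular_disc_open[OF R(1)] regular_disc_compact[OF R(1)] regular_disc_connected(2)[OF R(1)]
    regular_disc_sub[OF R(1)] regular_disc_boundary[OF R(1)]
  have cu: "continuous_on K u" using W R continuous_on_subset by (auto simp: superharmonic_on_def)
  obtain h where h: "continuous_on K h" "\<And>x. x \<in> K - D \<Longrightarrow> h x = u x" "\<And>x. x \<in> D \<Longrightarrow> harmonic_at h x"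
    using regular_disc_Dirichlet[OF R(1) cu] by blast
  define w where "w x = (if x \<in> K then h x else u x)" for x
  have hle: "h x \<le> u x" if "x \<in> K" for x
  proof -
    have "0 \<le> u x - h x"
    proof (rule min_principle[OF T(2,3) T(4,1,6) _ _ _ _ that])
      show "continuous_on K (\<lambda>x. u x - h x)" by (intro continuous_intros cu h)
      show "superharmonic_at (\<lambda>x. u x - h x) y" if "y \<in> D" for y
        using superharmonic_at_add_harm[OF _ harmonic_at_minus[OF h(3)[OF that]], of u] that W R T by (auto simp: superharmonic_on_def)
    qed (use T h in auto)
    then show ?thesis by simp
  qed
  have closedK: "closed K" using T(2) compact_imp_closed by blast
  have weq: "w x = u x" if "x \<notin> D" for x using h(2) that by (auto simp: w_def)
  have wle: "w x \<le> u x" for x using hle by (auto simp: w_def)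
  have harm: "harmonic_at w x" if "x \<in> D" for x
  proof (rule harmonic_at_cong[OF _ h(3)[OF that]])
    show "\<forall>\<^sub>F y in nhds x. h y = w y"
      unfolding eventually_nhds using T that by (intro exI[of _ D]) (auto simp: w_def)
  qed
  have contw: "continuous_on W w"
  proof -
    have "continuous_on (K \<union> (W - D)) (\<lambda>x. if x \<in> K then h x else u x)"
    proof (rule continuous_on_cases_local)
      show "closedin (top_of_set (K \<union> (W - D))) K"
        using closedK by (simp add: closed_subset)
      have *: "closed (- D)" using T(1) by (rule closed_Compl)
      have "(K \<union> (W - D)) \<inter> (- D) = W - D" using R(2) by blast
      then show "closedin (top_of_set (K \<union> (W - D))) (W - D)"
        using closedin_closed_Int[OF *, of "K \<union> (W - D)"] by simp
      show "continuous_on (W - D) u"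
        using W by (auto simp: superharmonic_on_def intro: continuous_on_subset[of W u])
    qed (use h in auto)
    moreover have "K \<union> (W - D) = W" using R T by auto
    ultimately show ?thesis by (simp add: w_def[abs_def])
  qed
  show thesis
  proof (rule that[of w])
    show "superharmonic_on w W"
      unfolding superharmonic_on_def
    proof (intro conjI ballI contw)
      fix x assume x: "x \<in> W"
      show "superharmonic_at w x"
      proof (cases "x \<in> D")
        case True
        then show ?thesis using harm harmonic_at_imp_superharmonic_at by blast
      next
        case False
        then show ?thesis
          using W x weq wle by (auto simp: superharmonic_on_def intro: superharmonic_at_dominated[of u])
      qed
    qed
    show "\<forall>x\<in>W. v x \<le> w x" if v: "\<forall>x\<in>W. v x \<le> u x" "superharmonic_on (\<lambda>x. - v x) W" for v
    proof
      fix x assume x: "x \<in> W"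
      show "v x \<le> w x"
      proof (cases "x \<in> K")
        case True
        have "0 \<le> - v x + h x"
        proof (rule min_principle[OF T(2,3) T(4,1,6) _ _ _ _ True])
          show "continuous_on K (\<lambda>x. - v x + h x)"
            using continuous_on_add[OF continuous_on_subset[of W "\<lambda>x. - v x"] h(1)] v(2) R(2)
            by (simp add: superharmonic_on_def)
          show "superharmonic_at (\<lambda>x. - v x + h x) y" if "y \<in> D" for y
            using v(2) that R T by (intro superharmonic_at_add_harm h) (auto simp: superharmonic_on_def)
          show "0 \<le> - v y + h y" if "y \<in> K - D" for y
            using that h(2) v(1) R by auto
        qed (use T in auto)
        then show ?thesis using True by (simp add: w_def)
      next
        case False
        then show ?thesis using v x by (simp add: w_def)
      qed
    qed
  qed (use weq wle harm in auto)
qed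

text \<open>Near a point \<open>x\<close>, choose members of \<open>Q\<close> whose values at \<open>x\<close> approach the infimum, make
  them decreasing and harmonic on a disc, and let \<open>h\<close> be their limit. Repeating this with members
  that also approach the infimum at a second point \<open>y\<close> gives a harmonic \<open>h' \<le> h\<close> with equality at
  \<open>x\<close>, hence everywhere on the disc; so \<open>h\<close> is the infimum at \<open>y\<close> as well.\<close>

proposition Perron:
  assumes X: "open X" "X \<subseteq> M" and Q: "Q \<noteq> {}"
    and B: "\<And>u x. u \<in> Q \<Longrightarrow> x \<in> X \<Longrightarrow> B \<le> u x"
    and dir: "\<And>u v. u \<in> Q \<Longrightarrow> v \<in> Q \<Longrightarrow> \<exists>w\<in>Q. \<forall>x\<in>X. w x \<le> u x \<and> w x \<le> v x"
    and mod: "\<And>u D K. u \<in> Q \<Longrightarrow> regular_disc D K \<Longrightarrow> K \<subseteq> X \<Longrightarrow>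
       \<exists>w\<in>Q. (\<forall>x\<in>X. w x \<le> u x) \<and> (\<forall>x\<in>D. harmonic_at w x) \<and> continuous_on K w"
    and x: "x \<in> X"
  shows "harmonic_at (\<lambda>x. INF u\<in>Q. u x) x"
proof -
  define g where "g x = (INF u\<in>Q. u x)" for x
  have bdd: "bdd_below ((\<lambda>u. u x) ` Q)" if "x \<in> X" for x
    using B that by (intro bdd_belowI2[of _ B]) auto
  have g_le: "g x \<le> u x" if "u \<in> Q" "x \<in> X" for u x
    unfolding g_def using cINF_lower[OF bdd] that by blast
  have approx: "\<exists>a. \<forall>n. a n \<in> Q \<and> a n x < g x + inverse (real (Suc n))" if "x \<in> X" for x
  proof -
    have "\<exists>u\<in>Q. u x < g x + inverse (real (Suc n))" for n
      using cINF_less_iff[OF Q bdd[OF that], of "g x + inverse (real (Suc n))"] by (simp add: g_def)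
    then show ?thesis by metis
  qed
  obtain D K where R: "regular_disc D K" "x \<in> D" "K \<subseteq> X"
    using regular_disc_ex[of x X] X x by blast
  have DX: "D \<subseteq> X" using R regular_disc_sub by blast
  have "\<exists>w\<in>Q. (\<forall>x\<in>X. w x \<le> u x \<and> w x \<le> v x) \<and> (\<forall>x\<in>D. harmonic_at w x) \<and> continuous_on K w"
    if "u \<in> Q" "v \<in> Q" for u v
    using dir[OF that] mod[OF _ R(1,3)] by (meson order_trans)
  then have "\<exists>w. w \<in> Q \<and> (\<forall>x\<in>X. w x \<le> u x \<and> w x \<le> v x) \<and> (\<forall>x\<in>D. harmonic_at w x) \<and> continuous_on K w"
    if "u \<in> Q" "v \<in> Q" for u v
    using that by blast
  note someI_ex[OF this]
  moreover define step where "step u v = (SOME w. w \<in> Q \<and> (\<forall>x\<in>X. w x \<le> u x \<and> w x \<le> v x) \<and>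
     (\<forall>x\<in>D. harmonic_at w x) \<and> continuous_on K w)" for u v
  ultimately have step: "step u v \<in> Q" "\<And>y. y \<in> X \<Longrightarrow> step u v y \<le> u y \<and> step u v y \<le> v y"
    "\<And>y. y \<in> D \<Longrightarrow> harmonic_at (step u v) y" "continuous_on K (step u v)" if "u \<in> Q" "v \<in> Q" for u v
    using that by simp_all
  let ?P = "\<lambda>a c h. (\<forall>n. c n \<in> Q) \<and> (\<forall>n. \<forall>y\<in>X. c n y \<le> a n y) \<and> (\<forall>y\<in>D. harmonic_at h y) \<and>
      (\<forall>y\<in>D. (\<lambda>n. c n y) \<longlonglongrightarrow> h y) \<and> (\<forall>y\<in>D. \<forall>n. h y \<le> c n y)"
  have seq: "\<exists>c h. ?P a c h" if a: "\<And>n. a n \<in> Q" for a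
  proof -
    define c where "c = rec_nat (step (a 0) (a 0)) (\<lambda>n r. step r (a (Suc n)))"
    have c0: "c 0 = step (a 0) (a 0)" and cS: "c (Suc n) = step (c n) (a (Suc n))" for n
      by (simp_all add: c_def)
    have cQ: "c n \<in> Q" for n by (induction n) (auto simp: c0 cS step a)
    have ca: "c n y \<le> a n y" if "y \<in> X" for n y
      by (cases n) (use step(2)[OF _ _ that] a cQ in \<open>auto simp: c0 cS\<close>)
    have dec: "decseq (\<lambda>n. c n y)" if "y \<in> X" for y
      by (rule decseq_SucI) (use step(2)[OF cQ a that] in \<open>auto simp: cS\<close>)
    have ch: "harmonic_at (c n) y" if "y \<in> D" for n y
      by (cases n) (use that a cQ in \<open>auto simp: c0 cS step(3)\<close>)
    have cc: "continuous_on K (c n)" for n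
      by (cases n) (use a cQ in \<open>auto simp: c0 cS step(4)\<close>)
    have "\<exists>l. (\<lambda>n. c n y) \<longlonglongrightarrow> l \<and> (\<forall>n. l \<le> c n y)" if "y \<in> X" for y
      using decseq_convergent[OF dec[OF that], of B] B[OF cQ that] by metis
    then obtain h where h: "\<And>y. y \<in> X \<Longrightarrow> (\<lambda>n. c n y) \<longlonglongrightarrow> h y" "\<And>y n. y \<in> X \<Longrightarrow> h y \<le> c n y"
      by metis
    have "harmonic_at h y" if "y \<in> D" for y
      by (rule regular_disc_limit[OF R(1), of c B]) (use cc ch B cQ h DX that in auto)
    then show ?thesis using cQ ca h DX by (intro exI[of _ c] exI[of _ h]) auto
  qed
  obtain a where a: "\<And>n. a n \<in> Q" "\<And>n. a n x < g x + inverse (real (Suc n))"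
    using approx[OF x] by blast
  obtain c h where P: "?P a c h" using seq[of a, OF a(1)] by (elim exE)
  then have c: "\<And>n. c n \<in> Q" "\<And>n y. y \<in> X \<Longrightarrow> c n y \<le> a n y" and h: "\<And>y. y \<in> D \<Longrightarrow> harmonic_at h y"
    and ch: "\<And>y. y \<in> D \<Longrightarrow> (\<lambda>n. c n y) \<longlonglongrightarrow> h y" "\<And>y n. y \<in> D \<Longrightarrow> h y \<le> c n y"
    by simp_all
  have lim_eq: "l \<le> g y" if "e \<longlonglongrightarrow> l" "\<And>n. e n \<le> g y + inverse (real (Suc n))" for e l y
  proof (rule LIMSEQ_le[OF that(1)])
    show "(\<lambda>n. g y + inverse (real (Suc n))) \<longlonglongrightarrow> g y"
      using tendsto_add[OF tendsto_const LIMSEQ_inverse_real_of_nat, of "g y"] by simp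
  qed (use that in auto)
  have h_ge: "g y \<le> h y" if "y \<in> D" for y
    by (rule LIMSEQ_le_const[OF ch(1)[OF that]]) (use g_le c DX that in auto)
  have "g y = h y" if y: "y \<in> D" for y
  proof -
    have yX: "y \<in> X" using y DX by auto
    obtain b where b: "\<And>n. b n \<in> Q" "\<And>n. b n y < g y + inverse (real (Suc n))"
      using approx[OF yX] by blast
    obtain c' h' where P': "?P (\<lambda>n. step (c n) (b n)) c' h'"
      using seq[of "\<lambda>n. step (c n) (b n)", OF step(1)[OF c(1) b(1)]] by (elim exE)
    then have c': "\<And>n. c' n \<in> Q" "\<And>n y. y \<in> X \<Longrightarrow> c' n y \<le> step (c n) (b n) y"
      and h': "\<And>y. y \<in> D \<Longrightarrow> harmonic_at h' y"
      and ch': "\<And>y. y \<in> D \<Longrightarrow> (\<lambda>n. c' n y) \<longlonglongrightarrow> h' y" "\<And>y n. y \<in> D \<Longrightarrow> h' y \<le> c' n y"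
      by simp_all
    have le: "c' n z \<le> c n z" "c' n z \<le> b n z" if "z \<in> X" for n z
      using c'(2)[OF that, of n] step(2)[OF c(1) b(1) that, of n n] by auto
    have h'h: "h' z \<le> h z" if "z \<in> D" for z
      by (rule LIMSEQ_le[OF ch'(1)[OF that] ch(1)[OF that]]) (use le DX that in auto)
    have h'_ge: "g z \<le> h' z" if "z \<in> D" for z
      by (rule LIMSEQ_le_const[OF ch'(1)[OF that]]) (use g_le c' DX that in auto)
    have "h' y \<le> g y"
      by (rule lim_eq[OF ch'(1)[OF y]]) (use le(2)[OF yX] b in \<open>meson less_imp_le order_trans\<close>)
    moreover have "h x \<le> g x"
      by (rule lim_eq[OF ch(1)[OF R(2)]]) (use c(2)[OF x] a in \<open>meson less_imp_le order_trans\<close>)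
    moreover have "h x = h' x"
      using h_ge[OF R(2)] h'_ge[OF R(2)] h'h[OF R(2)] calculation by linarith
    moreover have "h y - h' y = 0"
      by (rule harmonic_at_nonneg_zero[of D x "\<lambda>z. h z - h' z"])
         (use regular_disc_connected[OF R(1)] regular_disc_open[OF R(1)] R h h' h'h y calculation
          in \<open>auto intro!: harmonic_at_diff\<close>)
    ultimately show ?thesis using h_ge[OF y] by linarith
  qed
  then have "\<forall>\<^sub>F y in nhds x. h y = g y"
    unfolding eventually_nhds using regular_disc_open[OF R(1)] R(2) by (intro exI[of _ D]) auto
  then have "harmonic_at g x" using harmonic_at_cong h[OF R(2)] by blast
  then show ?thesis by (simp add: g_def[abs_def])
qed

end

section \<open>Barriers at the boundary\<close>

lemma directed_compact_less:
  fixes T :: "('a::topological_space \<Rightarrow> real) set"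
  assumes C: "compact C" and T: "T \<noteq> {}" and cont: "\<And>s. s \<in> T \<Longrightarrow> continuous_on C s"
    and dir: "\<And>s t. s \<in> T \<Longrightarrow> t \<in> T \<Longrightarrow> \<exists>w\<in>T. \<forall>x\<in>C. w x \<le> s x \<and> w x \<le> t x"
    and ex: "\<And>x. x \<in> C \<Longrightarrow> \<exists>s\<in>T. s x < k"
  shows "\<exists>s\<in>T. \<forall>x\<in>C. s x < k"
proof -
  have "\<exists>A. open A \<and> A \<inter> C = C \<inter> s -` {..<k}" if "s \<in> T" for s
    using cont[OF that] open_lessThan[of k] unfolding continuous_on_open_invariant
    by (metis Int_commute)
  then obtain A where A: "\<And>s. s \<in> T \<Longrightarrow> open (A s)" "\<And>s. s \<in> T \<Longrightarrow> A s \<inter> C = C \<inter> s -` {..<k}"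
    by metis
  have "C \<subseteq> (\<Union>s\<in>T. A s)" using ex A(2) by fastforce
  then obtain T' where T': "T' \<subseteq> T" "finite T'" "C \<subseteq> (\<Union>s\<in>T'. A s)"
    using compactE_image[OF C, of T A] A(1) by blast
  have "\<exists>w\<in>T. \<forall>s\<in>T'. \<forall>x\<in>C. w x \<le> s x"
    using T'(2,1)
  proof (induction T' rule: finite_induct)
    case empty
    then show ?case using T by auto
  next
    case (insert t F)
    then obtain w where w: "w \<in> T" "\<forall>s\<in>F. \<forall>x\<in>C. w x \<le> s x" by auto
    then obtain w' where "w' \<in> T" "\<forall>x\<in>C. w' x \<le> w x \<and> w' x \<le> t x" using dir insert.prems by blast
    with w show ?case by (intro bexI[of _ w']) (auto intro: order_trans)
  qed
  then obtain w where w: "w \<in> T" "\<forall>s\<in>T'. \<forall>x\<in>C. w x \<le> s x" by blast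
  have "w x < k" if x: "x \<in> C" for x
  proof -
    obtain s where s: "s \<in> T'" "x \<in> A s" using T' x by blast
    then have "s x < k" using A(2)[of s] T'(1) x by blast
    moreover have "w x \<le> s x" using w s x by blast
    ultimately show ?thesis by simp
  qed
  with w show ?thesis by blast
qed

context riemann_surface
begin

lemma superharmonic_onI:
  "(\<And>x. x \<in> W \<Longrightarrow> isCont u x) \<Longrightarrow> (\<And>x. x \<in> W \<Longrightarrow> superharmonic_at u x) \<Longrightarrow> superharmonic_on u W"
  unfolding superharmonic_on_def by (auto intro: continuous_at_imp_continuous_on)

lemma superharmonic_on_isCont: "superharmonic_on u W \<Longrightarrow> open W \<Longrightarrow> x \<in> W \<Longrightarrow> isCont u x"
  unfolding superharmonic_on_def by (simp add: continuous_on_eq_continuous_at)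

lemma superharmonic_on_superharmonic_at: "superharmonic_on u W \<Longrightarrow> x \<in> W \<Longrightarrow> superharmonic_at u x"
  unfolding superharmonic_on_def by blast

lemma superharmonic_on_subset: "superharmonic_on u W \<Longrightarrow> W' \<subseteq> W \<Longrightarrow> superharmonic_on u W'"
  unfolding superharmonic_on_def by (auto intro: continuous_on_subset)

lemma superharmonic_on_min: "superharmonic_on u W \<Longrightarrow> superharmonic_on v W \<Longrightarrow> superharmonic_on (\<lambda>x. min (u x) (v x)) W"
  unfolding superharmonic_on_def by (auto intro!: continuous_intros superharmonic_at_min)

lemma superharmonic_on_const: "W \<subseteq> M \<Longrightarrow> superharmonic_on (\<lambda>x. k) W"
  unfolding superharmonic_on_def by (auto intro!: harmonic_at_imp_superharmonic_at harmonic_at_const)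

text \<open>Superharmonicity is local, so a function may be checked by comparing it near each point with
  a simpler one.\<close>

lemma superharmonic_on_glue:
  assumes "\<And>x. x \<in> W \<Longrightarrow> \<exists>f. isCont f x \<and> superharmonic_at f x \<and> (\<forall>\<^sub>F y in nhds x. u y = f y)"
  shows "superharmonic_on u W"
proof (rule superharmonic_onI)
  fix x assume "x \<in> W"
  then obtain f where f: "isCont f x" "superharmonic_at f x" "\<forall>\<^sub>F y in nhds x. u y = f y"
    using assms by blast
  show "isCont u x" using f(1,3) isCont_cong[of u f x] by blast
  show "superharmonic_at u x" using superharmonic_at_cong f(2,3) by blast
qed

lemma compatible_chart_isCont: "compatible_chart (U, \<phi>) \<Longrightarrow> x \<in> U \<Longrightarrow> isCont \<phi> x"
  using compatible_chart_cont compatible_chart_open continuous_on_eq_continuous_at by blast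

lemma regular_disc_coordinate:
  assumes L: "compatible_chart (U, \<phi>)" and r: "r > 0" "cball a r \<subseteq> \<phi> ` U"
  shows "regular_disc {x \<in> U. \<phi> x \<in> ball a r} {x \<in> U. \<phi> x \<in> cball a r}"
proof -
  have *: "{x \<in> U. \<phi> x \<in> S} = inv_into U \<phi> ` S" if "S \<subseteq> \<phi> ` U" for S
    using that compatible_chart_inv[OF L] by (force simp: f_inv_into_f)
  have "ball a r \<subseteq> \<phi> ` U" using r ball_subset_cball[of a r] by blast
  then show ?thesis
    unfolding regular_disc_def using L r * by blast
qed

end

context compact_riemann_surface_with_boundary
begin

lemma V_closed: "closed V"
  using V_compact compact_imp_closed by blast

text \<open>In a holomorphic coordinate, \<open>V\<close> lies near a boundary point in a sector of opening less than
  \<open>2 pi\<close>. Indeed \<open>V\<close> is given by \<open>Im \<psi> \<ge> 0\<close> for an adapted chart \<open>\<psi>\<close>; the derivative of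
  \<open>Im \<psi>\<close> at \<open>p\<close> is the real part of multiplication by \<open>cnj a\<close> for some \<open>a \<noteq> 0\<close>, since the
  change of coordinates has an invertible derivative, and the error term is small compared to the
  distance to \<open>p\<close>. In the coordinate \<open>(\<phi> - \<phi> p) / a\<close>, the inner normal is the positive real axis.\<close>

lemma boundary_sector:
  assumes p: "p \<in> frontier V" and N: "open N" "p \<in> N"
  obtains U \<phi> a r where "compatible_chart (U, \<phi>)" "p \<in> U" "a \<noteq> 0" "r > 0"
    "cball (\<phi> p) (r * cmod a) \<subseteq> \<phi> ` (U \<inter> N)"
    "\<And>x. x \<in> U \<Longrightarrow> \<phi> x \<in> cball (\<phi> p) (r * cmod a) \<Longrightarrow> x \<in> V \<Longrightarrow>
       - cmod ((\<phi> x - \<phi> p) / a) / 2 \<le> Re ((\<phi> x - \<phi> p) / a)"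
proof -
  have pV: "p \<in> V" using p V_closed by (simp add: frontier_def)
  then obtain W \<psi> where W: "p \<in> W" "adapted_chart M atlas V (W, \<psi>)" using V_submanifold by blast
  obtain U \<phi> where A: "(U, \<phi>) \<in> atlas" "p \<in> U" using atlas_at pV V_subset by blast
  have L: "compatible_chart (U, \<phi>)" using A compatible_chart_atlas by blast
  have tc: "open W" "homeomorphism W (\<psi> ` W) \<psi> (inv_into W \<psi>)" "open (\<psi> ` W)"
    and half: "V \<inter> W = {x \<in> W. Im (\<psi> x) \<ge> 0}"
    and sm: "smooth_on (\<psi> \<circ> inv_into U \<phi>) (\<phi> ` (U \<inter> W))" "smooth_on (\<phi> \<circ> inv_into W \<psi>) (\<psi> ` (U \<inter> W))"
    using W A(1) by (auto simp: adapted_chart_def topological_chart_def)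
  have inv\<psi>: "inv_into W \<psi> (\<psi> x) = x" if "x \<in> W" for x
    using tc(2) that by (auto simp: homeomorphism_def)
  have cont\<psi>: "continuous_on W \<psi>" using tc(2) by (auto simp: homeomorphism_def)
  have Im0: "Im (\<psi> p) = 0"
  proof (rule ccontr)
    assume "Im (\<psi> p) \<noteq> 0"
    moreover have "Im (\<psi> p) \<ge> 0" using half pV W(1) by blast
    ultimately have "p \<in> W \<inter> (\<lambda>x. Im (\<psi> x)) -` {0<..}" using W(1) by simp
    moreover have "open (W \<inter> (\<lambda>x. Im (\<psi> x)) -` {0<..})"
      by (rule continuous_open_preimage[OF continuous_on_Im[OF cont\<psi>] tc(1) open_greaterThan])
    moreover have "W \<inter> (\<lambda>x. Im (\<psi> x)) -` {0<..} \<subseteq> V"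
    proof
      fix x assume "x \<in> W \<inter> (\<lambda>x. Im (\<psi> x)) -` {0<..}"
      then have "x \<in> {x \<in> W. Im (\<psi> x) \<ge> 0}" by simp
      then show "x \<in> V" unfolding half[symmetric] by simp
    qed
    ultimately have "p \<in> interior V" using interiorI by blast
    then show False using p by (simp add: frontier_def)
  qed
  define T where "T = \<phi> ` (U \<inter> W)"
  have T: "open T" "\<phi> p \<in> T" using compatible_chart_open_image[OF L tc(1)] A W by (auto simp: T_def)
  have diff: "f differentiable (at y)" if "smooth_on f S" "y \<in> S" for f :: "complex \<Rightarrow> complex" and S y
  proof -
    have "Ck_on (Suc 0) f S" using that(1) unfolding smooth_on_def by blast
    then show ?thesis using that(2) by simp
  qed
  obtain D where D: "((\<psi> \<circ> inv_into U \<phi>) has_derivative D) (at (\<phi> p))"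
    using diff[OF sm(1)] T(2) unfolding T_def differentiable_def by blast
  obtain D' where D': "((\<phi> \<circ> inv_into W \<psi>) has_derivative D') (at (\<psi> p))"
    using diff[OF sm(2)] A W unfolding differentiable_def by blast
  have base: "(\<phi> \<circ> inv_into W \<psi>) (\<psi> p) = \<phi> p" using inv\<psi> W by simp
  have chain: "((\<psi> \<circ> inv_into U \<phi>) \<circ> (\<phi> \<circ> inv_into W \<psi>) has_derivative D \<circ> D') (at (\<psi> p))"
    by (rule diff_chain_at[OF D']) (simp only: base D)
  have "open (\<psi> ` (U \<inter> W))"
  proof -
    have "\<psi> ` (U \<inter> W) = \<psi> ` W \<inter> inv_into W \<psi> -` U" using inv\<psi> by force
    moreover have "open (\<psi> ` W \<inter> inv_into W \<psi> -` U)"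
      by (rule continuous_open_preimage[OF _ tc(3) compatible_chart_open[OF L]]) (use tc(2) in \<open>simp add: homeomorphism_def\<close>)
    ultimately show ?thesis by simp
  qed
  then have "((\<lambda>x. x) has_derivative D \<circ> D') (at (\<psi> p))"
    by (rule has_derivative_transform_within_open[OF chain])
       (use A W inv\<psi> compatible_chart_inv[OF L] in auto)
  then have "D \<circ> D' = (\<lambda>x. x)"
    using has_derivative_unique has_derivative_ident by blast
  then have DD: "D (D' \<i>) = \<i>" by (metis comp_apply)
  define l where "l v = Im (D v)" for v
  interpret D: bounded_linear D using has_derivative_bounded_linear[OF D] .
  define a where "a = Complex (l 1) (l \<i>)"
  have l: "l v = Re (cnj a * v)" for v
  proof -
    have "D v = D (Re v *\<^sub>R 1 + Im v *\<^sub>R \<i>)"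
      by (metis complex_eq scaleR_conv_of_real mult.commute mult.right_neutral)
    then show ?thesis by (simp add: l_def a_def D.add D.scaleR)
  qed
  have a: "a \<noteq> 0" using l[of "D' \<i>"] DD by (auto simp: l_def)
  have quot: "Re (v / a) = l v / (cmod a)\<^sup>2" for v
    by (simp add: l complex_div_cnj[of v a] mult.commute)
  obtain d where d: "d > 0" "\<And>w. norm (w - \<phi> p) < d \<Longrightarrow>
      norm ((\<psi> \<circ> inv_into U \<phi>) w - (\<psi> \<circ> inv_into U \<phi>) (\<phi> p) - D (w - \<phi> p)) \<le> cmod a / 2 * norm (w - \<phi> p)"
    using D a unfolding has_derivative_at_alt by (metis zero_less_divide_iff zero_less_norm_iff zero_less_numeral)
  have "open (\<phi> ` (U \<inter> (W \<inter> N)))" by (rule compatible_chart_open_image[OF L open_Int[OF tc(1) N(1)]])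
  moreover have "\<phi> p \<in> \<phi> ` (U \<inter> (W \<inter> N))" using A W N by auto
  ultimately obtain e where e: "e > 0" "cball (\<phi> p) e \<subseteq> \<phi> ` (U \<inter> (W \<inter> N))"
    using open_contains_cball by blast
  define r where "r = min (d / 2) e / cmod a"
  have r: "r > 0" "r * cmod a \<le> e" "r * cmod a < d" using a d e by (auto simp: r_def)
  show thesis
  proof (rule that[OF L A(2) a r(1)])
    show "cball (\<phi> p) (r * cmod a) \<subseteq> \<phi> ` (U \<inter> N)"
      using subset_cball[OF r(2)] e(2) by blast
    fix x assume x: "x \<in> U" "\<phi> x \<in> cball (\<phi> p) (r * cmod a)" "x \<in> V"
    then have "\<phi> x \<in> \<phi> ` (U \<inter> (W \<inter> N))" using subset_cball[OF r(2)] e(2) by blast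
    then have xW: "x \<in> W" using compatible_chart_inj[OF L] x(1) by blast
    have nrm: "norm (\<phi> x - \<phi> p) < d" using x(2) r(3) by (simp add: dist_norm norm_minus_commute)
    have "norm (\<psi> x - \<psi> p - D (\<phi> x - \<phi> p)) \<le> cmod a / 2 * norm (\<phi> x - \<phi> p)"
      using d(2)[OF nrm] compatible_chart_inv[OF L x(1)] compatible_chart_inv[OF L A(2)] by simp
    then have "\<bar>Im (\<psi> x - \<psi> p - D (\<phi> x - \<phi> p))\<bar> \<le> cmod a / 2 * norm (\<phi> x - \<phi> p)"
      using abs_Im_le_cmod order_trans by blast
    then have "Im (\<psi> x - \<psi> p - D (\<phi> x - \<phi> p)) \<le> cmod a / 2 * norm (\<phi> x - \<phi> p)"
      by (rule abs_le_D1)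
    then have "Im (\<psi> x) - l (\<phi> x - \<phi> p) \<le> cmod a / 2 * norm (\<phi> x - \<phi> p)"
      using Im0 unfolding l_def minus_complex.sel by simp
    moreover have "Im (\<psi> x) \<ge> 0" using half x xW by blast
    ultimately have "l (\<phi> x - \<phi> p) \<ge> - (cmod a / 2 * norm (\<phi> x - \<phi> p))"
      by linarith
    then have "l (\<phi> x - \<phi> p) / (cmod a)\<^sup>2 \<ge> - (cmod a / 2 * norm (\<phi> x - \<phi> p)) / (cmod a)\<^sup>2"
      using a by (intro divide_right_mono) auto
    then show "- cmod ((\<phi> x - \<phi> p) / a) / 2 \<le> Re ((\<phi> x - \<phi> p) / a)"
      using a by (simp add: quot norm_divide power2_eq_square)
  qed
qed

text \<open>This is the barrier at a boundary point \<open>p\<close>, in the form in which it lowers a superharmonic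
  function \<open>u\<close> near \<open>p\<close>. With \<open>t\<close> the coordinate of \<open>boundary_sector\<close>, the function
  \<open>b = Re (csqrt (t + \<delta>))\<close> is harmonic and positive off the slit where \<open>t + \<delta>\<close> is a nonpositive
  real number, which for \<open>\<delta> > 0\<close> lies outside \<open>V\<close>; on a circle around \<open>p\<close> it is bounded below
  on \<open>V\<close> independently of \<open>\<delta>\<close>. So a fixed multiple of it can be glued to \<open>u\<close> by taking the
  minimum, at the price of removing from the domain a closed set \<open>B\<close> that does not meet \<open>V\<close>.
  The shift by \<open>\<delta>\<close> is what makes the competitor live on a neighbourhood of \<open>V\<close>, including \<open>p\<close>;
  letting \<open>\<delta>\<close> tend to 0 afterwards gives decay at \<open>p\<close>, where \<open>\<tau> = \<bar>t\<bar>\<close> vanishes.\<close>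

lemma barrier:
  assumes p: "p \<in> frontier V" and N: "open N" "p \<in> N"
  obtains \<Delta> \<tau> where "open \<Delta>" "p \<in> \<Delta>" "\<Delta> \<subseteq> N" "continuous_on \<Delta> \<tau>" "\<tau> p = 0" "\<And>x. 0 \<le> \<tau> x"
    "\<And>Y u. open Y \<Longrightarrow> Y \<subseteq> M \<Longrightarrow> V \<inter> N \<subseteq> Y \<Longrightarrow> superharmonic_on u Y \<Longrightarrow> \<forall>x\<in>Y. 0 \<le> u x \<Longrightarrow>
       \<exists>C\<ge>0. \<forall>\<delta>>0. \<exists>B u'. closed B \<and> B \<subseteq> N \<and> B \<inter> V = {} \<and> superharmonic_on u' (Y - B) \<and>
         (\<forall>x\<in>Y - B. 0 \<le> u' x \<and> u' x \<le> u x) \<and> (\<forall>x. x \<notin> \<Delta> \<longrightarrow> u' x = u x) \<and>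
         (\<forall>x\<in>\<Delta> \<inter> (Y - B). u' x \<le> C * sqrt (\<tau> x + \<delta>))"
proof -
  obtain U \<phi> a r where L: "compatible_chart (U, \<phi>)" and pU: "p \<in> U" and a: "a \<noteq> 0" and r: "r > 0"
    and ball: "cball (\<phi> p) (r * cmod a) \<subseteq> \<phi> ` (U \<inter> N)"
    and sector0: "\<And>x. x \<in> U \<Longrightarrow> \<phi> x \<in> cball (\<phi> p) (r * cmod a) \<Longrightarrow> x \<in> V \<Longrightarrow>
       - cmod ((\<phi> x - \<phi> p) / a) / 2 \<le> Re ((\<phi> x - \<phi> p) / a)"
    by (rule boundary_sector[OF p N]) (rule that)
  define t where "t x = (\<phi> x - \<phi> p) / a" for x
  define \<Delta> where "\<Delta> = {x \<in> U. \<phi> x \<in> ball (\<phi> p) (r * cmod a)}"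
  define K where "K = {x \<in> U. \<phi> x \<in> cball (\<phi> p) (r * cmod a)}"
  have RD: "regular_disc \<Delta> K"
    unfolding \<Delta>_def K_def by (rule regular_disc_coordinate[OF L]) (use r a ball in auto)
  note T = regular_disc_open[OF RD] regular_disc_compact[OF RD] regular_disc_sub[OF RD]
  have tball: "\<phi> x \<in> cball (\<phi> p) (r * cmod a) \<longleftrightarrow> cmod (t x) \<le> r"
    "\<phi> x \<in> ball (\<phi> p) (r * cmod a) \<longleftrightarrow> cmod (t x) < r" for x
    using a by (auto simp: t_def norm_divide dist_norm norm_minus_commute field_simps)
  have KN: "K \<subseteq> N"
  proof
    fix x assume "x \<in> K"
    then have "x \<in> U" "\<phi> x \<in> \<phi> ` (U \<inter> N)" using ball by (auto simp: K_def)
    then show "x \<in> N" using compatible_chart_inj[OF L] by blast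
  qed
  have sector: "- cmod (t x) / 2 \<le> Re (t x)" if "x \<in> K" "x \<in> V" for x
    using sector0 that by (auto simp: K_def t_def)
  have tcont: "isCont t x" if "x \<in> U" for x
    unfolding t_def using compatible_chart_isCont[OF L that] a by (intro continuous_intros) auto
  have tcontU: "continuous_on U t" using tcont by (simp add: continuous_at_imp_continuous_on)
  have KU: "K \<subseteq> U" by (auto simp: K_def)
  show thesis
  proof (rule that[of \<Delta> "\<lambda>x. cmod (t x)"])
    show "open \<Delta>" by (rule T)
    show "p \<in> \<Delta>" using pU r a by (auto simp: \<Delta>_def)
    show "\<Delta> \<subseteq> N" using T KN by blast
    show "continuous_on \<Delta> (\<lambda>x. cmod (t x))"
      using continuous_on_subset[OF tcontU, of \<Delta>] T KU by (intro continuous_intros) blast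
    show "cmod (t p) = 0" by (simp add: t_def)
    show "0 \<le> cmod (t x)" for x by simp
  next
    fix Y u assume Y: "open Y" "Y \<subseteq> M" "V \<inter> N \<subseteq> Y" and u: "superharmonic_on u Y" "\<forall>x\<in>Y. 0 \<le> u x"
    define S where "S = K - \<Delta>"
    have closedK: "closed K" using T(2) compact_imp_closed by blast
    have Sclosed: "closed S" unfolding S_def using closedK T(1) by blast
    have St: "cmod (t x) = r" if "x \<in> S" for x
      using that tball[of x] by (auto simp: S_def K_def \<Delta>_def)
    have "compact (V \<inter> S)"
      using compact_Int_closed[OF V_compact Sclosed] .
    moreover have "continuous_on (V \<inter> S) u"
      using u(1) Y(3) KN by (auto simp: superharmonic_on_def S_def intro!: continuous_on_subset[of Y u])
    ultimately have "bounded (u ` (V \<inter> S))"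
      by (intro compact_imp_bounded compact_continuous_image)
    then obtain m where "\<forall>y\<in>u ` (V \<inter> S). norm y \<le> m" unfolding bounded_iff by blast
    then have m: "\<And>x. x \<in> V \<inter> S \<Longrightarrow> u x \<le> m" by force
    \<comment> \<open>on \<open>V\<close> the function \<open>b\<close> below is at least \<open>sqrt r / 2\<close> on the boundary circle, for every \<open>\<delta>\<close>\<close>
    define C where "C = 2 * (\<bar>m\<bar> + 1) / sqrt r"
    have C: "C > 0" "C * (sqrt r / 2) = \<bar>m\<bar> + 1" using r by (auto simp: C_def)
    show "\<exists>C\<ge>0. \<forall>\<delta>>0. \<exists>B u'. closed B \<and> B \<subseteq> N \<and> B \<inter> V = {} \<and> superharmonic_on u' (Y - B) \<and>
         (\<forall>x\<in>Y - B. 0 \<le> u' x \<and> u' x \<le> u x) \<and> (\<forall>x. x \<notin> \<Delta> \<longrightarrow> u' x = u x) \<and>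
         (\<forall>x\<in>\<Delta> \<inter> (Y - B). u' x \<le> C * sqrt (cmod (t x) + \<delta>))"
    proof (intro exI[of _ C] conjI allI impI)
      show "0 \<le> C" using C by simp
      fix \<delta> :: real assume \<delta>: "\<delta> > 0"
      define b where "b x = Re (csqrt (t x + of_real \<delta>))" for x
      have b_eq: "b x = sqrt ((cmod (t x + of_real \<delta>) + Re (t x) + \<delta>) / 2)" for x
        by (simp add: b_def add.assoc)
      have b_nonneg: "b x \<ge> 0" for x
        unfolding b_def using csqrt_principal[of "t x + of_real \<delta>"] by linarith
      have b_le: "b x \<le> sqrt (cmod (t x) + \<delta>)" for x
      proof -
        have "cmod (t x + of_real \<delta>) \<le> cmod (t x) + \<delta>"
          using norm_triangle_ineq[of "t x" "of_real \<delta>"] \<delta> by simp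
        moreover have "Re (t x) \<le> cmod (t x)" by (rule complex_Re_le_cmod)
        ultimately have "cmod (t x + of_real \<delta>) + Re (t x) + \<delta> \<le> 2 * (cmod (t x) + \<delta>)" by simp
        then show ?thesis unfolding b_eq by (intro real_sqrt_le_mono) (simp add: field_simps)
      qed
      have b_ge: "sqrt r / 2 \<le> b x" if "x \<in> V \<inter> S" for x
      proof -
        have "- r / 2 \<le> Re (t x)" using sector[of x] St[of x] that by (auto simp: S_def)
        moreover have "cmod (t x) \<le> cmod (t x + of_real \<delta>) + \<delta>"
          using norm_triangle_ineq4[of "t x + of_real \<delta>" "of_real \<delta>"] \<delta> by simp
        ultimately have "r / 4 \<le> (cmod (t x + of_real \<delta>) + Re (t x) + \<delta>) / 2"
          using St[of x] that by simp
        then have "sqrt (r / 4) \<le> b x" unfolding b_eq by (rule real_sqrt_le_mono)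
        then show ?thesis by (simp add: real_sqrt_divide)
      qed
      have slit: "t x + of_real \<delta> \<notin> \<real>\<^sub>\<le>\<^sub>0" if "x \<in> V" "x \<in> K" for x
      proof
        assume *: "t x + of_real \<delta> \<in> \<real>\<^sub>\<le>\<^sub>0"
        then have "Re (t x) + \<delta> \<le> 0" "Im (t x) = 0" by (auto simp: complex_nonpos_Reals_iff)
        then have "cmod (t x) = - Re (t x)" using \<delta> by (simp add: cmod_eq_Re)
        then show False using sector[OF that(2,1)] \<open>Re (t x) + \<delta> \<le> 0\<close> \<delta> by linarith
      qed
      have bcont: "isCont b x" if "x \<in> U" for x
        unfolding b_eq[abs_def] by (intro continuous_intros isCont_Re tcont that) simp_all
      define O1 where "O1 = {x \<in> U. t x + of_real \<delta> \<notin> \<real>\<^sub>\<le>\<^sub>0}"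
      have O1: "open O1"
      proof -
        have "open (U \<inter> (\<lambda>x. t x + of_real \<delta>) -` (- \<real>\<^sub>\<le>\<^sub>0))"
          by (rule continuous_open_preimage[OF _ compatible_chart_open[OF L]]) (auto intro!: continuous_intros tcontU open_Compl)
        moreover have "O1 = U \<inter> (\<lambda>x. t x + of_real \<delta>) -` (- \<real>\<^sub>\<le>\<^sub>0)" by (auto simp: O1_def)
        ultimately show ?thesis by simp
      qed
      define O2 where "O2 = {x \<in> U \<inter> Y. u x < C * b x}"
      have O2: "open O2"
      proof -
        have "continuous_on (U \<inter> Y) (\<lambda>x. C * b x - u x)"
          using bcont superharmonic_on_isCont[OF u(1) Y(1)]
          by (intro continuous_at_imp_continuous_on ballI continuous_intros) auto
        then have "open ((U \<inter> Y) \<inter> (\<lambda>x. C * b x - u x) -` {0<..})"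
          by (rule continuous_open_preimage[OF _ open_Int[OF compatible_chart_open[OF L] Y(1)] open_greaterThan])
        moreover have "O2 = (U \<inter> Y) \<inter> (\<lambda>x. C * b x - u x) -` {0<..}" by (auto simp: O2_def)
        ultimately show ?thesis by simp
      qed
      \<comment> \<open>the slit on which \<open>b\<close> fails to be harmonic, and the part of the circle where \<open>C * b\<close> does not
        exceed \<open>u\<close>, so that gluing would fail; both avoid \<open>V\<close>\<close>
      define B where "B = (K - O1) \<union> (S - O2)"
      define u' where "u' x = (if x \<in> \<Delta> then min (u x) (C * b x) else u x)" for x
      have bharm: "harmonic_at (\<lambda>x. C * b x) x" if "x \<in> O1" for x
      proof (rule harmonic_at_cmult, rule harmonic_atI[of O1 x "\<lambda>x. csqrt (t x + of_real \<delta>)"])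
        have hol: "(\<lambda>w. csqrt ((w - \<phi> p) / a + of_real \<delta>)) holomorphic_on
             {w. (w - \<phi> p) / a + of_real \<delta> \<notin> \<real>\<^sub>\<le>\<^sub>0}"
          using a by (intro holomorphic_intros) auto
        have "hol ((\<lambda>w. csqrt ((w - \<phi> p) / a + of_real \<delta>)) \<circ> \<phi>) O1"
          by (rule hol_of_compatible_chart[OF L hol]) (auto simp: O1_def t_def)
        then show "hol (\<lambda>x. csqrt (t x + of_real \<delta>)) O1" by (simp add: t_def o_def)
        show "O1 \<subseteq> M" using compatible_chart_sub[OF L] by (auto simp: O1_def)
      qed (use that O1 in \<open>auto simp: b_def\<close>)
      have "superharmonic_on u' (Y - B)"
      proof (rule superharmonic_on_glue)
        fix x assume x: "x \<in> Y - B"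
        have ev: "\<forall>\<^sub>F y in nhds x. y \<in> A" if "open A" "x \<in> A" for A
          using that eventually_nhds by blast
        have ux: "isCont u x" "superharmonic_at u x" using superharmonic_on_isCont[OF u(1) Y(1)] superharmonic_on_superharmonic_at[OF u(1)] x by auto
        consider "x \<in> \<Delta>" | "x \<in> S" | "x \<notin> K" using T by (auto simp: S_def)
        then show "\<exists>f. isCont f x \<and> superharmonic_at f x \<and> (\<forall>\<^sub>F y in nhds x. u' y = f y)"
        proof cases
          case 1
          then have xO: "x \<in> O1" using x T by (auto simp: B_def)
          have "\<forall>\<^sub>F y in nhds x. u' y = min (u y) (C * b y)"
            using ev[OF T(1) 1] by eventually_elim (simp add: u'_def)
          moreover have "superharmonic_at (\<lambda>y. min (u y) (C * b y)) x"
            by (rule superharmonic_at_min[OF ux(2) harmonic_at_imp_superharmonic_at[OF bharm[OF xO]]])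
          moreover have "isCont (\<lambda>y. min (u y) (C * b y)) x"
            using ux(1) bcont[of x] xO by (intro continuous_intros) (auto simp: O1_def)
          ultimately show ?thesis by blast
        next
          case 2
          then have "x \<in> O2" using x by (auto simp: B_def)
          from ev[OF O2 this] have "\<forall>\<^sub>F y in nhds x. u' y = u y"
            by (rule eventually_mono) (auto simp: u'_def O2_def)
          then show ?thesis using ux by blast
        next
          case 3
          then have "x \<in> - K" by simp
          from ev[OF open_Compl[OF closedK] this] have "\<forall>\<^sub>F y in nhds x. u' y = u y"
            by (rule eventually_mono) (use T(3) in \<open>auto simp: u'_def\<close>)
          then show ?thesis using ux by blast
        qed
      qed
      moreover have "closed B" unfolding B_def using closedK Sclosed O1 O2 by blast
      moreover have "B \<subseteq> N" using KN by (auto simp: B_def S_def)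
      moreover have "B \<inter> V = {}"
      proof -
        have "x \<in> O2" if "x \<in> V" "x \<in> S" for x
        proof -
          have "C * (sqrt r / 2) \<le> C * b x" using b_ge[of x] that C(1) by (intro mult_left_mono) auto
          then have "\<bar>m\<bar> + 1 \<le> C * b x" unfolding C(2) .
          then have "u x < C * b x" using m[of x] that by auto
          then show ?thesis using that Y KN KU by (auto simp: O2_def S_def)
        qed
        then show ?thesis using slit KU by (auto simp: B_def O1_def)
      qed
      moreover have "\<forall>x\<in>Y - B. 0 \<le> u' x \<and> u' x \<le> u x"
        using u(2) b_nonneg C by (auto simp: u'_def)
      moreover have "\<forall>x. x \<notin> \<Delta> \<longrightarrow> u' x = u x" by (simp add: u'_def)
      moreover have "\<forall>x\<in>\<Delta> \<inter> (Y - B). u' x \<le> C * sqrt (cmod (t x) + \<delta>)"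
        using mult_left_mono[OF b_le, of C] C by (auto simp: u'_def min_le_iff_disj)
      ultimately show "\<exists>B u'. closed B \<and> B \<subseteq> N \<and> B \<inter> V = {} \<and> superharmonic_on u' (Y - B) \<and>
         (\<forall>x\<in>Y - B. 0 \<le> u' x \<and> u' x \<le> u x) \<and> (\<forall>x. x \<notin> \<Delta> \<longrightarrow> u' x = u x) \<and>
         (\<forall>x\<in>\<Delta> \<inter> (Y - B). u' x \<le> C * sqrt (cmod (t x) + \<delta>))" by blast
    qed
  qed
qed

end

section \<open>Isolated singularities of harmonic functions\<close>

lemma nonneg_if_perturbed_nonneg:
  fixes a c :: real
  assumes "\<And>e. e > 0 \<Longrightarrow> 0 \<le> a + e * c"
  shows "0 \<le> a"
proof (rule tendsto_lowerbound)
  show "((\<lambda>e. a + e * c) \<longlongrightarrow> a) (at_right 0)"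
    by (auto intro!: tendsto_eq_intros)
  show "\<forall>\<^sub>F e in at_right 0. 0 \<le> a + e * c"
    using eventually_at_right_less[of 0] by eventually_elim (rule assms)
qed simp

context riemann_surface
begin

lemma harmonic_on_surface_imp_harmonic_at:
  assumes g: "harmonic_on_surface atlas g W" and W: "open W" "W \<subseteq> M" and x: "x \<in> W"
  shows "harmonic_at g x"
proof -
  obtain U \<phi> where A: "(U, \<phi>) \<in> atlas" "x \<in> U" using atlas_at W x by blast
  have L: "compatible_chart (U, \<phi>)" using A compatible_chart_atlas by blast
  have op: "open (\<phi> ` (U \<inter> W))" by (rule compatible_chart_open_image[OF L W(1)])
  have "harmonic_on (g \<circ> inv_into U \<phi>) (\<phi> ` (U \<inter> W))"
    using g A(1) unfolding harmonic_on_surface_def by blast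
  then have "locally_Re (g \<circ> inv_into U \<phi>) (\<phi> ` (U \<inter> W))"
    by (rule harmonic_on_imp_locally_Re[OF _ op])
  then obtain r F where r: "r > 0" and F: "F holomorphic_on ball (\<phi> x) r"
    "\<And>w. w \<in> ball (\<phi> x) r \<Longrightarrow> (g \<circ> inv_into U \<phi>) w = Re (F w)"
    using A x unfolding locally_Re_def by blast
  show ?thesis
  proof (rule harmonic_atI)
    show "open (U \<inter> \<phi> -` ball (\<phi> x) r)" by (rule compatible_chart_open_vimage[OF L open_ball])
    show "x \<in> U \<inter> \<phi> -` ball (\<phi> x) r" using A r by simp
    show "U \<inter> \<phi> -` ball (\<phi> x) r \<subseteq> M" using compatible_chart_sub[OF L] by blast
    show "hol (F \<circ> \<phi>) (U \<inter> \<phi> -` ball (\<phi> x) r)" by (rule hol_of_compatible_chart[OF L F(1)]) auto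
    show "g y = Re ((F \<circ> \<phi>) y)" if "y \<in> U \<inter> \<phi> -` ball (\<phi> x) r" for y
      using F(2)[of "\<phi> y"] that compatible_chart_inv[OF L, of y] by simp
  qed
qed

lemma harmonic_at_imp_harmonic_on_surface:
  assumes g: "\<And>x. x \<in> W \<Longrightarrow> harmonic_at g x"
  shows "harmonic_on_surface atlas g W"
  unfolding harmonic_on_surface_def
proof safe
  fix U \<phi> assume A: "(U, \<phi>) \<in> atlas"
  have L: "compatible_chart (U, \<phi>)" using A compatible_chart_atlas by blast
  show "harmonic_on (g \<circ> inv_into U \<phi>) (\<phi> ` (U \<inter> W))"
  proof (rule harmonic_on_locally_Re, unfold locally_Re_def, safe)
    fix x assume x: "x \<in> U" "x \<in> W"
    obtain N f where N: "open N" "x \<in> N" "N \<subseteq> M" "hol f N" "\<And>y. y \<in> N \<Longrightarrow> g y = Re (f y)"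
      using g[OF x(2)] unfolding harmonic_at_def by blast
    have "open (\<phi> ` (U \<inter> N))" by (rule compatible_chart_open_image[OF L N(1)])
    moreover have "\<phi> x \<in> \<phi> ` (U \<inter> N)" using x N by blast
    ultimately obtain r where r: "r > 0" "ball (\<phi> x) r \<subseteq> \<phi> ` (U \<inter> N)" by (rule openE)
    show "\<exists>r>0. \<exists>F. F holomorphic_on ball (\<phi> x) r \<and> (\<forall>w\<in>ball (\<phi> x) r. (g \<circ> inv_into U \<phi>) w = Re (F w))"
    proof (intro exI conjI ballI)
      show "(f \<circ> inv_into U \<phi>) holomorphic_on ball (\<phi> x) r"
        by (rule holomorphic_on_subset[OF hol_compatible_chart[OF L N(1,3,4)] r(2)])
      show "(g \<circ> inv_into U \<phi>) w = Re ((f \<circ> inv_into U \<phi>) w)" if w: "w \<in> ball (\<phi> x) r" for w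
      proof -
        obtain y where "y \<in> U" "y \<in> N" "w = \<phi> y" using r(2) w by blast
        then show ?thesis using N(5) compatible_chart_inv[OF L] by simp
      qed
    qed (use r in auto)
  qed
qed

text \<open>If \<open>u\<close> is at least 1 near the puncture, then \<open>min 1 u\<close>, continued by 1, has no singularity.\<close>

lemma min_principle_punctured:
  assumes K: "compact K" "connected K" and I: "I \<subseteq> K" "open I" "K - I \<noteq> {}" "I \<subseteq> M" and q: "q \<in> I"
    and u: "continuous_on (K - {q}) u" "\<And>x. x \<in> I - {q} \<Longrightarrow> superharmonic_at u x" "\<And>x. x \<in> K - I \<Longrightarrow> 0 \<le> u x"
    and inf: "\<forall>\<^sub>F y in at q. 1 \<le> u y" and x: "x \<in> K - {q}"
  shows "0 \<le> u x"
proof -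
  define k where "k y = (if y = q then 1 else min 1 (u y))" for y
  obtain S where S: "open S" "q \<in> S" "\<And>y. y \<in> S \<Longrightarrow> y \<noteq> q \<Longrightarrow> 1 \<le> u y"
    using inf unfolding eventually_at_topological by blast
  have k1: "k y = 1" if "y \<in> S" for y using S(3)[OF that] by (auto simp: k_def)
  have kq: "\<forall>\<^sub>F y in nhds q. k y = 1" using S k1 eventually_nhds by blast
  have kne: "\<forall>\<^sub>F w in nhds y. k w = min 1 (u w)" if "y \<noteq> q" for y
  proof -
    have "\<forall>\<^sub>F w in nhds y. w \<noteq> q"
      using that open_Compl[of "{q}"] eventually_nhds[of "\<lambda>w. w \<noteq> q" y] by auto
    then show ?thesis by eventually_elim (simp add: k_def)
  qed
  have "continuous_on K k"
  proof -
    have "continuous_on ((K - {q}) \<union> (K \<inter> S)) k"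
    proof (rule continuous_on_Un_local_open)
      show "openin (top_of_set (K - {q} \<union> K \<inter> S)) (K - {q})"
        unfolding openin_open by (rule exI[of _ "- {q}"]) (use S in auto)
      show "openin (top_of_set (K - {q} \<union> K \<inter> S)) (K \<inter> S)"
        unfolding openin_open by (rule exI[of _ S]) (use S in auto)
      show "continuous_on (K - {q}) k"
        by (rule continuous_on_eq[of _ "\<lambda>y. min 1 (u y)"])
           (auto simp: k_def intro!: continuous_intros u(1))
      show "continuous_on (K \<inter> S) k"
        by (rule continuous_on_eq[of _ "\<lambda>y. 1"]) (auto simp: k1)
    qed
    moreover have "(K - {q}) \<union> (K \<inter> S) = K" using S(2) by auto
    ultimately show ?thesis by simp
  qed
  moreover have "superharmonic_at k y" if y: "y \<in> I" for y
  proof (cases "y = q")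
    case True
    show ?thesis
      by (rule superharmonic_at_cong[of "\<lambda>_. 1"]) (use kq True y I in \<open>auto intro!: harmonic_at_imp_superharmonic_at harmonic_at_const\<close>)
  next
    case False
    show ?thesis
      by (rule superharmonic_at_cong[OF _ kne[OF False]], rule superharmonic_at_min)
         (use u(2) y False I in \<open>auto intro!: harmonic_at_imp_superharmonic_at harmonic_at_const\<close>)
  qed
  moreover have "0 \<le> k y" if "y \<in> K - I" for y
    using u(3)[OF that] q that by (auto simp: k_def)
  ultimately have "0 \<le> k x"
    using min_principle[OF K I, of k 0 x] x by blast
  then show ?thesis using x by (auto simp: k_def)
qed

end

text \<open>The radius \<open>\<rho>\<close> only fixes a closed coordinate disc around \<open>pt\<close> in the interior of \<open>V\<close>, in which
  all local constructions at \<open>pt\<close> take place.\<close>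

locale pointed_bordered_surface = compact_riemann_surface_with_boundary M atlas V
  for M :: "'a::t2_space set" and atlas V +
  fixes pt :: 'a and U0 :: "'a set" and z :: "'a \<Rightarrow> complex" and \<rho> :: real
  assumes coord: "local_coordinate_at M atlas pt (U0, z)"
    and rho: "\<rho> > 0" "cball 0 \<rho> \<subseteq> z ` (U0 \<inter> interior V)"
begin

lemma zchart: "compatible_chart (U0, z)" and pt_U0: "pt \<in> U0" and z_pt: "z pt = 0"
  using coord by (auto simp: local_coordinate_at_def compatible_chart_def)

definition odisc where "odisc s = {x \<in> U0. cmod (z x) < s}"
definition cdisc where "cdisc s = {x \<in> U0. cmod (z x) \<le> s}"

lemma z_zero: "x \<in> U0 \<Longrightarrow> z x = 0 \<longleftrightarrow> x = pt"
  using compatible_chart_inj[OF zchart _ pt_U0] z_pt by auto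

lemma cdisc_interior: "s \<le> \<rho> \<Longrightarrow> cdisc s \<subseteq> interior V"
proof
  fix x assume "s \<le> \<rho>" "x \<in> cdisc s"
  then have x: "x \<in> U0" "z x \<in> cball 0 \<rho>" by (auto simp: cdisc_def)
  then obtain y where "y \<in> U0" "y \<in> interior V" "z x = z y" using rho(2) by blast
  then show "x \<in> interior V" using compatible_chart_inj[OF zchart x(1)] by blast
qed

lemma regular_disc_cdisc:
  assumes "0 < s" "s \<le> \<rho>" shows "regular_disc (odisc s) (cdisc s)"
proof -
  have "cball 0 s \<subseteq> z ` U0" using rho(2) subset_cball[OF assms(2), of 0] by blast
  from regular_disc_coordinate[OF zchart assms(1) this] show ?thesis
    by (simp add: odisc_def cdisc_def)
qed

lemma pt_odisc: "0 < s \<Longrightarrow> pt \<in> odisc s" using pt_U0 z_pt by (simp add: odisc_def)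

lemma pt_interior: "pt \<in> interior V"
  using cdisc_interior[of \<rho>] pt_odisc[OF rho(1)] by (auto simp: odisc_def cdisc_def)

lemma z_isCont: "x \<in> U0 \<Longrightarrow> isCont z x"
  using compatible_chart_isCont[OF zchart] .

lemma U0_open: "open U0" and U0_sub: "U0 \<subseteq> M"
  using compatible_chart_open[OF zchart] compatible_chart_sub[OF zchart] by auto

lemma odisc_open: "open (odisc s)"
proof -
  have "odisc s = U0 \<inter> z -` ball 0 s" by (auto simp: odisc_def)
  then show ?thesis using compatible_chart_open_vimage[OF zchart open_ball] by simp
qed

lemma cdisc_closed: "0 < s \<Longrightarrow> s \<le> \<rho> \<Longrightarrow> closed (cdisc s)"
  using regular_disc_compact[OF regular_disc_cdisc] compact_imp_closed by blast

lemma harm_ln_z: "x \<in> U0 - {pt} \<Longrightarrow> harmonic_at (\<lambda>y. ln (cmod (z y))) x"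
  by (rule harmonic_at_ln[of U0]) (use U0_open U0_sub zchart z_zero in \<open>auto intro: hol_chart\<close>)

lemma eventually_at_pt:
  assumes "0 < s" "\<And>x. x \<in> odisc s - {pt} \<Longrightarrow> P x"
  shows "eventually P (at pt)"
  unfolding eventually_at_topological
  by (intro exI[of _ "odisc s"]) (use assms odisc_open pt_odisc in auto)

lemma at_pt_nontrivial: "at pt \<noteq> bot"
proof
  assume "at pt = bot"
  then have "open {pt}" by (simp add: at_eq_bot_iff)
  then have "open (z ` (U0 \<inter> {pt}))" by (rule compatible_chart_open_image[OF zchart])
  moreover have "z ` (U0 \<inter> {pt}) = {0}" using pt_U0 z_pt by auto
  ultimately show False using not_open_singleton[of "0::complex"] by simp
qed

lemma cdisc_compact: "0 < s \<Longrightarrow> s \<le> \<rho> \<Longrightarrow> compact (cdisc s)"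
  using regular_disc_compact[OF regular_disc_cdisc] .

text \<open>A logarithmic pole, however weak, outweighs a function that is bounded below. This is what allows
  bounded singularities to be ignored in comparisons.\<close>

lemma log_dominates:
  assumes e: "e > 0" and f: "\<forall>\<^sub>F x in at pt. B \<le> f x"
  shows "\<forall>\<^sub>F x in at pt. 1 \<le> f x - e * ln (cmod (z x))"
proof -
  define s where "s = exp ((B - 1) / e)"
  have "s > 0" by (simp add: s_def)
  have "\<forall>\<^sub>F x in at pt. x \<in> odisc s - {pt}"
    by (rule eventually_at_pt[OF \<open>s > 0\<close>])
  with f show ?thesis
  proof eventually_elim
    case (elim x)
    then have "cmod (z x) > 0" "cmod (z x) < s" using z_zero by (auto simp: odisc_def)
    then have "ln (cmod (z x)) \<le> ln s" using \<open>s > 0\<close> by simp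
    then have "ln (cmod (z x)) \<le> (B - 1) / e" by (simp add: s_def)
    then have "e * ln (cmod (z x)) \<le> B - 1" using e by (simp add: field_simps)
    then show ?case using elim(1) by linarith
  qed
qed

text \<open>Let \<open>h\<close> solve the Dirichlet problem with the boundary values of \<open>f\<close>. The bounded differences
  \<open>h - f\<close> and \<open>f - h\<close> become nonnegative after adding any positive multiple of a logarithmic pole,
  hence are nonnegative.\<close>

lemma removable_singularity:
  assumes s: "0 < s" "s < s'" "s' \<le> \<rho>" and f: "\<And>x. x \<in> odisc s' - {pt} \<Longrightarrow> harmonic_at f x"
    and B: "\<And>x. x \<in> odisc s' - {pt} \<Longrightarrow> \<bar>f x\<bar> \<le> B"
  obtains h where "\<And>x. x \<in> odisc s \<Longrightarrow> harmonic_at h x" "\<And>x. x \<in> odisc s - {pt} \<Longrightarrow> h x = f x"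
    "continuous_on (cdisc s) h" "\<And>x. x \<in> cdisc s - odisc s \<Longrightarrow> h x = f x" "((f \<longlongrightarrow> h pt) (at pt))"
proof -
  have sub: "cdisc s \<subseteq> odisc s'" using s by (auto simp: cdisc_def odisc_def)
  have RD: "regular_disc (odisc s) (cdisc s)" using s by (intro regular_disc_cdisc) auto
  note T = regular_disc_open[OF RD] regular_disc_compact[OF RD] regular_disc_connected(2)[OF RD]
    regular_disc_sub[OF RD] regular_disc_boundary[OF RD]
  have fcont: "continuous_on (cdisc s - {pt}) f"
    using harmonic_at_isCont[OF f] sub by (intro continuous_at_imp_continuous_on) blast
  \<comment> \<open>continuous across \<open>pt\<close>, and equal to \<open>f\<close> on the boundary circle: admissible boundary data\<close>
  define u where "u x = f x * cmod (z x) / s" for x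
  have "continuous_on (cdisc s) u"
  proof (rule continuous_at_imp_continuous_on, safe)
    fix x assume x: "x \<in> cdisc s"
    show "isCont u x"
    proof (cases "x = pt")
      case False
      then show ?thesis unfolding u_def
        using x sub s harmonic_at_isCont[OF f, of x] z_isCont[of x]
        by (intro continuous_intros) (auto simp: cdisc_def)
    next
      case True
      have "(\<lambda>x. \<bar>B\<bar> * cmod (z x) / s) \<midarrow>pt\<rightarrow> \<bar>B\<bar> * cmod (z pt) / s"
        using z_isCont[OF pt_U0] s unfolding isCont_def by (intro tendsto_intros) auto
      then have lim: "(\<lambda>x. \<bar>B\<bar> * cmod (z x) / s) \<midarrow>pt\<rightarrow> 0" by (simp add: z_pt)
      have "u \<midarrow>pt\<rightarrow> 0"
      proof (rule Lim_null_comparison[OF _ lim])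
        show "\<forall>\<^sub>F x in at pt. norm (u x) \<le> \<bar>B\<bar> * cmod (z x) / s"
        proof (rule eventually_at_pt[of s'])
          fix x assume "x \<in> odisc s' - {pt}"
          then have "\<bar>f x\<bar> \<le> \<bar>B\<bar>" using B[of x] by linarith
          then show "norm (u x) \<le> \<bar>B\<bar> * cmod (z x) / s"
            using s by (auto simp: u_def abs_mult intro!: divide_right_mono mult_right_mono)
        qed (use s in auto)
      qed
      then show ?thesis using True by (simp add: isCont_def u_def z_pt)
    qed
  qed
  then obtain h where h: "continuous_on (cdisc s) h" "\<And>x. x \<in> cdisc s - odisc s \<Longrightarrow> h x = u x"
    "\<And>x. x \<in> odisc s \<Longrightarrow> harmonic_at h x"
    by (rule regular_disc_Dirichlet[OF RD]) (rule that)
  have hf: "h x = f x" if "x \<in> cdisc s - odisc s" for x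
  proof -
    have "cmod (z x) = s" using that by (auto simp: cdisc_def odisc_def)
    then show ?thesis using h(2)[OF that] s by (simp add: u_def)
  qed
  obtain m where m: "\<And>x. x \<in> cdisc s \<Longrightarrow> \<bar>h x\<bar> \<le> m"
    using compact_imp_bounded[OF compact_continuous_image[OF h(1) T(2)]]
    unfolding bounded_iff by (metis imageI real_norm_def)
  have lnz: "continuous_on (cdisc s - {pt}) (\<lambda>x. ln (cmod (z x)))"
    using harmonic_at_isCont[OF harm_ln_z] by (intro continuous_at_imp_continuous_on) (auto simp: cdisc_def)
  have key: "0 \<le> k x"
    if k: "continuous_on (cdisc s - {pt}) k" "\<And>x. x \<in> odisc s - {pt} \<Longrightarrow> harmonic_at k x"
      "\<And>x. x \<in> cdisc s - odisc s \<Longrightarrow> k x = 0" "\<And>x. x \<in> odisc s - {pt} \<Longrightarrow> - m - B \<le> k x"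
      and x: "x \<in> odisc s - {pt}" for k x
  proof -
    have xU: "x \<in> U0" "cmod (z x) > 0" using x z_zero by (auto simp: odisc_def)
    have le: "0 \<le> k x + e * (ln s - ln (cmod (z x)))" if e: "e > 0" for e
    proof -
      have "0 \<le> (k x + e * ln s) - e * ln (cmod (z x))"
      proof (rule min_principle_punctured[OF T(2,3) T(4,1,6) _ pt_odisc[OF s(1)],
              of "\<lambda>x. (k x + e * ln s) - e * ln (cmod (z x))"])
        show "continuous_on (cdisc s - {pt}) (\<lambda>x. (k x + e * ln s) - e * ln (cmod (z x)))"
          by (intro continuous_intros k lnz)
        show "superharmonic_at (\<lambda>x. (k x + e * ln s) - e * ln (cmod (z x))) y" if "y \<in> odisc s - {pt}" for y
          by (intro harmonic_at_imp_superharmonic_at harmonic_at_diff harmonic_at_add harmonic_at_const harmonic_at_cmult k(2) harm_ln_z)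
             (use that U0_sub in \<open>auto simp: odisc_def\<close>)
        show "0 \<le> (k y + e * ln s) - e * ln (cmod (z y))" if "y \<in> cdisc s - odisc s" for y
        proof -
          have "cmod (z y) = s" using that by (auto simp: cdisc_def odisc_def)
          then show ?thesis using k(3)[OF that] by simp
        qed
        show "\<forall>\<^sub>F y in at pt. 1 \<le> (k y + e * ln s) - e * ln (cmod (z y))"
          by (rule log_dominates[OF e, of "- m - B + e * ln s"], rule eventually_at_pt[OF s(1)])
             (use k(4) in auto)
        show "x \<in> cdisc s - {pt}" using x T by blast
      qed (use T in auto)
      then show ?thesis by (simp add: right_diff_distrib)
    qed
    show ?thesis by (rule nonneg_if_perturbed_nonneg[OF le])
  qed
  have hc: "continuous_on (cdisc s - {pt}) h" using h(1) continuous_on_subset by blast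
  have eq: "h x = f x" if x: "x \<in> odisc s - {pt}" for x
  proof -
    have bnd: "- m - B \<le> h y - f y \<and> - m - B \<le> f y - h y" if "y \<in> odisc s - {pt}" for y
    proof -
      have "y \<in> cdisc s" "y \<in> odisc s' - {pt}" using that T(4) sub by auto
      then show ?thesis using m[of y] B[of y] by linarith
    qed
    have "0 \<le> h x - f x"
      by (rule key[of "\<lambda>x. h x - f x", OF _ _ _ _ x])
         (use h f hf bnd T sub in \<open>auto intro!: continuous_intros fcont hc harmonic_at_diff\<close>)
    moreover have "0 \<le> f x - h x"
      by (rule key[of "\<lambda>x. f x - h x", OF _ _ _ _ x])
         (use h f hf bnd T sub in \<open>auto intro!: continuous_intros fcont hc harmonic_at_diff\<close>)
    ultimately show ?thesis by simp
  qed
  show thesis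
  proof (rule that[OF h(3) eq h(1) hf])
    have "h \<midarrow>pt\<rightarrow> h pt" using harmonic_at_isCont[OF h(3)[OF pt_odisc[OF s(1)]]] by (simp add: isCont_def)
    then show "f \<midarrow>pt\<rightarrow> h pt"
      by (rule Lim_transform_eventually) (use eventually_at_pt[OF s(1)] eq in simp)
  qed
qed

end

section \<open>The Green function and its approximation from outside\<close>

lemma eventually_pos_isCont:
  fixes f :: "'a::t2_space \<Rightarrow> real"
  assumes "isCont f x" "f x > c"
  shows "\<forall>\<^sub>F y in nhds x. c < f y"
  using assms order_tendstoD(1)[of f "f x" "nhds x" c] by (simp add: continuous_at tendsto_at_iff_tendsto_nhds)

context pointed_bordered_surface
begin

text \<open>A subharmonic function with a logarithmic pole at \<open>pt\<close>, which serves as a lower bound for all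
  competitors and thereby gives the infimum its pole.\<close>

definition pole :: "'a \<Rightarrow> real" where
  "pole x = (if x \<in> U0 then max 0 (ln (\<rho> / 3) - ln (cmod (z x))) else 0)"

lemma pole_nonneg: "0 \<le> pole x" by (simp add: pole_def)

lemma pole_outside:
  assumes "x \<notin> odisc (\<rho> / 3)" shows "pole x = 0"
proof (cases "x \<in> U0")
  case True
  then have le: "\<rho> / 3 \<le> cmod (z x)" using assms by (simp add: odisc_def)
  moreover have "0 < \<rho> / 3" using rho by simp
  ultimately have "ln (\<rho> / 3) \<le> ln (cmod (z x))" using ln_mono by (smt (verit))
  then show ?thesis by (simp add: pole_def)
qed (simp add: pole_def)

lemma pole_ge: "x \<in> U0 \<Longrightarrow> ln (\<rho> / 3) - ln (cmod (z x)) \<le> pole x"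
  unfolding pole_def by (simp only: if_True max.cobounded2)

lemma pole_le: "x \<in> U0 \<Longrightarrow> ln (\<rho> / 3) - ln (cmod (z x)) \<le> C \<Longrightarrow> 0 \<le> C \<Longrightarrow> pole x \<le> C"
  unfolding pole_def by (simp only: if_True max.bounded_iff)

lemma superharmonic_on_minus_pole: "superharmonic_on (\<lambda>x. - pole x) (M - {pt})"
proof (rule superharmonic_on_glue)
  fix x assume x: "x \<in> M - {pt}"
  show "\<exists>f. isCont f x \<and> superharmonic_at f x \<and> (\<forall>\<^sub>F y in nhds x. - pole y = f y)"
  proof (cases "x \<in> U0")
    case True
    define f where "f y = min 0 (ln (cmod (z y)) - ln (\<rho> / 3))" for y
    have h: "harmonic_at (\<lambda>y. ln (cmod (z y)) - ln (\<rho> / 3)) x"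
      using True x by (intro harmonic_at_diff harm_ln_z harmonic_at_const) auto
    have "open (U0 - {pt})" using U0_open by (simp add: open_delete)
    then have "\<forall>\<^sub>F y in nhds x. y \<in> U0 - {pt}"
      using True x eventually_nhds by blast
    then have "\<forall>\<^sub>F y in nhds x. - pole y = f y"
      by eventually_elim (auto simp: pole_def f_def min_def max_def)
    moreover have "isCont f x"
      unfolding f_def by (rule continuous_min[OF continuous_const harmonic_at_isCont[OF h]])
    moreover have "superharmonic_at f x"
      unfolding f_def using x by (intro superharmonic_at_min harmonic_at_imp_superharmonic_at h harmonic_at_const) auto
    ultimately show ?thesis by blast
  next
    case False
    have "closed (cdisc \<rho>)" using cdisc_closed rho by simp
    moreover have "x \<notin> cdisc \<rho>" using False by (simp add: cdisc_def)
    ultimately have "\<forall>\<^sub>F y in nhds x. y \<in> - cdisc \<rho>"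
      using eventually_nhds[of "\<lambda>y. y \<in> - cdisc \<rho>" x] by blast
    then have "\<forall>\<^sub>F y in nhds x. - pole y = 0"
      by eventually_elim (use rho in \<open>auto simp: cdisc_def odisc_def intro!: pole_outside\<close>)
    then show ?thesis using x by (intro exI[of _ "\<lambda>_. 0"]) (auto intro!: harmonic_at_imp_superharmonic_at harmonic_at_const)
  qed
qed

text \<open>The superharmonic functions on a neighbourhood \<open>W\<close> of \<open>V\<close> that compete for the Green function.
  Letting \<open>W\<close> shrink as well, their infimum over all \<open>W\<close> is the Green function of \<open>V\<close>.\<close>

definition competitor :: "'a set \<Rightarrow> ('a \<Rightarrow> real) \<Rightarrow> bool" where
  "competitor W u \<longleftrightarrow> open W \<and> V \<subseteq> W \<and> W \<subseteq> M \<and> superharmonic_on u (W - {pt}) \<and> (\<forall>x\<in>W - {pt}. pole x \<le> u x)"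

lemma competitor_min:
  assumes "competitor W u" "competitor W' u'"
  shows "competitor (W \<inter> W') (\<lambda>x. min (u x) (u' x))"
proof -
  have "superharmonic_on (\<lambda>x. min (u x) (u' x)) (W \<inter> W' - {pt})"
    using assms by (intro superharmonic_on_min) (auto simp: competitor_def intro: superharmonic_on_subset)
  then show ?thesis using assms by (auto simp: competitor_def)
qed

lemma competitor_modification:
  assumes u: "competitor W u" and R: "regular_disc D K" "K \<subseteq> W - {pt}"
  obtains w where "competitor W w" "\<And>x. x \<in> W - {pt} \<Longrightarrow> w x \<le> u x" "\<And>x. x \<in> D \<Longrightarrow> harmonic_at w x"
proof -
  have W: "open (W - {pt})" "superharmonic_on u (W - {pt})" using u by (auto simp: competitor_def open_delete)
  obtain w where w: "superharmonic_on w (W - {pt})" "\<And>x. x \<in> W - {pt} \<Longrightarrow> w x \<le> u x" "\<And>x. x \<notin> D \<Longrightarrow> w x = u x"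
    "\<And>x. x \<in> D \<Longrightarrow> harmonic_at w x"
    "\<And>v. \<forall>x\<in>W - {pt}. v x \<le> u x \<Longrightarrow> superharmonic_on (\<lambda>x. - v x) (W - {pt}) \<Longrightarrow> \<forall>x\<in>W - {pt}. v x \<le> w x"
    by (rule superharmonic_on_modification[OF W R]) (rule that)
  have "superharmonic_on (\<lambda>x. - pole x) (W - {pt})"
    by (rule superharmonic_on_subset[OF superharmonic_on_minus_pole]) (use u in \<open>auto simp: competitor_def\<close>)
  then have "\<forall>x\<in>W - {pt}. pole x \<le> w x"
    using w(5)[of pole] u by (auto simp: competitor_def)
  then have "competitor W w" using u w(1) by (auto simp: competitor_def)
  then show thesis using that w by blast
qed

lemma frontier_V_nonempty: obtains p where "p \<in> frontier V" "p \<in> V" "p \<notin> interior V"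
  using V_boundary V_closed by (auto simp: frontier_def)

text \<open>A superharmonic function between 0 and 1 that equals 1 on a small disc around \<open>pt\<close> and is
  less than 1 on a larger circle: the existence of such a function expresses that the boundary of \<open>V\<close>
  is not negligible. The barrier at one boundary point \<open>p\<close>, applied to the constant 1, provides a
  function that is less than 1 at \<open>p\<close>. By modifications on discs, the set \<open>Z\<close> of points at which some
  function of this kind is less than 1 is open and closed in the complement of the small disc. As
  \<open>V\<close> is connected, \<open>Z\<close> reaches the circle, and compactness of the circle then leaves a
  single function.\<close>

lemma capacity_function:
  obtains W s where "open W" "V \<subseteq> W" "W \<subseteq> M" "superharmonic_on s W" "\<And>x. x \<in> W \<Longrightarrow> 0 \<le> s x \<and> s x \<le> 1"
    "\<And>x. x \<in> cdisc (\<rho> / 3) \<Longrightarrow> s x = 1" "\<And>x. x \<in> U0 \<Longrightarrow> cmod (z x) = 2 * \<rho> / 3 \<Longrightarrow> s x < 1"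
proof -
  obtain p where p: "p \<in> frontier V" "p \<in> V" "p \<notin> interior V" by (rule frontier_V_nonempty)
  have kkV: "cdisc \<rho> \<subseteq> V" using cdisc_interior[of \<rho>] interior_subset by blast
  have N: "open (M - cdisc \<rho>)" "p \<in> M - cdisc \<rho>"
    using open_carrier cdisc_closed[of \<rho>] rho p cdisc_interior[of \<rho>] V_subset by auto
  obtain \<Delta> \<tau> where \<Delta>: "open \<Delta>" "p \<in> \<Delta>" "\<Delta> \<subseteq> M - cdisc \<rho>" "\<tau> p = 0"
    and bar: "\<And>Y u. open Y \<Longrightarrow> Y \<subseteq> M \<Longrightarrow> V \<inter> (M - cdisc \<rho>) \<subseteq> Y \<Longrightarrow> superharmonic_on u Y \<Longrightarrow> \<forall>x\<in>Y. 0 \<le> u x \<Longrightarrow>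
       \<exists>C\<ge>0. \<forall>\<delta>>0. \<exists>B u'. closed B \<and> B \<subseteq> M - cdisc \<rho> \<and> B \<inter> V = {} \<and> superharmonic_on u' (Y - B) \<and>
         (\<forall>x\<in>Y - B. 0 \<le> u' x \<and> u' x \<le> u x) \<and> (\<forall>x. x \<notin> \<Delta> \<longrightarrow> u' x = u x) \<and>
         (\<forall>x\<in>\<Delta> \<inter> (Y - B). u' x \<le> C * sqrt (\<tau> x + \<delta>))"
    by (rule barrier[OF p(1) N]) (rule that)
  have "\<exists>C\<ge>0. \<forall>\<delta>>0. \<exists>B u'. closed B \<and> B \<subseteq> M - cdisc \<rho> \<and> B \<inter> V = {} \<and> superharmonic_on u' (M - B) \<and>
         (\<forall>x\<in>M - B. 0 \<le> u' x \<and> u' x \<le> 1) \<and> (\<forall>x. x \<notin> \<Delta> \<longrightarrow> u' x = 1) \<and>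
         (\<forall>x\<in>\<Delta> \<inter> (M - B). u' x \<le> C * sqrt (\<tau> x + \<delta>))"
    by (rule bar[of M "\<lambda>_. 1"]) (auto simp: open_carrier superharmonic_on_const)
  then obtain C where C: "C \<ge> 0" and bar': "\<forall>\<delta>>0. \<exists>B u'. closed B \<and> B \<subseteq> M - cdisc \<rho> \<and> B \<inter> V = {} \<and> superharmonic_on u' (M - B) \<and>
         (\<forall>x\<in>M - B. 0 \<le> u' x \<and> u' x \<le> 1) \<and> (\<forall>x. x \<notin> \<Delta> \<longrightarrow> u' x = 1) \<and>
         (\<forall>x\<in>\<Delta> \<inter> (M - B). u' x \<le> C * sqrt (\<tau> x + \<delta>))" by (elim exE conjE)
  \<comment> \<open>makes the barrier bound \<open>C * sqrt \<delta>\<close> at \<open>p\<close> smaller than 1\<close>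
  define \<delta> where "\<delta> = (1 / (C + 1))\<^sup>2"
  have "sqrt \<delta> = 1 / (C + 1)" unfolding \<delta>_def real_sqrt_abs using C by simp
  then have \<delta>: "\<delta> > 0" "C * sqrt \<delta> < 1" using C by (auto simp: \<delta>_def)
  obtain B s0 where B: "closed B" "B \<subseteq> M - cdisc \<rho>" "B \<inter> V = {}" and s0: "superharmonic_on s0 (M - B)"
    "\<forall>x\<in>M - B. 0 \<le> s0 x \<and> s0 x \<le> 1" "\<forall>x. x \<notin> \<Delta> \<longrightarrow> s0 x = 1"
    "\<forall>x\<in>\<Delta> \<inter> (M - B). s0 x \<le> C * sqrt (\<tau> x + \<delta>)"
    using bar'[rule_format, OF \<delta>(1)] by (elim exE conjE)
  define W where "W = M - B"
  have W: "open W" "V \<subseteq> W" "W \<subseteq> M" using open_carrier B V_subset by (auto simp: W_def)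
  have s0p: "s0 p < 1"
    using s0(4) \<Delta> p B W \<delta> by (force simp: W_def)
  let ?r = "\<rho> / 3"
  have r: "0 < ?r" "?r \<le> \<rho>" using rho by auto
  define T where "T = {s. superharmonic_on s W \<and> (\<forall>x\<in>W. 0 \<le> s x \<and> s x \<le> 1) \<and> (\<forall>x\<in>cdisc ?r. s x = 1)}"
  have kkr: "cdisc ?r \<subseteq> cdisc \<rho>" using rho by (auto simp: cdisc_def)
  have s0T: "s0 \<in> T" using s0 \<Delta>(3) kkr by (auto simp: T_def W_def)
  have Tmin: "(\<lambda>x. min (s x) (t x)) \<in> T" if "s \<in> T" "t \<in> T" for s t
    using that by (auto simp: T_def superharmonic_on_min)
  have Tcont: "isCont s x" if "s \<in> T" "x \<in> W" for s x
    using that superharmonic_on_isCont[OF _ W(1)] by (auto simp: T_def)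
  define Z where "Z = {x \<in> W. \<exists>s\<in>T. s x < 1}"
  have Zkk: "Z \<inter> cdisc ?r = {}" by (auto simp: Z_def T_def)
  have "open Z"
  proof -
    have "open (W \<inter> s -` {..<1})" if "s \<in> T" for s
      by (rule continuous_open_preimage[OF _ W(1) open_lessThan])
         (use Tcont[OF that] in \<open>auto intro: continuous_at_imp_continuous_on\<close>)
    then have "open (\<Union>s\<in>T. W \<inter> s -` {..<1})" by blast
    moreover have "Z = (\<Union>s\<in>T. W \<inter> s -` {..<1})" by (auto simp: Z_def)
    ultimately show ?thesis by simp
  qed
  have spread: "D \<subseteq> Z" if R: "regular_disc D K" "K \<subseteq> W - cdisc ?r" and y: "y \<in> D \<inter> Z" for D K y
  proof
    fix x assume x: "x \<in> D"
    obtain s where s: "s \<in> T" "s y < 1" using y by (auto simp: Z_def)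
    have sW: "superharmonic_on s W" "K \<subseteq> W" using s R by (auto simp: T_def)
    obtain w where w: "superharmonic_on w W" "\<And>x. x \<in> W \<Longrightarrow> w x \<le> s x" "\<And>x. x \<notin> D \<Longrightarrow> w x = s x"
      "\<And>x. x \<in> D \<Longrightarrow> harmonic_at w x"
      "\<And>v. \<forall>x\<in>W. v x \<le> s x \<Longrightarrow> superharmonic_on (\<lambda>x. - v x) W \<Longrightarrow> \<forall>x\<in>W. v x \<le> w x"
      by (rule superharmonic_on_modification[OF W(1) sW(1) R(1) sW(2)]) (rule that)
    have DK: "D \<subseteq> K" by (rule regular_disc_sub(1)[OF R(1)])
    have "0 \<le> w x" if "x \<in> W" for x
      using w(5)[of "\<lambda>_. 0"] s that superharmonic_on_const[OF W(3)] by (auto simp: T_def)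
    moreover have "w x \<le> 1" if "x \<in> W" for x using w(2)[OF that] s that by (force simp: T_def)
    moreover have "w x = 1" if "x \<in> cdisc ?r" for x
    proof -
      have "x \<notin> D" using that R DK by auto
      then show ?thesis using w(3) s(1) that by (simp add: T_def)
    qed
    ultimately have wT: "w \<in> T" using w(1) by (simp add: T_def)
    have DW: "D \<subseteq> W" using DK R by blast
    have "w x < 1"
    proof (rule ccontr)
      assume "\<not> w x < 1"
      then have "- w x = - 1" using \<open>\<And>x. x \<in> W \<Longrightarrow> w x \<le> 1\<close>[of x] x DW by force
      then have "- w y = - 1"
        using harmonic_at_nonneg_zero[OF regular_disc_connected(1)[OF R(1)] regular_disc_open[OF R(1)] x,
            of "\<lambda>x. - w x" "-1" y] w(4) \<open>\<And>x. x \<in> W \<Longrightarrow> w x \<le> 1\<close> DW y harmonic_at_minus by fastforce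
      then show False using w(2)[of y] s(2) y DW by force
    qed
    then show "x \<in> Z" using wT x DW by (auto simp: Z_def)
  qed
  \<comment> \<open>if the annulus around the small disc were not contained in \<open>Z\<close>, it would be disjoint from it, and
    \<open>V\<close> would fall apart into \<open>Z\<close> and the union of \<open>Z2\<close> with the disc\<close>
  define Z2 where "Z2 = W - cdisc ?r - Z"
  have opW: "open (W - cdisc ?r)" using W(1) cdisc_closed[OF r] by blast
  have "open Z2"
  proof (subst open_subopen, safe)
    fix x assume x: "x \<in> Z2"
    then have xW: "x \<in> W - cdisc ?r" "x \<notin> Z" by (auto simp: Z2_def)
    obtain D K where R: "regular_disc D K" "x \<in> D" "K \<subseteq> W - cdisc ?r"
      using regular_disc_ex[OF _ opW xW(1)] xW W(3) by blast
    have "D \<inter> Z = {}" using spread[OF R(1,3)] R(2) xW(2) by blast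
    then have "D \<subseteq> Z2" using R(3) regular_disc_sub(1)[OF R(1)] by (auto simp: Z2_def)
    then show "\<exists>T. open T \<and> x \<in> T \<and> T \<subseteq> Z2" using R(2) regular_disc_open[OF R(1)] by blast
  qed
  define A where "A = {x \<in> U0. ?r < cmod (z x) \<and> cmod (z x) < \<rho>}"
  have "connected A"
  proof -
    have sub: "{w. ?r < norm (w - 0) \<and> norm (w - 0) < \<rho>} \<subseteq> z ` U0"
    proof
      fix w :: complex assume "w \<in> {w. ?r < norm (w - 0) \<and> norm (w - 0) < \<rho>}"
      then have "w \<in> cball 0 \<rho>" by simp
      then show "w \<in> z ` U0" using rho(2) by blast
    qed
    have "A = inv_into U0 z ` {w. ?r < norm (w - 0) \<and> norm (w - 0) < \<rho>}"
    proof
      show "A \<subseteq> inv_into U0 z ` {w. ?r < norm (w - 0) \<and> norm (w - 0) < \<rho>}"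
        using compatible_chart_inv[OF zchart] by (force simp: A_def)
      show "inv_into U0 z ` {w. ?r < norm (w - 0) \<and> norm (w - 0) < \<rho>} \<subseteq> A"
      proof clarify
        fix w :: complex assume "?r < norm (w - 0)" "norm (w - 0) < \<rho>"
        moreover from this have "w \<in> z ` U0" using sub by blast
        ultimately show "inv_into U0 z w \<in> A" by (auto simp: A_def compatible_chart_inv[OF zchart])
      qed
    qed
    moreover have "connected (inv_into U0 z ` {w. ?r < norm (w - 0) \<and> norm (w - 0) < \<rho>})"
      by (rule connected_continuous_image[OF continuous_on_subset[OF compatible_chart_inv_cont[OF zchart] sub] connected_annulus(1)])
         simp
    ultimately show ?thesis by simp
  qed
  have AW: "A \<subseteq> Z \<union> Z2" using kkV W by (auto simp: A_def Z2_def cdisc_def subset_eq)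
  have "A \<subseteq> Z"
  proof (rule ccontr)
    assume "\<not> A \<subseteq> Z"
    then have "Z2 \<inter> A \<noteq> {}" using AW by blast
    then have AZ: "Z \<inter> A = {}"
      using connectedD[OF \<open>connected A\<close> \<open>open Z\<close> \<open>open Z2\<close> _ AW] by (auto simp: Z2_def)
    have dZ: "odisc \<rho> \<inter> Z = {}" using AZ Zkk by (auto simp: odisc_def A_def cdisc_def set_eq_iff not_less)
    have cov: "V \<subseteq> Z \<union> (Z2 \<union> odisc \<rho>)" using W(2) rho by (auto simp: Z2_def cdisc_def odisc_def)
    have disj: "Z \<inter> (Z2 \<union> odisc \<rho>) \<inter> V = {}" using dZ by (auto simp: Z2_def)
    have "open (Z2 \<union> odisc \<rho>)" using \<open>open Z2\<close> odisc_open by blast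
    from connectedD[OF V_connected \<open>open Z\<close> this disj cov]
    have "Z \<inter> V = {} \<or> (Z2 \<union> odisc \<rho>) \<inter> V = {}" .
    moreover have "p \<in> Z \<inter> V" using s0p s0T p W by (auto simp: Z_def)
    moreover have "pt \<in> (Z2 \<union> odisc \<rho>) \<inter> V" using pt_odisc[OF rho(1)] pt_interior interior_subset by blast
    ultimately show False by blast
  qed
  define C2 where "C2 = {x \<in> U0. cmod (z x) = 2 * \<rho> / 3}"
  have C2A: "C2 \<subseteq> A" "C2 \<subseteq> W" using rho \<open>A \<subseteq> Z\<close> by (auto simp: C2_def A_def Z_def)
  have "compact C2"
  proof -
    have "C2 = cdisc (2 * \<rho> / 3) - odisc (2 * \<rho> / 3)" by (auto simp: C2_def cdisc_def odisc_def)
    moreover have "compact (cdisc (2 * \<rho> / 3) - odisc (2 * \<rho> / 3))"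
      by (rule compact_diff[OF cdisc_compact odisc_open]) (use rho in auto)
    ultimately show ?thesis by simp
  qed
  have "\<exists>s\<in>T. \<forall>x\<in>C2. s x < 1"
  proof (rule directed_compact_less[OF \<open>compact C2\<close>])
    show "T \<noteq> {}" using s0T by blast
    show "continuous_on C2 s" if "s \<in> T" for s
      using Tcont[OF that] C2A by (intro continuous_at_imp_continuous_on) blast
    show "\<exists>w\<in>T. \<forall>x\<in>C2. w x \<le> s x \<and> w x \<le> t x" if "s \<in> T" "t \<in> T" for s t
      using Tmin[OF that] by (rule bexI[rotated]) simp
    show "\<exists>s\<in>T. s x < 1" if "x \<in> C2" for x using that C2A \<open>A \<subseteq> Z\<close> by (auto simp: Z_def)
  qed
  then obtain s where "s \<in> T" "\<And>x. x \<in> C2 \<Longrightarrow> s x < 1" by blast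
  then show thesis using W by (intro that[of W s]) (auto simp: T_def C2_def)
qed

text \<open>Inside a small circle take \<open>C - ln \<bar>z\<bar>\<close>, outside a larger one a multiple \<open>B s\<close> of the function
  of \<open>capacity_function\<close>, and the minimum of both in between. For a suitable choice of \<open>C\<close> and \<open>B\<close>
  each of the two functions is the smaller one near the circle where it takes over.\<close>

lemma competitor_exists:
  obtains W u C where "competitor W u" "\<And>x. x \<in> cdisc (\<rho> / 3) - {pt} \<Longrightarrow> u x \<le> C - ln (cmod (z x))"
proof -
  let ?r1 = "\<rho> / 3" and ?r2 = "2 * \<rho> / 3"
  have r: "0 < ?r1" "?r1 \<le> \<rho>" "0 < ?r2" "?r2 \<le> \<rho>" "?r1 < ?r2" using rho by auto
  obtain W s where W: "open W" "V \<subseteq> W" "W \<subseteq> M" and s: "superharmonic_on s W" "\<And>x. x \<in> W \<Longrightarrow> 0 \<le> s x \<and> s x \<le> 1"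
    "\<And>x. x \<in> cdisc ?r1 \<Longrightarrow> s x = 1" "\<And>x. x \<in> U0 \<Longrightarrow> cmod (z x) = ?r2 \<Longrightarrow> s x < 1"
    by (rule capacity_function) (rule that)
  have kkW: "cdisc ?r2 \<subseteq> W" using cdisc_interior[OF r(4)] interior_subset W(2) by blast
  define C2 where "C2 = {x \<in> U0. cmod (z x) = ?r2}"
  have C2eq: "C2 = cdisc ?r2 - odisc ?r2" by (auto simp: C2_def cdisc_def odisc_def)
  have C2: "compact C2" "C2 \<subseteq> W"
    using compact_diff[OF cdisc_compact[OF r(3,4)] odisc_open] kkW by (auto simp: C2eq)
  have "complex_of_real ?r2 \<in> cball 0 \<rho>" using r by simp
  then obtain y where y: "y \<in> U0" "z y = complex_of_real ?r2" using rho(2) by (metis IntD1 imageE subset_eq)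
  have "cmod (z y) = \<bar>?r2\<bar>" unfolding y(2) by (rule norm_of_real)
  then have "y \<in> C2" using r y(1) by (simp add: C2_def)
  have scont: "isCont s x" if "x \<in> W" for x using superharmonic_on_isCont[OF s(1) W(1) that] .
  obtain x0 where x0: "x0 \<in> C2" "\<And>x. x \<in> C2 \<Longrightarrow> s x \<le> s x0"
    using continuous_attains_sup[OF C2(1), of s] \<open>y \<in> C2\<close> scont C2(2)
    by (metis continuous_at_imp_continuous_on empty_iff subsetD)
  define \<theta> where "\<theta> = s x0"
  have \<theta>: "0 \<le> \<theta>" "\<theta> < 1" using s(2,4) x0(1) C2 by (auto simp: \<theta>_def C2_def)
  \<comment> \<open>\<open>C - ln \<bar>z\<bar>\<close> has to be below \<open>B s\<close> on the inner circle, where \<open>s = 1\<close>, and above it on the outer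
    one, where \<open>s \<le> \<theta>\<close>: this is possible once \<open>B (1 - \<theta>)\<close> exceeds \<open>ln 2\<close>, the logarithm of the ratio of radii\<close>
  define B where "B = ln 2 / (1 - \<theta>) + 1"
  have Bpos: "B > 0" using \<theta> by (auto simp: B_def intro!: add_nonneg_pos divide_nonneg_pos)
  have Beq: "B - B * \<theta> = ln 2 + (1 - \<theta>)"
  proof -
    have "B * (1 - \<theta>) = ln 2 + (1 - \<theta>)" using \<theta> by (simp add: B_def distrib_right)
    then show ?thesis by (simp add: right_diff_distrib)
  qed
  define C where "C = B * \<theta> + ln ?r2 + (1 - \<theta>) / 2"
  have lnr: "ln ?r2 = ln 2 + ln ?r1" using rho by (simp add: ln_mult ln_div)
  have C: "B * \<theta> < C - ln ?r2" "C - ln ?r1 < B" "ln ?r2 < C" "ln ?r1 < C"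
  proof -
    show "B * \<theta> < C - ln ?r2" using \<theta> by (simp add: C_def)
    show "C - ln ?r1 < B" using Beq \<theta> unfolding C_def lnr by (simp add: field_simps)
    have "0 \<le> B * \<theta>" using Bpos \<theta> by simp
    moreover have "0 < (1 - \<theta>) / 2" using \<theta> by simp
    ultimately show 2: "ln ?r2 < C" unfolding C_def by linarith
    have "0 < ln (2::real)" by simp
    then show "ln ?r1 < C" using 2 unfolding lnr by linarith
  qed
  define p where "p x = C - ln (cmod (z x))" for x
  define q where "q x = B * s x" for x
  define u where "u x = (if x \<in> cdisc ?r1 then p x else if x \<in> odisc ?r2 then min (p x) (q x) else q x)" for x
  have ph: "harmonic_at p x" if "x \<in> U0 - {pt}" for x
    unfolding p_def using that U0_sub by (intro harmonic_at_diff harmonic_at_const harm_ln_z) auto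
  have qs: "isCont q x" "superharmonic_at q x" if "x \<in> W" for x
    unfolding q_def using scont[OF that] superharmonic_on_superharmonic_at[OF s(1) that] Bpos
    by (auto intro!: continuous_intros superharmonic_at_cmult)
  have ev: "\<forall>\<^sub>F y in nhds x. y \<in> A" if "open A" "x \<in> A" for A and x :: 'a
    using that eventually_nhds by blast
  have "superharmonic_on u (W - {pt})"
  proof (rule superharmonic_on_glue)
    fix x assume x: "x \<in> W - {pt}"
    consider "x \<in> odisc ?r1" | "x \<in> U0" "cmod (z x) = ?r1" | "x \<in> odisc ?r2" "x \<notin> cdisc ?r1"
      | "x \<in> U0" "cmod (z x) = ?r2" | "x \<notin> cdisc ?r2"
      using r by (force simp: odisc_def cdisc_def)
    then show "\<exists>f. isCont f x \<and> superharmonic_at f x \<and> (\<forall>\<^sub>F y in nhds x. u y = f y)"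
    proof cases
      case 1
      have "harmonic_at p x" using ph 1 x by (simp add: odisc_def)
      moreover have "\<forall>\<^sub>F y in nhds x. u y = p y"
        using ev[OF odisc_open 1] by eventually_elim (simp add: u_def odisc_def cdisc_def)
      ultimately show ?thesis using harmonic_at_isCont harmonic_at_imp_superharmonic_at by blast
    next
      case 2
      have pharm: "harmonic_at p x" using ph 2 x by simp
      have "s x = 1" using s(3) 2 by (simp add: cdisc_def)
      moreover have "p x = C - ln ?r1" unfolding p_def 2(2) ..
      ultimately have "0 < q x - p x" using C(2) by (simp add: q_def)
      moreover have "isCont (\<lambda>x. q x - p x) x"
        using qs x harmonic_at_isCont[OF pharm] by (intro continuous_intros) auto
      ultimately have "\<forall>\<^sub>F y in nhds x. 0 < q y - p y" by (intro eventually_pos_isCont)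
      moreover have "x \<in> odisc ?r2" using 2 r by (simp add: odisc_def)
      note ev[OF odisc_open this]
      ultimately have "\<forall>\<^sub>F y in nhds x. u y = p y"
        by eventually_elim (simp add: u_def)
      then show ?thesis using harmonic_at_isCont[OF pharm] harmonic_at_imp_superharmonic_at[OF pharm] by blast
    next
      case 3
      have pharm: "harmonic_at p x" using ph 3 x by (simp add: odisc_def)
      have "open (odisc ?r2 - cdisc ?r1)" using odisc_open cdisc_closed[OF r(1,2)] by blast
      from ev[OF this] have "\<forall>\<^sub>F y in nhds x. y \<in> odisc ?r2 - cdisc ?r1" using 3 by blast
      then have "\<forall>\<^sub>F y in nhds x. u y = min (p y) (q y)"
        by eventually_elim (simp add: u_def)
      moreover have "isCont (\<lambda>y. min (p y) (q y)) x" "superharmonic_at (\<lambda>y. min (p y) (q y)) x"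
        using qs x harmonic_at_isCont[OF pharm] harmonic_at_imp_superharmonic_at[OF pharm]
        by (auto intro!: continuous_min superharmonic_at_min)
      ultimately show ?thesis by blast
    next
      case 4
      have pharm: "harmonic_at p x" using ph 4 x by simp
      have "s x \<le> \<theta>" using x0(2) 4 by (simp add: C2_def \<theta>_def)
      then have "q x \<le> B * \<theta>" using Bpos by (simp add: q_def)
      moreover have "p x = C - ln ?r2" unfolding p_def 4(2) ..
      ultimately have "0 < p x - q x" using C(1) by linarith
      moreover have "isCont (\<lambda>x. p x - q x) x"
        using qs x harmonic_at_isCont[OF pharm] by (intro continuous_intros) auto
      ultimately have "\<forall>\<^sub>F y in nhds x. 0 < p y - q y" by (intro eventually_pos_isCont)
      moreover have "x \<in> - cdisc ?r1" using 4 r by (simp add: cdisc_def)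
      note ev[OF open_Compl[OF cdisc_closed[OF r(1,2)]] this]
      ultimately have "\<forall>\<^sub>F y in nhds x. u y = q y"
        by eventually_elim (simp add: u_def)
      then show ?thesis using qs[of x] x by blast
    next
      case 5
      then have "x \<in> - cdisc ?r2" by simp
      from ev[OF open_Compl[OF cdisc_closed[OF r(3,4)]] this]
      have "\<forall>\<^sub>F y in nhds x. u y = q y"
        by eventually_elim (use r in \<open>auto simp: u_def cdisc_def odisc_def\<close>)
      then show ?thesis using qs[of x] x by blast
    qed
  qed
  moreover have "pole x \<le> u x" if x: "x \<in> W - {pt}" for x
  proof -
    have q0: "0 \<le> q x" using s(2)[of x] x Bpos by (simp add: q_def)
    have ppos: "0 \<le> p x" if "x \<in> odisc ?r2"
    proof -
      have "cmod (z x) > 0" "cmod (z x) \<le> ?r2" using that x z_zero by (auto simp: odisc_def)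
      then have "ln (cmod (z x)) \<le> ln ?r2" using ln_mono by (smt (verit))
      then show ?thesis using C by (simp add: p_def)
    qed
    show ?thesis
    proof (cases "x \<in> cdisc ?r1")
      case True
      then have "x \<in> U0" "x \<in> odisc ?r2" using r by (auto simp: cdisc_def odisc_def)
      then show ?thesis using True ppos C by (auto simp: u_def p_def intro!: pole_le)
    next
      case False
      then have "pole x = 0" by (intro pole_outside) (auto simp: cdisc_def odisc_def)
      then show ?thesis using False q0 ppos by (simp add: u_def)
    qed
  qed
  ultimately have "competitor W u" using W by (simp add: competitor_def)
  then show thesis by (rule that[of W u C]) (simp add: u_def p_def)
qed

definition competitors :: "('a \<Rightarrow> real) set" where
  "competitors = {u. \<exists>W. competitor W u}"

definition green :: "'a \<Rightarrow> real" where
  "green x = (if x \<in> V then INF u\<in>competitors. u x else 0)"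

lemma competitors_nonempty: "competitors \<noteq> {}"
proof -
  obtain W u where "competitor W u" by (rule competitor_exists) (rule that)
  then show ?thesis by (auto simp: competitors_def)
qed

lemma competitor_ge_pole: "u \<in> competitors \<Longrightarrow> x \<in> V - {pt} \<Longrightarrow> pole x \<le> u x"
  by (auto simp: competitors_def competitor_def)

lemma green_le:
  assumes "u \<in> competitors" "x \<in> V - {pt}" shows "green x \<le> u x"
proof -
  have "bdd_below ((\<lambda>u. u x) ` competitors)"
    using competitor_ge_pole assms(2) by (intro bdd_belowI2[of _ "pole x"]) auto
  then show ?thesis using assms cINF_lower by (fastforce simp: green_def)
qed

lemma green_ge_pole: "x \<in> V - {pt} \<Longrightarrow> pole x \<le> green x"
  using cINF_greatest[OF competitors_nonempty, of "pole x" "\<lambda>u. u x"] competitor_ge_pole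
  by (simp add: green_def)

lemma green_nonneg: "x \<noteq> pt \<Longrightarrow> 0 \<le> green x"
  using green_ge_pole[of x] pole_nonneg[of x] by (cases "x \<in> V") (auto simp: green_def)

lemma competitors_directed:
  assumes "u \<in> competitors" "v \<in> competitors"
  shows "(\<lambda>x. min (u x) (v x)) \<in> competitors"
  using assms competitor_min by (fastforce simp: competitors_def)

lemma green_harm:
  assumes x: "x \<in> interior V - {pt}"
  shows "harmonic_at green x"
proof -
  let ?X = "interior V - {pt}"
  have op: "open ?X" by (simp add: open_delete)
  have XV: "?X \<subseteq> V - {pt}" using interior_subset by blast
  have "harmonic_at (\<lambda>x. INF u\<in>competitors. u x) x"
  proof (rule Perron[OF op _ competitors_nonempty, of 0])
    show "?X \<subseteq> M" using XV V_subset by blast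
    show "0 \<le> u x" if "u \<in> competitors" "x \<in> ?X" for u x
      using competitor_ge_pole[OF that(1), of x] XV that(2) pole_nonneg[of x] by (meson order_trans subsetD)
    show "\<exists>w\<in>competitors. \<forall>x\<in>?X. w x \<le> u x \<and> w x \<le> v x" if "u \<in> competitors" "v \<in> competitors" for u v
      using competitors_directed[OF that] by (rule bexI[rotated]) simp
    show "\<exists>w\<in>competitors. (\<forall>x\<in>?X. w x \<le> u x) \<and> (\<forall>x\<in>D. harmonic_at w x) \<and> continuous_on K w"
      if u: "u \<in> competitors" and R: "regular_disc D K" "K \<subseteq> ?X" for u D K
    proof -
      obtain W where W: "competitor W u" using u by (auto simp: competitors_def)
      then have VW: "V \<subseteq> W" by (simp add: competitor_def)
      have KW: "K \<subseteq> W - {pt}" using R XV VW by blast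
      obtain w where w: "competitor W w" "\<And>x. x \<in> W - {pt} \<Longrightarrow> w x \<le> u x" "\<And>x. x \<in> D \<Longrightarrow> harmonic_at w x"
        by (rule competitor_modification[OF W R(1) KW]) (rule that)
      have "continuous_on K w"
        using w(1) KW by (auto simp: competitor_def superharmonic_on_def intro: continuous_on_subset)
      then show ?thesis using w XV VW by (intro bexI[of _ w]) (auto simp: competitors_def)
    qed
  qed (use x in auto)
  moreover have "\<forall>\<^sub>F y in nhds x. (INF u\<in>competitors. u y) = green y"
  proof -
    have "\<forall>\<^sub>F y in nhds x. y \<in> ?X" using eventually_nhds[of "\<lambda>y. y \<in> ?X" x] op x by blast
    then show ?thesis by eventually_elim (use XV in \<open>auto simp: green_def\<close>)
  qed
  ultimately show ?thesis by (rule harmonic_at_cong[rotated])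
qed

text \<open>Starting from any competitor, the barrier at \<open>p\<close> yields competitors bounded by
  \<open>C * sqrt (\<tau> + \<delta>)\<close> near \<open>p\<close>, for all \<open>\<delta> > 0\<close>; so \<open>green\<close> is at most \<open>C * sqrt \<tau>\<close>.\<close>

lemma green_boundary:
  assumes p: "p \<in> frontier V"
  shows "green p = 0" "isCont green p"
proof -
  have pV: "p \<in> V" "p \<notin> interior V" using p V_closed by (auto simp: frontier_def)
  have N: "open (M - cdisc \<rho>)" "p \<in> M - cdisc \<rho>"
    using open_carrier cdisc_closed[of \<rho>] rho pV cdisc_interior[of \<rho>] V_subset by auto
  obtain \<Delta> \<tau> where \<Delta>: "open \<Delta>" "p \<in> \<Delta>" "\<Delta> \<subseteq> M - cdisc \<rho>" "continuous_on \<Delta> \<tau>" "\<tau> p = 0" "\<And>x. 0 \<le> \<tau> x"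
    and bar: "\<And>Y u. open Y \<Longrightarrow> Y \<subseteq> M \<Longrightarrow> V \<inter> (M - cdisc \<rho>) \<subseteq> Y \<Longrightarrow> superharmonic_on u Y \<Longrightarrow> \<forall>x\<in>Y. 0 \<le> u x \<Longrightarrow>
       \<exists>C\<ge>0. \<forall>\<delta>>0. \<exists>B u'. closed B \<and> B \<subseteq> M - cdisc \<rho> \<and> B \<inter> V = {} \<and> superharmonic_on u' (Y - B) \<and>
         (\<forall>x\<in>Y - B. 0 \<le> u' x \<and> u' x \<le> u x) \<and> (\<forall>x. x \<notin> \<Delta> \<longrightarrow> u' x = u x) \<and>
         (\<forall>x\<in>\<Delta> \<inter> (Y - B). u' x \<le> C * sqrt (\<tau> x + \<delta>))"
    by (rule barrier[OF p N]) (rule that)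
  obtain W u where u: "competitor W u" by (rule competitor_exists) (rule that)
  have ptkk: "pt \<in> cdisc \<rho>" using pt_odisc[OF rho(1)] by (auto simp: odisc_def cdisc_def)
  let ?Y = "W - {pt}"
  have Y: "open ?Y" "?Y \<subseteq> M" "V \<inter> (M - cdisc \<rho>) \<subseteq> ?Y" "superharmonic_on u ?Y" "\<forall>x\<in>?Y. 0 \<le> u x"
  proof -
    show "\<forall>x\<in>?Y. 0 \<le> u x"
      using u pole_nonneg order_trans unfolding competitor_def by blast
  qed (use u ptkk in \<open>auto simp: competitor_def open_delete\<close>)
  obtain C where C: "C \<ge> 0" and bar': "\<forall>\<delta>>0. \<exists>B u'. closed B \<and> B \<subseteq> M - cdisc \<rho> \<and> B \<inter> V = {} \<and> superharmonic_on u' (?Y - B) \<and>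
         (\<forall>x\<in>?Y - B. 0 \<le> u' x \<and> u' x \<le> u x) \<and> (\<forall>x. x \<notin> \<Delta> \<longrightarrow> u' x = u x) \<and>
         (\<forall>x\<in>\<Delta> \<inter> (?Y - B). u' x \<le> C * sqrt (\<tau> x + \<delta>))"
    using bar[OF Y] by (elim exE conjE)
  have ptD: "pt \<notin> \<Delta>" using \<Delta>(3) ptkk by blast
  have bound: "green x \<le> C * sqrt (\<tau> x)" if x: "x \<in> \<Delta>" for x
  proof (cases "x \<in> V")
    case False
    then show ?thesis using C \<Delta>(6) by (simp add: green_def)
  next
    case True
    have "green x \<le> C * sqrt (\<tau> x + \<delta>)" if \<delta>: "\<delta> > 0" for \<delta>
    proof -
      obtain B u' where B: "closed B" "B \<subseteq> M - cdisc \<rho>" "B \<inter> V = {}" and u': "superharmonic_on u' (?Y - B)"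
        "\<forall>x\<in>?Y - B. 0 \<le> u' x \<and> u' x \<le> u x" "\<forall>x. x \<notin> \<Delta> \<longrightarrow> u' x = u x"
        "\<forall>x\<in>\<Delta> \<inter> (?Y - B). u' x \<le> C * sqrt (\<tau> x + \<delta>)"
        using bar'[rule_format, OF \<delta>] by (elim exE conjE)
      have eq: "W - B - {pt} = ?Y - B" by blast
      have "pole y \<le> u' y" if y: "y \<in> W - B - {pt}" for y
      proof (cases "y \<in> \<Delta>")
        case True
        then have "pole y = 0" using \<Delta>(3) rho by (intro pole_outside) (auto simp: cdisc_def odisc_def)
        then show ?thesis using u'(2) y by auto
      next
        case False
        then show ?thesis using u'(3) u y by (simp add: competitor_def)
      qed
      then have "competitor (W - B) u'"
        unfolding competitor_def eq using u B u'(1) by (auto simp: competitor_def)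
      then have "green x \<le> u' x"
        using True x ptD by (intro green_le) (auto simp: competitors_def)
      moreover have "x \<in> \<Delta> \<inter> (?Y - B)" using True x ptD B u by (auto simp: competitor_def)
      then have "u' x \<le> C * sqrt (\<tau> x + \<delta>)" using u'(4) by blast
      ultimately show ?thesis by (rule order_trans)
    qed
    moreover have "((\<lambda>\<delta>. C * sqrt (\<tau> x + \<delta>)) \<longlongrightarrow> C * sqrt (\<tau> x)) (at_right 0)"
      by (auto intro!: tendsto_eq_intros)
    ultimately show ?thesis
      using eventually_at_right_less[of "0::real"]
      by (intro tendsto_lowerbound[where F = "at_right 0"]) (auto elim: eventually_mono)
  qed
  have nonneg: "0 \<le> green x" if "x \<in> \<Delta>" for x using green_nonneg[of x] that ptD by auto
  show g0: "green p = 0" using bound[OF \<Delta>(2)] nonneg[OF \<Delta>(2)] \<Delta>(5) by simp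
  have "isCont \<tau> p" using \<Delta> continuous_on_eq_continuous_at by blast
  then have "isCont (\<lambda>x. C * sqrt (\<tau> x)) p" by (intro continuous_intros)
  then have lim: "(\<lambda>x. C * sqrt (\<tau> x)) \<midarrow>p\<rightarrow> 0" by (simp add: isCont_def \<Delta>(5))
  have "\<forall>\<^sub>F x in at p. x \<in> \<Delta>" using \<Delta> eventually_at_topological by blast
  then have "\<forall>\<^sub>F x in at p. norm (green x) \<le> C * sqrt (\<tau> x)"
    by eventually_elim (use bound nonneg in auto)
  from Lim_null_comparison[OF this lim] show "isCont green p"
    by (simp add: isCont_def g0)
qed

lemma green_bounded_near_pt:
  obtains B where "\<And>x. x \<in> cdisc (\<rho> / 3) - {pt} \<Longrightarrow> \<bar>green x + ln (cmod (z x))\<bar> \<le> B"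
proof -
  obtain W u C where u: "competitor W u" "\<And>x. x \<in> cdisc (\<rho> / 3) - {pt} \<Longrightarrow> u x \<le> C - ln (cmod (z x))"
    by (rule competitor_exists) (rule that)
  have "\<bar>green x + ln (cmod (z x))\<bar> \<le> max \<bar>C\<bar> \<bar>ln (\<rho> / 3)\<bar>" if x: "x \<in> cdisc (\<rho> / 3) - {pt}" for x
  proof -
    have xV: "x \<in> V - {pt}" "x \<in> U0" using x cdisc_interior[of "\<rho> / 3"] rho interior_subset by (auto simp: cdisc_def)
    have "green x \<le> u x" using u xV by (intro green_le) (auto simp: competitors_def)
    then have "green x + ln (cmod (z x)) \<le> C" using u(2)[OF x] by linarith
    moreover have "ln (\<rho> / 3) \<le> green x + ln (cmod (z x))"
      using green_ge_pole[OF xV(1)] pole_ge[OF xV(2)] by linarith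
    ultimately show ?thesis by linarith
  qed
  then show thesis by (rule that)
qed

lemma green_is_green: "is_green_function M atlas V pt (U0, z) green"
  unfolding is_green_function_def prod.case
proof (intro conjI)
  show "continuous_on (M - {pt}) green"
  proof (intro continuous_at_imp_continuous_on ballI)
    fix x assume x: "x \<in> M - {pt}"
    consider "x \<in> interior V" | "x \<in> frontier V" | "x \<notin> V"
      using V_closed by (auto simp: frontier_def)
    then show "isCont green x"
    proof cases
      case 1
      then show ?thesis using x harmonic_at_isCont[OF green_harm] by blast
    next
      case 2
      then show ?thesis by (rule green_boundary)
    next
      case 3
      then have "\<forall>\<^sub>F y in nhds x. y \<in> - V"
        using V_closed eventually_nhds[of "\<lambda>y. y \<in> - V" x] by blast
      then have "\<forall>\<^sub>F y in nhds x. green y = 0" by eventually_elim (simp add: green_def)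
      then show ?thesis using isCont_cong[of green "\<lambda>_. 0" x] by simp
    qed
  qed
  show "\<forall>x\<in>M - interior V. green x = 0"
    using green_boundary(1) V_closed by (auto simp: green_def frontier_def)
  show "harmonic_on_surface atlas green (interior V - {pt})"
    by (rule harmonic_at_imp_harmonic_on_surface[OF green_harm])
  obtain B where "\<And>x. x \<in> cdisc (\<rho> / 3) - {pt} \<Longrightarrow> \<bar>green x + ln (cmod (z x))\<bar> \<le> B"
    by (rule green_bounded_near_pt) (rule that)
  then show "\<exists>B. \<forall>\<^sub>F x in at pt. \<bar>green x + ln (cmod (z x))\<bar> \<le> B"
    using rho by (intro exI[of _ B] eventually_at_pt[of "\<rho> / 3"]) (auto simp: cdisc_def odisc_def)
qed

text \<open>The difference of two Green functions vanishes on the frontier and is bounded near \<open>pt\<close>,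
  so that any positive multiple of a Green function dominates it.\<close>

lemma green_function_le:
  assumes g: "is_green_function M atlas V pt (U0, z) g1" "is_green_function M atlas V pt (U0, z) g2"
    and x: "x \<in> V - {pt}"
  shows "g1 x \<le> g2 x"
proof -
  have op: "open (interior V - {pt})" by (simp add: open_delete)
  have sub: "interior V - {pt} \<subseteq> M" using V_subset interior_subset by blast
  have harm: "harmonic_at g1 y" "harmonic_at g2 y" if "y \<in> interior V - {pt}" for y
    using g harmonic_on_surface_imp_harmonic_at[OF _ op sub that] by (auto simp: is_green_function_def)
  have cont: "continuous_on (V - {pt}) g1" "continuous_on (V - {pt}) g2"
    using g V_subset by (auto simp: is_green_function_def intro: continuous_on_subset)
  have zero: "g1 y = 0" "g2 y = 0" if "y \<in> V - interior V" for y
    using g V_subset that by (auto simp: is_green_function_def)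
  obtain B1 B2 where B: "\<forall>\<^sub>F x in at pt. \<bar>g1 x + ln (cmod (z x))\<bar> \<le> B1"
    "\<forall>\<^sub>F x in at pt. \<bar>g2 x + ln (cmod (z x))\<bar> \<le> B2"
    using g by (auto simp: is_green_function_def)
  have "0 \<le> (g2 x - g1 x) + e * g2 x" if e: "e > 0" for e
  proof (rule min_principle_punctured[OF V_compact V_connected interior_subset open_interior _ _ pt_interior,
        of "\<lambda>x. (g2 x - g1 x) + e * g2 x"])
    show "V - interior V \<noteq> {}" using V_boundary V_closed by (simp add: frontier_def)
    show "interior V \<subseteq> M" using V_subset interior_subset by blast
    show "continuous_on (V - {pt}) (\<lambda>x. (g2 x - g1 x) + e * g2 x)"
      by (intro continuous_intros cont)
    show "superharmonic_at (\<lambda>x. (g2 x - g1 x) + e * g2 x) y" if "y \<in> interior V - {pt}" for y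
      using harm[OF that] by (intro harmonic_at_imp_superharmonic_at harmonic_at_add harmonic_at_diff harmonic_at_cmult)
    show "0 \<le> (g2 y - g1 y) + e * g2 y" if "y \<in> V - interior V" for y
      using zero[OF that] by simp
    have "\<forall>\<^sub>F x in at pt. - B1 - B2 - e * B2 \<le> (g2 x - g1 x) + e * g2 x + e * ln (cmod (z x))"
      using B
    proof eventually_elim
      case (elim y)
      have "e * (- B2) \<le> e * (g2 y + ln (cmod (z y)))" using elim e by (intro mult_left_mono) auto
      then show ?case using elim by (simp add: distrib_left)
    qed
    from log_dominates[OF e this]
    show "\<forall>\<^sub>F x in at pt. 1 \<le> (g2 x - g1 x) + e * g2 x" by simp
  qed (use x in auto)
  then have "0 \<le> g2 x - g1 x" by (rule nonneg_if_perturbed_nonneg)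
  then show ?thesis by simp
qed

text \<open>Uniqueness identifies the Green function chosen in the definition of the capacitary norm with
  the infimum of the competitors.\<close>

lemma green_function_eq:
  assumes "x \<in> V - {pt}"
  shows "green_function M atlas V pt (U0, z) x = green x"
proof -
  have "is_green_function M atlas V pt (U0, z) (green_function M atlas V pt (U0, z))"
    unfolding green_function_def by (rule someI[of _ green]) (rule green_is_green)
  then show ?thesis
    using green_function_le green_is_green assms by (intro antisym) blast+
qed

text \<open>The infimum over the competitors on a fixed neighbourhood is harmonic on all of it, in particular
  across the boundary of \<open>V\<close>.\<close>

lemma neighbourhood_green:
  assumes u: "competitor W u"
  obtains g where "\<And>x. x \<in> W - {pt} \<Longrightarrow> harmonic_at g x" "\<And>x. x \<in> W - {pt} \<Longrightarrow> pole x \<le> g x \<and> g x \<le> u x"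
proof -
  define Q where "Q = {v. competitor W v}"
  have uQ: "u \<in> Q" using u by (simp add: Q_def)
  have ge: "pole x \<le> v x" if "v \<in> Q" "x \<in> W - {pt}" for v x
    using that by (auto simp: Q_def competitor_def)
  define g where "g x = (INF v\<in>Q. v x)" for x
  have X: "open (W - {pt})" "W - {pt} \<subseteq> M" using u by (auto simp: competitor_def open_delete)
  show thesis
  proof (rule that[of g])
    fix x assume x: "x \<in> W - {pt}"
    have "bdd_below ((\<lambda>v. v x) ` Q)" using ge x by (intro bdd_belowI2[of _ "pole x"]) auto
    then have "g x \<le> u x" unfolding g_def using cINF_lower uQ by fast
    moreover have "pole x \<le> g x" unfolding g_def using uQ ge x by (intro cINF_greatest) auto
    ultimately show "pole x \<le> g x \<and> g x \<le> u x" by simp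
    show "harmonic_at g x"
      unfolding g_def
    proof (rule Perron[OF X, of Q 0])
      show "Q \<noteq> {}" using uQ by blast
      show "0 \<le> v x" if "v \<in> Q" "x \<in> W - {pt}" for v x
        using ge[OF that] pole_nonneg[of x] by linarith
      show "\<exists>w\<in>Q. \<forall>x\<in>W - {pt}. w x \<le> v x \<and> w x \<le> v' x" if "v \<in> Q" "v' \<in> Q" for v v'
        using that competitor_min[of W v W v'] by (intro bexI[of _ "\<lambda>x. min (v x) (v' x)"]) (auto simp: Q_def)
      show "\<exists>w\<in>Q. (\<forall>x\<in>W - {pt}. w x \<le> v x) \<and> (\<forall>x\<in>D. harmonic_at w x) \<and> continuous_on K w"
        if v: "v \<in> Q" and R: "regular_disc D K" "K \<subseteq> W - {pt}" for v D K
      proof -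
        have "competitor W v" using v by (simp add: Q_def)
        from competitor_modification[OF this R] obtain w where w: "competitor W w"
          "\<And>x. x \<in> W - {pt} \<Longrightarrow> w x \<le> v x" "\<And>x. x \<in> D \<Longrightarrow> harmonic_at w x" by metis
        have "continuous_on K w"
          using w(1) R by (auto simp: competitor_def superharmonic_on_def intro: continuous_on_subset)
        then show ?thesis using w by (intro bexI[of _ w]) (auto simp: Q_def)
      qed
    qed (rule x)
  qed
qed

text \<open>The limit in the capacitary norm can be approximated from above by functions \<open>g\<close> that are harmonic
  on a whole neighbourhood of \<open>V\<close>, apart from a logarithmic pole at \<open>pt\<close>. This replaces the Green
  function, which is not harmonic across the boundary of \<open>V\<close>, by one that gives rise to holomorphic
  functions up to the boundary.\<close>

proposition green_approximation:
  assumes l: "Lim (at pt) (\<lambda>x. green_function M atlas V pt (U0, z) x + ln (cmod (z x))) < l"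
  obtains W g h s where "open W" "V \<subseteq> W" "W \<subseteq> M" "\<And>x. x \<in> W - {pt} \<Longrightarrow> harmonic_at g x"
    "\<And>x. x \<in> W - {pt} \<Longrightarrow> 0 \<le> g x" "0 < s" "s \<le> \<rho>" "\<And>x. x \<in> odisc s \<Longrightarrow> harmonic_at h x"
    "\<And>x. x \<in> odisc s - {pt} \<Longrightarrow> g x = h x - ln (cmod (z x))" "h pt < l"
proof -
  have r: "0 < \<rho> / 4" "\<rho> / 4 < \<rho> / 3" "\<rho> / 3 \<le> \<rho>" using rho by auto
  have ddV: "odisc (\<rho> / 3) - {pt} \<subseteq> interior V - {pt}" "odisc (\<rho> / 3) \<subseteq> cdisc (\<rho> / 3)"
    using cdisc_interior[OF r(3)] by (auto simp: odisc_def cdisc_def)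
  have ddU: "odisc s \<subseteq> U0" for s by (auto simp: odisc_def)
  obtain B where B: "\<And>x. x \<in> cdisc (\<rho> / 3) - {pt} \<Longrightarrow> \<bar>green x + ln (cmod (z x))\<bar> \<le> B"
    by (rule green_bounded_near_pt) (rule that)
  obtain h where h: "\<And>x. x \<in> odisc (\<rho> / 4) \<Longrightarrow> harmonic_at h x"
    "\<And>x. x \<in> odisc (\<rho> / 4) - {pt} \<Longrightarrow> h x = green x + ln (cmod (z x))"
    and lim: "((\<lambda>x. green x + ln (cmod (z x))) \<longlongrightarrow> h pt) (at pt)"
  proof (rule removable_singularity[OF r, of "\<lambda>x. green x + ln (cmod (z x))" B])
    show "harmonic_at (\<lambda>x. green x + ln (cmod (z x))) x" if "x \<in> odisc (\<rho> / 3) - {pt}" for x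
      using that ddV ddU by (intro harmonic_at_add green_harm harm_ln_z) auto
    show "\<bar>green x + ln (cmod (z x))\<bar> \<le> B" if "x \<in> odisc (\<rho> / 3) - {pt}" for x
      using B that ddV by blast
  qed (rule that)
  have "((\<lambda>x. green_function M atlas V pt (U0, z) x + ln (cmod (z x))) \<longlongrightarrow> h pt) (at pt)"
  proof (rule Lim_transform_eventually[OF lim], rule eventually_at_pt[OF r(1)])
    fix x assume "x \<in> odisc (\<rho> / 4) - {pt}"
    then have "x \<in> V - {pt}" using ddV interior_subset rho by (fastforce simp: odisc_def)
    then show "green x + ln (cmod (z x)) = green_function M atlas V pt (U0, z) x + ln (cmod (z x))"
      by (simp add: green_function_eq)
  qed
  from tendsto_Lim[OF at_pt_nontrivial this] l have "h pt < l" by simp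
  then obtain l' where l': "h pt < l'" "l' < l" using dense by blast
  \<comment> \<open>\<open>h < l'\<close> on a small disc. On its boundary circle finitely many competitors suffice to beat the
    level \<open>l'\<close>, and the maximum principle brings the estimate to \<open>pt\<close>.\<close>
  have "isCont (\<lambda>x. l' - h x) pt"
    using harmonic_at_isCont[OF h(1)[OF pt_odisc[OF r(1)]]] by (intro continuous_intros)
  then have "\<forall>\<^sub>F x in nhds pt. 0 < l' - h x" using l' by (intro eventually_pos_isCont) auto
  then obtain S where S: "open S" "pt \<in> S" "\<And>x. x \<in> S \<Longrightarrow> h x < l'"
    unfolding eventually_nhds by auto
  have "open (z ` (U0 \<inter> S))" by (rule compatible_chart_open_image[OF zchart S(1)])
  moreover have "0 \<in> z ` (U0 \<inter> S)" using pt_U0 S(2) z_pt by (metis IntI imageI)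
  ultimately obtain s' where s': "s' > 0" "cball 0 s' \<subseteq> z ` (U0 \<inter> S)"
    using open_contains_cball by blast
  define s where "s = min s' (\<rho> / 8)"
  have s: "0 < s" "s < \<rho> / 4" "s \<le> \<rho>" "s < \<rho> / 3" "s \<le> s'" using s' rho by (auto simp: s_def)
  have kkS: "x \<in> S" if "x \<in> cdisc s" for x
  proof -
    have "z x \<in> z ` (U0 \<inter> S)" "x \<in> U0" using that s(5) s'(2) by (auto simp: cdisc_def)
    then show ?thesis using compatible_chart_inj[OF zchart] by blast
  qed
  define C2 where "C2 = cdisc s - odisc s"
  have C2: "compact C2" "C2 \<subseteq> V - {pt}" "C2 \<subseteq> odisc (\<rho> / 4) - {pt}" "C2 \<subseteq> S"
  proof -
    show "compact C2" unfolding C2_def by (rule compact_diff[OF cdisc_compact[OF s(1,3)] odisc_open])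
    show "C2 \<subseteq> V - {pt}" using cdisc_interior[OF s(3)] interior_subset pt_odisc[OF s(1)] by (auto simp: C2_def)
    show "C2 \<subseteq> odisc (\<rho> / 4) - {pt}" using s pt_odisc[OF s(1)] by (auto simp: C2_def cdisc_def odisc_def)
    show "C2 \<subseteq> S" using kkS by (auto simp: C2_def)
  qed
  have C2z: "cmod (z x) = s" if "x \<in> C2" for x using that by (auto simp: C2_def cdisc_def odisc_def)
  have "\<exists>u\<in>competitors. \<forall>x\<in>C2. u x < l' - ln s"
  proof (rule directed_compact_less[OF C2(1) competitors_nonempty])
    show "continuous_on C2 u" if u: "u \<in> competitors" for u
    proof -
      obtain W where "competitor W u" using u by (auto simp: competitors_def)
      then have "continuous_on (W - {pt}) u" "V - {pt} \<subseteq> W - {pt}" by (auto simp: competitor_def superharmonic_on_def)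
      then show ?thesis using C2(2) continuous_on_subset by blast
    qed
    show "\<exists>w\<in>competitors. \<forall>x\<in>C2. w x \<le> u x \<and> w x \<le> v x" if "u \<in> competitors" "v \<in> competitors" for u v
      using competitors_directed[OF that] by (rule bexI[rotated]) simp
    show "\<exists>u\<in>competitors. u x < l' - ln s" if x: "x \<in> C2" for x
    proof -
      have "green x < l' - ln s" using h(2)[of x] S(3)[of x] C2 x C2z[OF x] by (auto simp: subset_eq)
      then have "(INF u\<in>competitors. u x) < l' - ln s" using C2(2) x by (auto simp: green_def)
      then show ?thesis
        using cINF_greatest[OF competitors_nonempty, of "l' - ln s" "\<lambda>u. u x"] by (meson not_le)
    qed
  qed
  then obtain u where u: "u \<in> competitors" "\<And>x. x \<in> C2 \<Longrightarrow> u x < l' - ln s" by blast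
  then obtain W1 where W1: "competitor W1 u" by (auto simp: competitors_def)
  obtain W2 u2 C where W2: "competitor W2 u2" "\<And>x. x \<in> cdisc (\<rho> / 3) - {pt} \<Longrightarrow> u2 x \<le> C - ln (cmod (z x))"
    by (rule competitor_exists) (rule that)
  define W where "W = W1 \<inter> W2"
  define v where "v x = min (u x) (u2 x)" for x
  have v: "competitor W v" unfolding W_def v_def by (rule competitor_min[OF W1 W2(1)])
  have vC: "v x \<le> C - ln (cmod (z x))" if "x \<in> cdisc (\<rho> / 3) - {pt}" for x
    using W2(2)[OF that] by (simp add: v_def)
  obtain g where g: "\<And>x. x \<in> W - {pt} \<Longrightarrow> harmonic_at g x" "\<And>x. x \<in> W - {pt} \<Longrightarrow> pole x \<le> g x \<and> g x \<le> v x"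
    by (rule neighbourhood_green[OF v]) (rule that)
  have VW: "V \<subseteq> W" "open W" "W \<subseteq> M" using v by (auto simp: competitor_def)
  have ddW: "odisc (\<rho> / 3) - {pt} \<subseteq> W - {pt}" using ddV VW interior_subset by blast
  have gharm: "harmonic_at (\<lambda>x. g x + ln (cmod (z x))) x" if "x \<in> odisc (\<rho> / 3) - {pt}" for x
    using that ddW ddU by (intro harmonic_at_add g harm_ln_z) auto
  have gB: "\<bar>g x + ln (cmod (z x))\<bar> \<le> max \<bar>C\<bar> \<bar>ln (\<rho> / 3)\<bar>" if x: "x \<in> odisc (\<rho> / 3) - {pt}" for x
  proof -
    have "x \<in> U0" using x ddU by blast
    moreover have "pole x \<le> g x" "g x \<le> v x" using g(2) x ddW by blast+
    moreover have "v x \<le> C - ln (cmod (z x))" using vC x ddV(2) by blast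
    ultimately show ?thesis using pole_ge[of x] by linarith
  qed
  obtain k where k: "\<And>x. x \<in> odisc s \<Longrightarrow> harmonic_at k x" "\<And>x. x \<in> odisc s - {pt} \<Longrightarrow> k x = g x + ln (cmod (z x))"
    "continuous_on (cdisc s) k" "\<And>x. x \<in> cdisc s - odisc s \<Longrightarrow> k x = g x + ln (cmod (z x))"
    by (rule removable_singularity[OF s(1,4) r(3)], rule gharm, assumption, rule gB, assumption) (rule that)
  have RD: "regular_disc (odisc s) (cdisc s)" by (rule regular_disc_cdisc[OF s(1,3)])
  note T = regular_disc_open[OF RD] regular_disc_compact[OF RD] regular_disc_connected(2)[OF RD]
    regular_disc_sub[OF RD] regular_disc_boundary[OF RD]
  have "0 \<le> l' - k pt"
  proof (rule min_principle[OF T(2,3) T(4,1,6), of "\<lambda>x. l' - k x" 0 pt])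
    show "odisc s \<subseteq> M" using T by blast
    show "continuous_on (cdisc s) (\<lambda>x. l' - k x)" by (intro continuous_intros k)
    show "superharmonic_at (\<lambda>x. l' - k x) x" if "x \<in> odisc s" for x
      using that T by (intro harmonic_at_imp_superharmonic_at harmonic_at_diff harmonic_at_const k) auto
    show "0 \<le> l' - k x" if x: "x \<in> cdisc s - odisc s" for x
    proof -
      have xC: "x \<in> C2" using x by (simp add: C2_def)
      have "x \<in> W - {pt}" using C2(2) VW xC by blast
      then have "g x \<le> v x" using g(2) by blast
      then have "g x < l' - ln s" using u(2)[OF xC] by (simp add: v_def)
      then show ?thesis using k(4)[OF x] C2z[OF xC] by simp
    qed
    show "pt \<in> cdisc s" using pt_odisc[OF s(1)] T by blast
  qed
  then have kl: "k pt < l" using l' by simp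
  show thesis
  proof (rule that[OF VW(2,1,3) g(1) _ s(1,3) k(1) _ kl])
    show "0 \<le> g x" if "x \<in> W - {pt}" for x
      using g(2)[OF that] pole_nonneg[of x] by linarith
    show "g x = k x - ln (cmod (z x))" if "x \<in> odisc s - {pt}" for x using k(2)[OF that] by simp
  qed
qed

end

section \<open>Holomorphic functions with prescribed modulus\<close>

text \<open>Where \<open>H\<close> does not vanish, the quotient has constant modulus and so is constant; the
  identity theorem does the rest.\<close>

lemma same_modulus_holomorphic:
  assumes F: "F holomorphic_on ball a r" and H: "H holomorphic_on ball a r"
    and eq: "\<And>w. w \<in> ball a r \<Longrightarrow> cmod (F w) = cmod (H w)"
  shows "\<exists>k. cmod k = 1 \<and> (\<forall>w\<in>ball a r. F w = k * H w)"
proof (cases "\<exists>w\<in>ball a r. H w \<noteq> 0")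
  case False
  then show ?thesis using eq by (intro exI[of _ 1]) auto
next
  case True
  then obtain w where w: "w \<in> ball a r" "H w \<noteq> 0" by blast
  have "open (ball a r \<inter> H -` (- {0}))"
    using H by (intro continuous_open_preimage holomorphic_on_imp_continuous_on) auto
  moreover have "w \<in> ball a r \<inter> H -` (- {0})" using w by simp
  ultimately obtain d where d: "d > 0" "ball w d \<subseteq> ball a r \<inter> H -` (- {0})" by (rule openE)
  have hol: "(\<lambda>w. F w / H w) holomorphic_on ball w d"
    using d by (intro holomorphic_intros holomorphic_on_subset[OF F] holomorphic_on_subset[OF H]) auto
  have one: "cmod (F v / H v) = 1" if "v \<in> ball w d" for v
  proof -
    have "v \<in> ball a r" "H v \<noteq> 0" using d that by auto
    then show ?thesis using eq by (simp add: norm_divide)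
  qed
  have "(\<lambda>w. F w / H w) constant_on ball w d"
    by (rule maximum_modulus_principle[OF hol _ _ _ order_refl, of w]) (use one d in auto)
  then obtain k where k: "\<And>v. v \<in> ball w d \<Longrightarrow> F v / H v = k" unfolding constant_on_def by blast
  have "F v = k * H v" if v: "v \<in> ball a r" for v
  proof (rule analytic_continuation_open[of "ball w d" "ball a r" F "\<lambda>v. k * H v"])
    show "F v = k * H v" if "v \<in> ball w d" for v
    proof -
      have "H v \<noteq> 0" using d that by auto
      then show ?thesis using k[OF that] by (simp add: field_simps)
    qed
    show "(\<lambda>v. k * H v) holomorphic_on ball a r" by (intro holomorphic_intros H)
  qed (use d F v in auto)
  moreover have "cmod k = 1" using one[of w] k[of w] d by simp
  ultimately show ?thesis by blast
qed

text \<open>The function \<open>E\<close> is locally the modulus of a holomorphic function. The local solutions are unique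
  up to constants of modulus 1 and form a local system; on a simply connected set it has a global
  section.\<close>

locale modulus_sheaf = riemann_surface M atlas
  for M :: "'a::t2_space set" and atlas +
  fixes W :: "'a set" and E :: "'a \<Rightarrow> real"
  assumes W_open: "open W" and W_sub: "W \<subseteq> M"
    and local_modulus: "\<And>x. x \<in> W \<Longrightarrow> \<exists>N f. open N \<and> x \<in> N \<and> N \<subseteq> W \<and> hol f N \<and> (\<forall>y\<in>N. cmod (f y) = E y)"
    and nondegenerate: "\<And>x. x \<in> W \<Longrightarrow> \<not> (\<forall>\<^sub>F y in nhds x. E y = 0)"
begin

definition germ_at :: "'a \<Rightarrow> ('a \<Rightarrow> complex) \<Rightarrow> bool" where
  "germ_at x f \<longleftrightarrow> (\<exists>N. open N \<and> x \<in> N \<and> N \<subseteq> W \<and> hol f N \<and> (\<forall>y\<in>N. cmod (f y) = E y))"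

definition same_germ :: "'a \<Rightarrow> ('a \<Rightarrow> complex) \<Rightarrow> ('a \<Rightarrow> complex) \<Rightarrow> bool" where
  "same_germ x f g \<longleftrightarrow> (\<forall>\<^sub>F y in nhds x. f y = g y)"

lemma same_germ_refl: "same_germ x f f"
  and same_germ_sym: "same_germ x f g \<Longrightarrow> same_germ x g f"
  by (simp_all add: same_germ_def eq_commute)

lemma same_germ_trans: "same_germ x f g \<Longrightarrow> same_germ x g h \<Longrightarrow> same_germ x f h"
  unfolding same_germ_def by (auto elim: eventually_elim2)

lemma same_germ_scale: "same_germ x f g \<Longrightarrow> same_germ x (\<lambda>y. k * f y) (\<lambda>y. k * g y)"
  unfolding same_germ_def by (auto elim: eventually_mono)

lemma same_germ_eq: "same_germ x f g \<Longrightarrow> f x = g x"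
  unfolding same_germ_def by (rule eventually_nhds_x_imp_x)

lemma same_germ_nhd:
  assumes "same_germ x f g" obtains N where "open N" "x \<in> N" "\<And>y. y \<in> N \<Longrightarrow> same_germ y f g"
  using assms unfolding same_germ_def eventually_nhds by blast

lemma germ_at_nhd:
  assumes "germ_at x f" obtains N where "open N" "x \<in> N" "N \<subseteq> W" "\<And>y. y \<in> N \<Longrightarrow> germ_at y f"
    "hol f N" "\<And>y. y \<in> N \<Longrightarrow> cmod (f y) = E y"
  using assms unfolding germ_at_def by blast

lemma germ_at_ex: "x \<in> W \<Longrightarrow> \<exists>f. germ_at x f"
  using local_modulus unfolding germ_at_def by blast

lemma germ_at_W: "germ_at x f \<Longrightarrow> x \<in> W"
  unfolding germ_at_def by blast

lemma germ_at_scale: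
  assumes "germ_at x f" "cmod k = 1" shows "germ_at x (\<lambda>y. k * f y)"
proof -
  obtain N where N: "open N" "x \<in> N" "N \<subseteq> W" "hol f N" "\<And>y. y \<in> N \<Longrightarrow> cmod (f y) = E y"
    using assms(1) unfolding germ_at_def by blast
  then show ?thesis
    unfolding germ_at_def
    by (intro exI[of _ N]) (auto simp: norm_mult assms(2) intro!: hol_mult hol_const)
qed

lemma germ_ratio:
  assumes f: "germ_at x f" and g: "germ_at x g"
  obtains k where "cmod k = 1" "same_germ x f (\<lambda>y. k * g y)"
proof -
  obtain N where N: "open N" "x \<in> N" "N \<subseteq> W" "hol f N" "\<And>y. y \<in> N \<Longrightarrow> cmod (f y) = E y"
    using f unfolding germ_at_def by blast
  obtain N' where N': "open N'" "x \<in> N'" "N' \<subseteq> W" "hol g N'" "\<And>y. y \<in> N' \<Longrightarrow> cmod (g y) = E y"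
    using g unfolding germ_at_def by blast
  have xM: "x \<in> M" using N W_sub by blast
  obtain U \<phi> where A: "(U, \<phi>) \<in> atlas" "x \<in> U" using atlas_at xM by blast
  have L: "compatible_chart (U, \<phi>)" using A compatible_chart_atlas by blast
  have op: "open (\<phi> ` (U \<inter> (N \<inter> N')))" by (rule compatible_chart_open_image[OF L open_Int[OF N(1) N'(1)]])
  moreover have "\<phi> x \<in> \<phi> ` (U \<inter> (N \<inter> N'))" using A N N' by blast
  ultimately obtain r where r: "r > 0" "ball (\<phi> x) r \<subseteq> \<phi> ` (U \<inter> (N \<inter> N'))" by (rule openE)
  have NM: "N \<subseteq> M" "N' \<subseteq> M" using N N' W_sub by auto
  have "(f \<circ> inv_into U \<phi>) holomorphic_on ball (\<phi> x) r" "(g \<circ> inv_into U \<phi>) holomorphic_on ball (\<phi> x) r"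
    using r by (auto intro: holomorphic_on_subset[OF hol_compatible_chart[OF L N(1) NM(1) N(4)]]
        holomorphic_on_subset[OF hol_compatible_chart[OF L N'(1) NM(2) N'(4)]])
  moreover have "cmod ((f \<circ> inv_into U \<phi>) w) = cmod ((g \<circ> inv_into U \<phi>) w)" if w: "w \<in> ball (\<phi> x) r" for w
  proof -
    obtain y where y: "y \<in> U" "y \<in> N" "y \<in> N'" "w = \<phi> y" using r(2) w by blast
    then show ?thesis using N(5) N'(5) compatible_chart_inv[OF L] by simp
  qed
  ultimately obtain k where k: "cmod k = 1"
    "\<And>w. w \<in> ball (\<phi> x) r \<Longrightarrow> (f \<circ> inv_into U \<phi>) w = k * (g \<circ> inv_into U \<phi>) w"
    using same_modulus_holomorphic by blast
  have "f y = k * g y" if "y \<in> U \<inter> \<phi> -` ball (\<phi> x) r" for y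
    using k(2)[of "\<phi> y"] that compatible_chart_inv[OF L, of y] by simp
  moreover have "open (U \<inter> \<phi> -` ball (\<phi> x) r)" by (rule compatible_chart_open_vimage[OF L open_ball])
  moreover have "x \<in> U \<inter> \<phi> -` ball (\<phi> x) r" using A r by simp
  ultimately have "same_germ x f (\<lambda>y. k * g y)"
    unfolding same_germ_def eventually_nhds by blast
  with k(1) show thesis by (rule that)
qed

lemma germ_ratio_unique:
  assumes f: "germ_at x f" and eq: "same_germ x (\<lambda>y. k * f y) (\<lambda>y. k' * f y)"
  shows "k = k'"
proof (rule ccontr)
  assume "k \<noteq> k'"
  obtain N where N: "open N" "x \<in> N" "N \<subseteq> W" "\<And>y. y \<in> N \<Longrightarrow> cmod (f y) = E y"
    using f unfolding germ_at_def by blast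
  have "\<forall>\<^sub>F y in nhds x. y \<in> N" using N eventually_nhds by blast
  with eq have "\<forall>\<^sub>F y in nhds x. E y = 0"
    unfolding same_germ_def
  proof eventually_elim
    case (elim y)
    then have "f y = 0" using \<open>k \<noteq> k'\<close> by simp
    then show ?case using N(4)[OF elim(2)] by simp
  qed
  then show False using nondegenerate N by blast
qed

text \<open>A continuous choice of germs of solutions along a map \<open>H\<close> from a parameter space. Germs are
  represented by functions, compared by \<open>same_germ\<close>. Germs rather than values are continued because
  \<open>E\<close> may vanish.\<close>

definition section_along :: "'t::topological_space set \<Rightarrow> ('t \<Rightarrow> 'a) \<Rightarrow> ('t \<Rightarrow> 'a \<Rightarrow> complex) \<Rightarrow> bool" where
  "section_along K H F \<longleftrightarrow> (\<forall>s\<in>K. germ_at (H s) (F s)) \<and>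
     (\<forall>s\<in>K. \<exists>T. open T \<and> s \<in> T \<and> (\<forall>s'\<in>K \<inter> T. same_germ (H s') (F s') (F s)))"

lemma section_germ: "section_along K H F \<Longrightarrow> s \<in> K \<Longrightarrow> germ_at (H s) (F s)"
  by (simp add: section_along_def)

lemma section_local:
  assumes "section_along K H F" "s \<in> K"
  obtains T where "open T" "s \<in> T" "\<And>s'. s' \<in> K \<inter> T \<Longrightarrow> same_germ (H s') (F s') (F s)"
  using assms unfolding section_along_def by blast

lemma section_subset:
  assumes F: "section_along K H F" and K: "K' \<subseteq> K" shows "section_along K' H F"
  unfolding section_along_def
proof (intro conjI ballI)
  fix s assume "s \<in> K'"
  then have s: "s \<in> K" using K by blast
  show "germ_at (H s) (F s)" using section_germ[OF F s] .
  obtain T where "open T" "s \<in> T" "\<And>s'. s' \<in> K \<inter> T \<Longrightarrow> same_germ (H s') (F s') (F s)"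
    using section_local[OF F s] by metis
  then show "\<exists>T. open T \<and> s \<in> T \<and> (\<forall>s'\<in>K' \<inter> T. same_germ (H s') (F s') (F s))"
    using K by (intro exI[of _ T]) blast
qed

lemma section_cong: "(\<And>s. s \<in> K \<Longrightarrow> H s = H' s) \<Longrightarrow> section_along K H F \<Longrightarrow> section_along K H' F"
  unfolding section_along_def by simp

lemma section_const:
  assumes "\<And>s. s \<in> K \<Longrightarrow> germ_at (H s) f" shows "section_along K H (\<lambda>_. f)"
  unfolding section_along_def using assms same_germ_refl by (auto intro: exI[of _ UNIV])

lemma section_scale:
  assumes F: "section_along K H F" and k: "cmod k = 1"
  shows "section_along K H (\<lambda>s y. k * F s y)"
  using F germ_at_scale[OF _ k] same_germ_scale[of _ _ _ k]
  unfolding section_along_def by (intro conjI ballI) (meson IntD1)+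

lemma section_reparametrise:
  assumes F: "section_along K H F" and p: "continuous_on K' p" "p ` K' \<subseteq> K"
  shows "section_along K' (\<lambda>s. H (p s)) (\<lambda>s. F (p s))"
  unfolding section_along_def
proof (intro conjI ballI)
  fix s assume s: "s \<in> K'"
  then have ps: "p s \<in> K" using p by blast
  show "germ_at (H (p s)) (F (p s))" using section_germ[OF F ps] .
  obtain T where T: "open T" "p s \<in> T" "\<And>s'. s' \<in> K \<inter> T \<Longrightarrow> same_germ (H s') (F s') (F (p s))"
    using section_local[OF F ps] by metis
  obtain T' where T': "open T'" "T' \<inter> K' = p -` T \<inter> K'"
    using p(1) T(1) unfolding continuous_on_open_invariant by blast
  show "\<exists>T. open T \<and> s \<in> T \<and> (\<forall>s'\<in>K' \<inter> T. same_germ (H (p s')) (F (p s')) (F (p s)))"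
    using T T' s p(2) by (intro exI[of _ T']) blast
qed

lemma section_ratio:
  assumes K: "connected K" "s0 \<in> K" and H: "continuous_on K H"
    and F: "section_along K H F" and F': "section_along K H F'"
    and k: "same_germ (H s0) (F s0) (\<lambda>y. k * F' s0 y)" and s: "s \<in> K"
  shows "same_germ (H s) (F s) (\<lambda>y. k * F' s y)"
proof -
  define A where "A = {s \<in> K. same_germ (H s) (F s) (\<lambda>y. k * F' s y)}"
  have near: "\<exists>T. open T \<and> s \<in> T \<and> (\<forall>s'\<in>K \<inter> T. same_germ (H s') (F s') (\<lambda>y. c * F' s' y))"
    if s: "s \<in> K" and c: "same_germ (H s) (F s) (\<lambda>y. c * F' s y)" for s c
  proof -
    obtain T1 where T1: "open T1" "s \<in> T1" "\<And>s'. s' \<in> K \<inter> T1 \<Longrightarrow> same_germ (H s') (F s') (F s)"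
      using section_local[OF F s] by metis
    obtain T2 where T2: "open T2" "s \<in> T2" "\<And>s'. s' \<in> K \<inter> T2 \<Longrightarrow> same_germ (H s') (F' s') (F' s)"
      using section_local[OF F' s] by metis
    obtain N where N: "open N" "H s \<in> N" "\<And>y. y \<in> N \<Longrightarrow> same_germ y (F s) (\<lambda>y. c * F' s y)"
      using same_germ_nhd[OF c] by metis
    obtain T3 where T3: "open T3" "T3 \<inter> K = H -` N \<inter> K"
      using H N(1) unfolding continuous_on_open_invariant by blast
    have "same_germ (H s') (F s') (\<lambda>y. c * F' s' y)" if "s' \<in> K \<inter> (T1 \<inter> T2 \<inter> T3)" for s'
    proof -
      have "H s' \<in> N" using that T3 by blast
      then have "same_germ (H s') (F s') (\<lambda>y. c * F' s y)"
        using same_germ_trans[OF T1(3) N(3)] that by blast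
      moreover have "same_germ (H s') (\<lambda>y. c * F' s y) (\<lambda>y. c * F' s' y)"
        using same_germ_scale[OF same_germ_sym[OF T2(3)]] that by blast
      ultimately show ?thesis by (rule same_germ_trans)
    qed
    moreover have "s \<in> T1 \<inter> T2 \<inter> T3" using T1 T2 T3 N s by blast
    moreover have "open (T1 \<inter> T2 \<inter> T3)" using T1 T2 T3 by blast
    ultimately show ?thesis by blast
  qed
  have "openin (top_of_set K) A"
  proof (subst openin_subopen, safe)
    fix s assume "s \<in> A"
    then obtain T where T: "open T" "s \<in> T" "\<forall>s'\<in>K \<inter> T. same_germ (H s') (F s') (\<lambda>y. k * F' s' y)" "s \<in> K"
      using near[of s k] by (auto simp: A_def)
    then show "\<exists>T. openin (top_of_set K) T \<and> s \<in> T \<and> T \<subseteq> A"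
      by (intro exI[of _ "K \<inter> T"]) (auto simp: A_def openin_open_Int)
  qed
  moreover have "openin (top_of_set K) (K - A)"
  proof (subst openin_subopen, safe)
    fix s assume s: "s \<in> K" "s \<notin> A"
    obtain c where c: "same_germ (H s) (F s) (\<lambda>y. c * F' s y)"
      using germ_ratio[OF section_germ[OF F s(1)] section_germ[OF F' s(1)]] by metis
    then have ck: "c \<noteq> k" using s by (auto simp: A_def)
    obtain T where T: "open T" "s \<in> T" "\<forall>s'\<in>K \<inter> T. same_germ (H s') (F s') (\<lambda>y. c * F' s' y)"
      using near[OF s(1) c] by blast
    have "s' \<notin> A" if s': "s' \<in> K \<inter> T" for s'
    proof
      assume "s' \<in> A"
      then have "same_germ (H s') (F s') (\<lambda>y. k * F' s' y)" by (simp add: A_def)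
      with T(3) s' have "same_germ (H s') (\<lambda>y. c * F' s' y) (\<lambda>y. k * F' s' y)"
        using same_germ_trans same_germ_sym by blast
      then show False using germ_ratio_unique section_germ[OF F'] s' ck by blast
    qed
    then show "\<exists>T. openin (top_of_set K) T \<and> s \<in> T \<and> T \<subseteq> K - A"
      using T s by (intro exI[of _ "K \<inter> T"]) (auto simp: openin_open_Int)
  qed
  then have "closedin (top_of_set K) A" by (simp add: closedin_def A_def) 
  moreover have "s0 \<in> A" using K k by (simp add: A_def)
  ultimately have "A = K" using K(1) unfolding connected_clopen by blast
  then show ?thesis using s by (auto simp: A_def)
qed

lemma section_unique:
  assumes K: "connected K" "s0 \<in> K" and H: "continuous_on K H"
    and F: "section_along K H F" and F': "section_along K H F'"
    and k: "same_germ (H s0) (F s0) (F' s0)" and s: "s \<in> K"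
  shows "same_germ (H s) (F s) (F' s)"
  using section_ratio[OF K H F F', of 1] k s by simp

lemma section_union:
  assumes K: "closed K1" "closed K2" and F: "section_along K1 H F1" "section_along K2 H F2"
    and eq: "\<And>s. s \<in> K1 \<inter> K2 \<Longrightarrow> same_germ (H s) (F1 s) (F2 s)" and H: "continuous_on (K1 \<union> K2) H"
  shows "section_along (K1 \<union> K2) H (\<lambda>s. if s \<in> K1 then F1 s else F2 s)"
proof -
  let ?F = "\<lambda>s. if s \<in> K1 then F1 s else F2 s"
  have F2: "same_germ (H s) (?F s) (F2 s)" if "s \<in> K2" for s
    using eq[of s] that same_germ_refl by auto
  show ?thesis
    unfolding section_along_def
  proof (intro conjI ballI)
    fix s assume s: "s \<in> K1 \<union> K2"
    show "germ_at (H s) (?F s)" using section_germ[OF F(1)] section_germ[OF F(2)] s by auto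
    \<comment> \<open>near \<open>s\<close>, the section over \<open>Ki\<close> agrees with \<open>?F s\<close>; vacuously so if \<open>s\<close> is not in \<open>Ki\<close>\<close>
    have one: "\<exists>T. open T \<and> s \<in> T \<and> (\<forall>s'\<in>K1 \<inter> T. same_germ (H s') (?F s') (?F s))"
    proof (cases "s \<in> K1")
      case True
      then show ?thesis using section_local[OF F(1) True] by (metis IntD1)
    next
      case False
      then show ?thesis using K(1) by (intro exI[of _ "- K1"]) auto
    qed
    have two: "\<exists>T. open T \<and> s \<in> T \<and> (\<forall>s'\<in>K2 \<inter> T. same_germ (H s') (?F s') (?F s))"
    proof (cases "s \<in> K2")
      case True
      obtain T where T: "open T" "s \<in> T" "\<And>s'. s' \<in> K2 \<inter> T \<Longrightarrow> same_germ (H s') (F2 s') (F2 s)"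
        using section_local[OF F(2) True] by metis
      obtain N where N: "open N" "H s \<in> N" "\<And>y. y \<in> N \<Longrightarrow> same_germ y (F2 s) (?F s)"
        using same_germ_nhd[OF same_germ_sym[OF F2[OF True]]] by metis
      obtain T' where T': "open T'" "T' \<inter> (K1 \<union> K2) = H -` N \<inter> (K1 \<union> K2)"
        using H N(1) unfolding continuous_on_open_invariant by blast
      have "same_germ (H s') (?F s') (?F s)" if s': "s' \<in> K2 \<inter> (T \<inter> T')" for s'
      proof -
        have "H s' \<in> N" using s' T' by blast
        have "same_germ (H s') (?F s') (F2 s)"
          using same_germ_trans[OF F2 T(3)] s' by blast
        then show ?thesis using same_germ_trans N(3)[OF \<open>H s' \<in> N\<close>] by blast
      qed
      moreover have "s \<in> T \<inter> T'" using T T' N s by blast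
      moreover have "open (T \<inter> T')" using T T' by blast
      ultimately show ?thesis by blast
    next
      case False
      then show ?thesis using K(2) by (intro exI[of _ "- K2"]) auto
    qed
    from one two obtain T1 T2 where "open T1" "s \<in> T1" "\<forall>s'\<in>K1 \<inter> T1. same_germ (H s') (?F s') (?F s)"
      "open T2" "s \<in> T2" "\<forall>s'\<in>K2 \<inter> T2. same_germ (H s') (?F s') (?F s)" by metis
    then show "\<exists>T. open T \<and> s \<in> T \<and> (\<forall>s'\<in>(K1 \<union> K2) \<inter> T. same_germ (H s') (?F s') (?F s))"
      by (intro exI[of _ "T1 \<inter> T2"]) blast
  qed
qed

lemma section_glue:
  assumes K: "closed K1" "closed K2" "connected (K1 \<inter> K2)"
    and F: "section_along K1 H F1" "section_along K2 H F2" and H: "continuous_on (K1 \<union> K2) H"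
  shows "\<exists>F. section_along (K1 \<union> K2) H F"
proof (cases "K1 \<inter> K2 = {}")
  case True
  then show ?thesis using section_union[OF K(1,2) F _ H] by blast
next
  case False
  then obtain s0 where s0: "s0 \<in> K1 \<inter> K2" by blast
  obtain k where k: "cmod k = 1" "same_germ (H s0) (F1 s0) (\<lambda>y. k * F2 s0 y)"
    using germ_ratio[OF section_germ[OF F(1)] section_germ[OF F(2)]] s0 by (metis IntD1 IntD2)
  have "same_germ (H s) (F1 s) (\<lambda>y. k * F2 s y)" if "s \<in> K1 \<inter> K2" for s
    by (rule section_ratio[of "K1 \<inter> K2" s0 H F1 F2 k])
       (use K(3) s0 k(2) that F H in \<open>auto intro: section_subset continuous_on_subset\<close>)
  then show ?thesis using section_union[OF K(1,2) F(1) section_scale[OF F(2) k(1)] _ H] by blast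
qed

text \<open>Sections exist over small rectangles, and can be glued along a common edge after multiplication
  by a constant, since an edge is connected. Bisection in the second parameter gives sections over
  thin strips, bisection in the first one then gives the square.\<close>

lemma section_on_square:
  assumes H: "continuous_on ({0..1::real} \<times> {0..1::real}) H" and HW: "H ` ({0..1} \<times> {0..1}) \<subseteq> W"
  shows "\<exists>F. section_along ({0..1} \<times> {0..1}) H F"
proof -
  let ?Q = "{0..1::real} \<times> {0..1::real}"
  have rect: "connected (?Q \<inter> ({a..b} \<times> {c..d}))" "closed (?Q \<inter> ({a..b} \<times> {c..d}))" for a b c d :: real
    by (auto intro!: convex_connected convex_Int convex_Times closed_Int closed_Times)
  have sub: "continuous_on K H" if "K \<subseteq> ?Q" for K using H that continuous_on_subset by blast
  have strip: "\<exists>d>0. \<exists>F. section_along (?Q \<inter> ({s - d..s + d} \<times> {0..1})) H F" if s: "s \<in> {0..1}" for s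
  proof (rule Bolzano[of 0 1 "\<lambda>a b. \<exists>d>0. \<exists>F. section_along (?Q \<inter> ({s - d..s + d} \<times> {a..b})) H F"])
    fix a b c :: real assume le: "a \<le> b" "b \<le> c"
    assume "\<exists>d>0. \<exists>F. section_along (?Q \<inter> ({s - d..s + d} \<times> {a..b})) H F"
      "\<exists>d>0. \<exists>F. section_along (?Q \<inter> ({s - d..s + d} \<times> {b..c})) H F"
    then obtain d1 F1 d2 F2 where d: "d1 > 0" "d2 > 0" and
      F: "section_along (?Q \<inter> ({s - d1..s + d1} \<times> {a..b})) H F1"
         "section_along (?Q \<inter> ({s - d2..s + d2} \<times> {b..c})) H F2" by blast
    define d where "d = min d1 d2"
    let ?K1 = "?Q \<inter> ({s - d..s + d} \<times> {a..b})" and ?K2 = "?Q \<inter> ({s - d..s + d} \<times> {b..c})"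
    have F': "section_along ?K1 H F1" "section_along ?K2 H F2"
      by (rule section_subset[OF F(1)], force simp: d_def) (rule section_subset[OF F(2)], force simp: d_def)
    have int: "?K1 \<inter> ?K2 = ?Q \<inter> ({s - d..s + d} \<times> {b..b})" using le by auto
    have un: "?K1 \<union> ?K2 = ?Q \<inter> ({s - d..s + d} \<times> {a..c})" using le by auto
    have "\<exists>F. section_along (?K1 \<union> ?K2) H F"
      by (rule section_glue[OF rect(2) rect(2) _ F']) (unfold int, rule rect, rule sub, blast)
    then show "\<exists>d>0. \<exists>F. section_along (?Q \<inter> ({s - d..s + d} \<times> {a..c})) H F"
      unfolding un using d by (intro exI[of _ d]) (auto simp: d_def)
  next
    fix t :: real assume t: "0 \<le> t" "t \<le> 1"
    then have "H (s, t) \<in> W" using HW s by auto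
    then obtain f where "germ_at (H (s, t)) f" using germ_at_ex by blast
    then obtain N where N: "open N" "H (s, t) \<in> N" "\<And>y. y \<in> N \<Longrightarrow> germ_at y f"
      using germ_at_nhd by metis
    obtain T where T: "open T" "T \<inter> ?Q = H -` N \<inter> ?Q"
      using H N(1) unfolding continuous_on_open_invariant by blast
    have "(s, t) \<in> T" using T N s t by auto
    then obtain e where e: "e > 0" "ball (s, t) e \<subseteq> T" using T(1) openE by blast
    have "section_along (?Q \<inter> ({s - e / 3..s + e / 3} \<times> {a..b})) H (\<lambda>_. f)"
      if "a \<le> t" "t \<le> b" "b - a < e / 3" for a b
    proof (rule section_const)
      fix x assume x: "x \<in> ?Q \<inter> ({s - e / 3..s + e / 3} \<times> {a..b})"
      obtain s' t' where x': "x = (s', t')" by (cases x)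
      have "dist (s, t) (s', t') \<le> \<bar>s - s'\<bar> + \<bar>t - t'\<bar>"
        unfolding dist_Pair_Pair dist_real_def by (rule sqrt_sum_squares_le_sum_abs[THEN order_trans]) simp
      also have "\<dots> < e" using x x' that e by auto
      finally have "x \<in> T" using e x' by auto
      then have "H x \<in> N" using T x by blast
      then show "germ_at (H x) f" by (rule N)
    qed
    then show "\<exists>d>0. \<forall>a b. a \<le> t \<and> t \<le> b \<and> b - a < d \<longrightarrow>
       (\<exists>d>0. \<exists>F. section_along (?Q \<inter> ({s - d..s + d} \<times> {a..b})) H F)"
      using e by (intro exI[of _ "e / 3"] conjI allI impI) auto
  qed simp
  have "\<exists>F. section_along (?Q \<inter> ({0..1} \<times> {0..1})) H F"
  proof (rule Bolzano[of 0 1 "\<lambda>a b. \<exists>F. section_along (?Q \<inter> ({a..b} \<times> {0..1})) H F"])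
    fix a b c :: real assume le: "a \<le> b" "b \<le> c"
    let ?K1 = "?Q \<inter> ({a..b} \<times> {0..1})" and ?K2 = "?Q \<inter> ({b..c} \<times> {0..1})"
    assume "\<exists>F. section_along ?K1 H F" "\<exists>F. section_along ?K2 H F"
    then obtain F1 F2 where F: "section_along ?K1 H F1" "section_along ?K2 H F2" by blast
    have int: "?K1 \<inter> ?K2 = ?Q \<inter> ({b..b} \<times> {0..1})" using le by auto
    have un: "?K1 \<union> ?K2 = ?Q \<inter> ({a..c} \<times> {0..1})" using le by auto
    have "\<exists>F. section_along (?K1 \<union> ?K2) H F"
      by (rule section_glue[OF rect(2) rect(2) _ F]) (unfold int, rule rect, rule sub, blast)
    then show "\<exists>F. section_along (?Q \<inter> ({a..c} \<times> {0..1})) H F" unfolding un .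
  next
    fix s :: real assume "0 \<le> s" "s \<le> 1"
    then obtain d F where d: "d > 0" "section_along (?Q \<inter> ({s - d..s + d} \<times> {0..1})) H F"
      using strip[of s] by auto
    have "section_along (?Q \<inter> ({a..b} \<times> {0..1})) H F" if "a \<le> s" "s \<le> b" "b - a < d" for a b
      by (rule section_subset[OF d(2)]) (use that in auto)
    then show "\<exists>d>0. \<forall>a b. a \<le> s \<and> s \<le> b \<and> b - a < d \<longrightarrow> (\<exists>F. section_along (?Q \<inter> ({a..b} \<times> {0..1})) H F)"
      using d by blast
  qed simp
  then show ?thesis by simp
qed

lemma section_on_path:
  assumes p: "path p" "path_image p \<subseteq> W" and f: "germ_at (p 0) f"
  obtains F where "section_along {0..1} p F" "same_germ (p 0) (F 0) f"
proof -
  have cp: "continuous_on {0..1} p" using p by (simp add: path_def)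
  have "continuous_on ({0..1::real} \<times> {0..1::real}) (\<lambda>x. p (snd x))"
    by (rule continuous_on_compose2[OF cp]) (auto intro!: continuous_intros)
  moreover have "(\<lambda>x. p (snd x)) ` ({0..1::real} \<times> {0..1::real}) \<subseteq> W"
    using p(2) by (auto simp: path_image_def)
  ultimately obtain F where F: "section_along ({0..1::real} \<times> {0..1::real}) (\<lambda>x. p (snd x)) F"
    using section_on_square by blast
  define G where "G t = F (0::real, t)" for t :: real
  have "section_along {0..1} (\<lambda>t. p (snd (0::real, t))) (\<lambda>t. F (0, t))"
    by (rule section_reparametrise[OF F]) (auto intro!: continuous_intros)
  then have G: "section_along {0..1} p G" by (simp add: G_def[abs_def])
  then have "germ_at (p 0) (G 0)" by (rule section_germ) simp
  from germ_ratio[OF f this] obtain k where k: "cmod k = 1" "same_germ (p 0) f (\<lambda>y. k * G 0 y)" by metis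
  show thesis
    by (rule that[OF section_scale[OF G k(1)] same_germ_sym[OF k(2)]])
qed

text \<open>Continue over the square that parametrises a homotopy of \<open>l\<close> to a constant loop. The sections along
  the two edges traced by the base points differ by a constant, which is 1 at the constant loop.\<close>

lemma loop_monodromy_trivial:
  assumes hom: "homotopic_loops V l (\<lambda>_. a)" and V: "V \<subseteq> W" and f: "germ_at (l 0) f"
  obtains S where "section_along {0..1} l S" "same_germ (l 0) (S 0) f" "same_germ (l 0) (S 1) f"
proof -
  obtain h where h: "continuous_on ({0..1::real} \<times> {0..1}) h" "h \<in> ({0..1} \<times> {0..1}) \<rightarrow> V"
    "\<And>x. x \<in> {0..1} \<Longrightarrow> h (0, x) = l x" "\<And>x. x \<in> {0..1} \<Longrightarrow> h (1, x) = a"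
    "\<And>t. t \<in> {0..1} \<Longrightarrow> h (t, 0) = h (t, 1)"
    using hom unfolding homotopic_loops by (auto simp: pathfinish_def pathstart_def)
  have "h ` ({0..1} \<times> {0..1}) \<subseteq> W" using h(2) V by (auto simp: Pi_iff)
  then obtain F where F: "section_along ({0..1::real} \<times> {0..1::real}) h F"
    using section_on_square[OF h(1)] by blast
  have edge: "section_along {0..1} (\<lambda>t. h (p t)) (\<lambda>t. F (p t))" "continuous_on {0..1} (\<lambda>t. h (p t))"
    if "continuous_on {0..1} p" "p ` {0..1} \<subseteq> {0..1} \<times> {0..1}" for p :: "real \<Rightarrow> real \<times> real"
    using section_reparametrise[OF F that] continuous_on_compose2[OF h(1) that(1)] that(2) by auto
  have I: "connected {0..1::real}" "0 \<in> {0..1::real}" "1 \<in> {0..1::real}" by auto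
  \<comment> \<open>the bottom and top edges run over the same path, the base points of the loops\<close>
  have e0: "section_along {0..1} (\<lambda>t. h (t, 0)) (\<lambda>t. F (t, 0))" "continuous_on {0..1} (\<lambda>t. h (t, 0))"
    by (rule edge[of "\<lambda>t. (t, 0)"]; force intro!: continuous_intros)+
  have "section_along {0..1} (\<lambda>t. h (t, 1)) (\<lambda>t. F (t, 1))"
    by (rule edge[of "\<lambda>t. (t, 1)"]; force intro!: continuous_intros)
  then have e1: "section_along {0..1} (\<lambda>t. h (t, 0)) (\<lambda>t. F (t, 1))"
    by (rule section_cong[rotated]) (simp add: h(5))
  \<comment> \<open>over the constant loop nothing changes\<close>
  have "section_along {0..1} (\<lambda>x. h (1, x)) (\<lambda>x. F (1, x))"
    by (rule edge[of "\<lambda>t. (1, t)"]; force intro!: continuous_intros)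
  then have s1: "section_along {0..1} (\<lambda>x. a) (\<lambda>x. F (1, x))"
    by (rule section_cong[rotated]) (simp add: h(4))
  have s1': "section_along {0..1} (\<lambda>x::real. a) (\<lambda>x. F (1, 0))"
    by (rule section_const) (use section_germ[OF s1 I(2)] in simp)
  have end1: "same_germ a (F (1, 1)) (F (1, 0))"
    by (rule section_unique[OF I(1,2) continuous_on_const s1 s1' same_germ_refl I(3)])
  have "same_germ (h (0, 0)) (F (0, 1)) (F (0, 0))"
    by (rule section_unique[OF I(1,3) e0(2) e1 e0(1) _ I(2)]) (use end1 h(4) in auto)
  then have end0: "same_germ (l 0) (F (0, 1)) (F (0, 0))" by (simp add: h(3))
  have "section_along {0..1} (\<lambda>x. h (0, x)) (\<lambda>x. F (0, x))"
    by (rule edge[of "\<lambda>t. (0, t)"]; force intro!: continuous_intros)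
  then have s0: "section_along {0..1} l (\<lambda>x. F (0, x))"
    by (rule section_cong[rotated]) (simp add: h(3))
  obtain k where k: "cmod k = 1" "same_germ (l 0) f (\<lambda>y. k * F (0, 0) y)"
    using germ_ratio[OF f section_germ[OF s0 I(2)]] by metis
  show thesis
    by (rule that[OF section_scale[OF s0 k(1)] same_germ_sym[OF k(2)]])
       (rule same_germ_trans[OF same_germ_scale[OF end0] same_germ_sym[OF k(2)]])
qed

text \<open>The loop that runs along \<open>p\<close> and back along \<open>q\<close> has trivial monodromy, and a section along it
  restricts to sections along \<open>p\<close> and \<open>q\<close> that meet in the middle of the loop.\<close>

lemma path_sections_agree:
  assumes sc: "simply_connected V" and V: "V \<subseteq> W"
    and p: "path p" "path_image p \<subseteq> V" and q: "path q" "path_image q \<subseteq> V"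
    and ends: "p 0 = q 0" "p 1 = q 1"
    and F: "section_along {0..1} p F" and G: "section_along {0..1} q G"
    and start: "same_germ (p 0) (F 0) (G 0)"
  shows "same_germ (p 1) (F 1) (G 1)"
proof -
  define l where "l = p +++ reversepath q"
  have l01: "l 0 = p 0" "l 1 = p 0" using ends by (simp_all add: l_def joinpaths_def reversepath_def)
  have path_l: "path l" unfolding l_def
    by (rule path_join_imp) (use p q ends in \<open>auto simp: pathfinish_def\<close>)
  have im_l: "path_image l \<subseteq> V" unfolding l_def
    by (rule subset_path_image_join) (use p q in \<open>auto simp: path_image_reversepath\<close>)
  have "p 0 \<in> V" using p(2) by (auto simp: path_image_def)
  then have "homotopic_loops V l (\<lambda>_. p 0)"
    using path_l im_l l01
    by (intro sc[unfolded simply_connected_def, THEN spec, THEN spec, THEN mp])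
       (auto simp: path_def path_image_def pathstart_def pathfinish_def)
  moreover have "germ_at (l 0) (F 0)" using section_germ[OF F, of 0] l01 by simp
  ultimately obtain S where S: "section_along {0..1} l S" "same_germ (l 0) (S 0) (F 0)" "same_germ (l 0) (S 1) (F 0)"
    using loop_monodromy_trivial[OF _ V] by metis
  have I: "connected {0..1::real}" "0 \<in> {0..1::real}" "1 \<in> {0..1::real}" by auto
  have "section_along {0..1} (\<lambda>t. l (t / 2)) (\<lambda>t. S (t / 2))"
    by (rule section_reparametrise[OF S(1)]) (auto intro!: continuous_intros)
  then have 1: "section_along {0..1} p (\<lambda>t. S (t / 2))"
    by (rule section_cong[rotated]) (simp add: l_def joinpaths_def)
  have "section_along {0..1} (\<lambda>t. l (1 - t / 2)) (\<lambda>t. S (1 - t / 2))"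
    by (rule section_reparametrise[OF S(1)]) (auto intro!: continuous_intros)
  then have 2: "section_along {0..1} q (\<lambda>t. S (1 - t / 2))"
    by (rule section_cong[rotated]) (use ends in \<open>auto simp: l_def joinpaths_def reversepath_def\<close>)
  have "same_germ (p 1) (F 1) (S (1 / 2))"
    by (rule section_unique[OF I(1,2) _ F 1 _ I(3), simplified])
       (use p S(2) l01 same_germ_sym in \<open>auto simp: path_def\<close>)
  moreover have "same_germ (q 1) (G 1) (S (1 / 2))"
  proof (rule section_unique[OF I(1,2) _ G 2 _ I(3), simplified])
    show "continuous_on {0..1} q" using q by (simp add: path_def)
    show "same_germ (q 0) (G 0) (S 1)"
      using same_germ_trans[OF same_germ_sym[OF start]] same_germ_sym[OF S(3)] l01 ends by simp
  qed
  ultimately show ?thesis using ends same_germ_trans same_germ_sym by metis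
qed

text \<open>\<open>R x\<close> is the result of continuing a fixed germ at \<open>a\<close> along any path in \<open>V\<close> from \<open>a\<close> to \<open>x\<close>.
  The result for a nearby point \<open>y\<close> is compared by appending a short path from \<open>x\<close> to \<open>y\<close>.\<close>

lemma locally_constant_germs:
  assumes sc: "simply_connected V" and V: "V \<subseteq> W" "a \<in> V"
    and lpc: "\<And>x N. x \<in> V \<Longrightarrow> open N \<Longrightarrow> x \<in> N \<Longrightarrow> \<exists>B. open B \<and> x \<in> B \<and>
       (\<forall>y\<in>B \<inter> V. \<exists>p. path p \<and> p 0 = x \<and> p 1 = y \<and> path_image p \<subseteq> N \<inter> V)"
  obtains R where "\<And>x. x \<in> V \<Longrightarrow> germ_at x (R x)"
    "\<And>x. x \<in> V \<Longrightarrow> \<exists>B. open B \<and> x \<in> B \<and> (\<forall>y\<in>B \<inter> V. same_germ y (R y) (R x))"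
proof -
  obtain f where f: "germ_at a f" using germ_at_ex V by blast
  have ex: "\<exists>p F. path p \<and> path_image p \<subseteq> V \<and> p 0 = a \<and> p 1 = x \<and> section_along {0..1} p F \<and> same_germ a (F 0) f"
    if x: "x \<in> V" for x
  proof -
    have "homotopic_loops V (\<lambda>_. a) (\<lambda>_. x)"
      using sc V(2) x unfolding simply_connected_def
      by (auto simp: path_def path_image_def pathstart_def pathfinish_def intro!: continuous_intros)
    then obtain h where h: "continuous_on ({0..1::real} \<times> {0..1::real}) h" "h \<in> ({0..1} \<times> {0..1}) \<rightarrow> V"
      "h (0, 0) = a" "h (1, 0) = x"
      unfolding homotopic_loops by fastforce
    define p where "p t = h (t, 0)" for t
    have p: "path p" "path_image p \<subseteq> V" "p 0 = a" "p 1 = x"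
      using h unfolding p_def path_def path_image_def
      by (auto intro!: continuous_on_compose2[OF h(1)] continuous_intros simp: Pi_iff)
    have "path_image p \<subseteq> W" using p(2) V(1) by blast
    then obtain F where "section_along {0..1} p F" "same_germ (p 0) (F 0) f"
      using section_on_path[OF p(1)] f p(3) by metis
    then show ?thesis using p by (intro exI[of _ p] exI[of _ F]) simp
  qed
  define C where "C x g \<longleftrightarrow> (\<exists>p F. path p \<and> path_image p \<subseteq> V \<and> p 0 = a \<and> p 1 = x \<and>
    section_along {0..1} p F \<and> same_germ a (F 0) f \<and> g = F 1)" for x g
  define R where "R x = (SOME g. C x g)" for x
  have R: "C x (R x)" if "x \<in> V" for x
  proof -
    from ex[OF that] obtain g where "C x g" unfolding C_def by blast
    then show ?thesis unfolding R_def by (rule someI[of "C x"])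
  qed
  have unique: "same_germ x g g'" if c: "C x g" "C x g'" for x g g'
  proof -
    obtain p F where p: "path p" "path_image p \<subseteq> V" "p 0 = a" "p 1 = x" and F: "section_along {0..1} p F"
      "same_germ a (F 0) f" "g = F 1" using c(1) unfolding C_def by (elim exE conjE)
    obtain q G where q: "path q" "path_image q \<subseteq> V" "q 0 = a" "q 1 = x" and G: "section_along {0..1} q G"
      "same_germ a (G 0) f" "g' = G 1" using c(2) unfolding C_def by (elim exE conjE)
    have start: "same_germ (p 0) (F 0) (G 0)"
      unfolding p(3) by (rule same_germ_trans[OF F(2) same_germ_sym[OF G(2)]])
    have ends: "p 0 = q 0" "p 1 = q 1" using p q by simp_all
    have "same_germ (p 1) (F 1) (G 1)"
      by (rule path_sections_agree[OF sc V(1) p(1,2) q(1,2) ends F(1) G(1) start])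
    then show ?thesis using p F G by simp
  qed
  show thesis
  proof (rule that[of R])
    fix x assume x: "x \<in> V"
    obtain p F where p: "path p" "path_image p \<subseteq> V" "p 0 = a" "p 1 = x" and F: "section_along {0..1} p F"
      "same_germ a (F 0) f" "R x = F 1" using R[OF x] unfolding C_def by (elim exE conjE)
    show germ: "germ_at x (R x)" using section_germ[OF F(1), of 1] p F(3) by simp
    obtain N where N: "open N" "x \<in> N" "\<And>y. y \<in> N \<Longrightarrow> germ_at y (R x)" using germ_at_nhd[OF germ] by metis
    obtain B where B: "open B" "x \<in> B"
      and B3: "\<forall>y\<in>B \<inter> V. \<exists>p. path p \<and> p 0 = x \<and> p 1 = y \<and> path_image p \<subseteq> N \<inter> V"
      using lpc[OF x N(1,2)] by (elim exE conjE)
    have "same_germ y (R y) (R x)" if y: "y \<in> B \<inter> V" for y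
    proof -
      obtain q where q: "path q" "q 0 = x" "q 1 = y" "path_image q \<subseteq> N \<inter> V"
        using bspec[OF B3 y] by (elim exE conjE)
      define j where "j = p +++ q"
      have j: "path j" "path_image j \<subseteq> V" "j 0 = a" "j 1 = y"
      proof -
        show "path j" unfolding j_def
          by (rule path_join_imp) (use p q in \<open>auto simp: pathfinish_def pathstart_def\<close>)
        show "path_image j \<subseteq> V" unfolding j_def
          by (rule subset_path_image_join) (use p q in auto)
        show "j 0 = a" "j 1 = y" using p q by (simp_all add: j_def joinpaths_def)
      qed
      define G where "G t = (if t \<in> {0..1/2} then F (2 * t) else R x)" for t :: real
      have "section_along ({0..1/2} \<union> {1/2..1}) j G"
        unfolding G_def
      proof (rule section_union)
        have "section_along {0..1/2} (\<lambda>t. p (2 * t)) (\<lambda>t. F (2 * t))"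
          by (rule section_reparametrise[OF F(1)]) (auto intro!: continuous_intros)
        then show "section_along {0..1/2} j (\<lambda>t. F (2 * t))"
          by (rule section_cong[rotated]) (simp add: j_def joinpaths_def)
        show "section_along {1/2..1} j (\<lambda>t. R x)"
        proof (rule section_const, rule N(3))
          fix t :: real assume t: "t \<in> {1/2..1}"
          have "j t = q (2 * t - 1)"
          proof (cases "t = 1/2")
            case True
            show ?thesis unfolding True using p(4) q(2) by (simp add: j_def joinpaths_def)
          qed (use t in \<open>auto simp: j_def joinpaths_def\<close>)
          then show "j t \<in> N" using q(4) t by (auto simp: path_image_def)
        qed
        show "same_germ (j s) (F (2 * s)) (R x)" if "s \<in> {0..1/2} \<inter> {1/2..1}" for s
        proof -
          have "2 * s = 1" using that by auto
          then show ?thesis using same_germ_refl F(3) by simp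
        qed
        have "{0..1/2} \<union> {1/2..1} = {0..1::real}" by auto
        then show "continuous_on ({0..1/2} \<union> {1/2..1}) j" using j(1) by (simp add: path_def)
      qed auto
      moreover have "{0..1/2} \<union> {1/2..1} = {0..1::real}" by auto
      ultimately have "section_along {0..1} j G" by simp
      moreover have "G 0 = F 0" "G 1 = R x" by (simp_all add: G_def)
      ultimately have "C y (R x)" using j F(2) unfolding C_def by (intro exI[of _ j] exI[of _ G]) simp
      then show ?thesis using unique R y by blast
    qed
    then show "\<exists>B. open B \<and> x \<in> B \<and> (\<forall>y\<in>B \<inter> V. same_germ y (R y) (R x))" using B by blast
  qed
qed

text \<open>The germs obtained on \<open>V\<close> extend to a neighbourhood by compactness: finitely many of them live on
  discs covering \<open>V\<close>, and near a point of \<open>V\<close> those whose closed discs contain the point agree.\<close>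

proposition global_modulus:
  assumes sc: "simply_connected V" and V: "V \<subseteq> W" "V \<noteq> {}" "compact V"
    and lpc: "\<And>x N. x \<in> V \<Longrightarrow> open N \<Longrightarrow> x \<in> N \<Longrightarrow> \<exists>B. open B \<and> x \<in> B \<and>
       (\<forall>y\<in>B \<inter> V. \<exists>p. path p \<and> p 0 = x \<and> p 1 = y \<and> path_image p \<subseteq> N \<inter> V)"
  obtains N u where "open N" "V \<subseteq> N" "N \<subseteq> W" "hol u N" "\<And>x. x \<in> N \<Longrightarrow> cmod (u x) = E x"
proof -
  obtain a where a: "a \<in> V" using V by blast
  obtain R where R: "\<And>x. x \<in> V \<Longrightarrow> germ_at x (R x)"
    "\<And>x. x \<in> V \<Longrightarrow> \<exists>B. open B \<and> x \<in> B \<and> (\<forall>y\<in>B \<inter> V. same_germ y (R y) (R x))"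
    by (rule locally_constant_germs[OF sc V(1) a lpc]) (assumption | rule that)+
  have "\<exists>D K. regular_disc D K \<and> x \<in> D \<and> K \<subseteq> W \<and> (\<forall>y\<in>K. germ_at y (R x)) \<and>
      (\<forall>y\<in>K \<inter> V. same_germ y (R y) (R x))" if x: "x \<in> V" for x
  proof -
    obtain B where B: "open B" "x \<in> B" "\<forall>y\<in>B \<inter> V. same_germ y (R y) (R x)" using R(2)[OF x] by blast
    obtain N where N: "open N" "x \<in> N" "N \<subseteq> W" "\<And>y. y \<in> N \<Longrightarrow> germ_at y (R x)"
      using germ_at_nhd[OF R(1)[OF x]] by metis
    have "x \<in> M" "open (B \<inter> N)" "x \<in> B \<inter> N" using x V W_sub B N by auto
    then obtain D K where "regular_disc D K" "x \<in> D" "K \<subseteq> B \<inter> N" by (rule regular_disc_ex)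
    then show ?thesis using B N by blast
  qed
  then have "\<forall>x\<in>V. \<exists>p. regular_disc (fst p) (snd p) \<and> x \<in> fst p \<and> snd p \<subseteq> W \<and>
      (\<forall>y\<in>snd p. germ_at y (R x)) \<and> (\<forall>y\<in>snd p \<inter> V. same_germ y (R y) (R x))" by simp
  from bchoice[OF this] obtain P where P: "\<forall>x\<in>V. regular_disc (fst (P x)) (snd (P x)) \<and> x \<in> fst (P x) \<and>
      snd (P x) \<subseteq> W \<and> (\<forall>y\<in>snd (P x). germ_at y (R x)) \<and>
      (\<forall>y\<in>snd (P x) \<inter> V. same_germ y (R y) (R x))" by (elim exE)
  define D K where "D x = fst (P x)" and "K x = snd (P x)" for x
  have DK: "\<And>x. x \<in> V \<Longrightarrow> regular_disc (D x) (K x)" "\<And>x. x \<in> V \<Longrightarrow> x \<in> D x"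
    "\<And>x. x \<in> V \<Longrightarrow> K x \<subseteq> W" "\<And>x y. x \<in> V \<Longrightarrow> y \<in> K x \<Longrightarrow> germ_at y (R x)"
    "\<And>x y. x \<in> V \<Longrightarrow> y \<in> K x \<inter> V \<Longrightarrow> same_germ y (R y) (R x)"
    using P unfolding D_def K_def by blast+
  have "V \<subseteq> (\<Union>x\<in>V. D x)" using DK(2) by blast
  then obtain X where X: "X \<subseteq> V" "finite X" "V \<subseteq> (\<Union>x\<in>X. D x)"
    using compactE_image[OF V(3), of V D] regular_disc_open[OF DK(1)] by metis
  \<comment> \<open>away from \<open>V\<close> the local solutions on overlapping discs need not agree; on \<open>N0\<close> they do\<close>
  define N0 where "N0 = {y \<in> (\<Union>x\<in>X. D x). \<forall>i\<in>X. \<forall>j\<in>X. y \<in> K i \<longrightarrow> y \<in> K j \<longrightarrow> same_germ y (R i) (R j)}"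
  have "V \<subseteq> interior N0"
  proof
    fix y assume y: "y \<in> V"
    define T where "T i j = (if y \<in> K i \<and> y \<in> K j then interior {w. same_germ w (R i) (R j)}
       else if y \<in> K i then - K j else - K i)" for i j
    have T: "open (T i j)" "y \<in> T i j" "\<And>w. w \<in> T i j \<Longrightarrow> w \<in> K i \<Longrightarrow> w \<in> K j \<Longrightarrow> same_germ w (R i) (R j)"
      if "i \<in> X" "j \<in> X" for i j
    proof -
      have cl: "closed (K i)" "closed (K j)"
        using regular_disc_compact[OF DK(1)] compact_imp_closed that X(1) by blast+
      show "open (T i j)" using cl by (simp add: T_def open_Compl)
      show "y \<in> T i j"
      proof (cases "y \<in> K i \<and> y \<in> K j")
        case True
        then have "same_germ y (R i) (R j)"
          using DK(5)[of i y] DK(5)[of j y] that X(1) y same_germ_trans same_germ_sym by blast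
        then obtain N where "open N" "y \<in> N" "\<And>w. w \<in> N \<Longrightarrow> same_germ w (R i) (R j)"
          using same_germ_nhd by metis
        then have "y \<in> interior {w. same_germ w (R i) (R j)}" by (intro interiorI[of N]) auto
        then show ?thesis using True by (simp add: T_def)
      qed (auto simp: T_def)
      show "same_germ w (R i) (R j)" if "w \<in> T i j" "w \<in> K i" "w \<in> K j" for w
        using that interior_subset[of "{w. same_germ w (R i) (R j)}"] by (auto simp: T_def split: if_splits)
    qed
    obtain i0 where i0: "i0 \<in> X" "y \<in> D i0" using X y by blast
    define Y where "Y = D i0 \<inter> (\<Inter>i\<in>X. \<Inter>j\<in>X. T i j)"
    have "open Y"
      unfolding Y_def using X T(1) i0 regular_disc_open[OF DK(1)] by (intro open_Int open_INT ballI) auto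
    moreover have "y \<in> Y" using T(2) i0 by (simp add: Y_def)
    moreover have "Y \<subseteq> N0" using T(3) i0 unfolding Y_def N0_def by blast
    ultimately show "y \<in> interior N0" by (rule interiorI)
  qed
  define u where "u w = R (SOME i. i \<in> X \<and> w \<in> D i) w" for w
  have DsubK: "D i \<subseteq> K i" if "i \<in> X" for i using regular_disc_sub(1)[OF DK(1)] that X by blast
  have u: "u w = R i w" if w: "w \<in> N0" "w \<in> D i" and i: "i \<in> X" for w i
  proof -
    define j where "j = (SOME i. i \<in> X \<and> w \<in> D i)"
    have "j \<in> X \<and> w \<in> D j" unfolding j_def by (rule someI[of _ i]) (use w i in simp)
    then have "same_germ w (R j) (R i)" using w i DsubK unfolding N0_def by blast
    then show ?thesis unfolding u_def j_def[symmetric] by (rule same_germ_eq)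
  qed
  have N0W: "w \<in> W" and N0E: "cmod (u w) = E w" if w: "w \<in> N0" for w
  proof -
    obtain i where i: "i \<in> X" "w \<in> D i" using w by (auto simp: N0_def)
    then have g: "germ_at w (R i)" using DK(4) DsubK X by blast
    show "w \<in> W" using germ_at_W[OF g] .
    show "cmod (u w) = E w" using g u[OF w i(2,1)] unfolding germ_at_def by auto
  qed
  show thesis
  proof (rule that[of "interior N0" u])
    show "hol u (interior N0)"
    proof (rule hol_local)
      fix w assume w: "w \<in> interior N0"
      then have "w \<in> N0" using interior_subset by blast
      then obtain i where i: "i \<in> X" "w \<in> D i" by (auto simp: N0_def)
      then have "germ_at w (R i)" using DK(4) DsubK X by blast
      then obtain N where N: "open N" "w \<in> N" "hol (R i) N" using germ_at_nhd by metis
      have "hol (R i) (N \<inter> D i \<inter> interior N0)" by (rule hol_subset[OF N(3)]) blast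
      moreover have "u y = R i y" if "y \<in> N \<inter> D i \<inter> interior N0" for y
        using u[of y i] i that interior_subset by blast
      ultimately have "hol u (N \<inter> D i \<inter> interior N0)" using hol_cong by metis
      moreover have "open (N \<inter> D i \<inter> interior N0)"
        using N regular_disc_open[OF DK(1)] i X by blast
      ultimately show "\<exists>N. open N \<and> w \<in> N \<and> hol u N" using N i w by blast
    qed
    show "interior N0 \<subseteq> W" using N0W interior_subset by blast
    show "cmod (u x) = E x" if "x \<in> interior N0" for x using N0E that interior_subset by blast
  qed (use \<open>V \<subseteq> interior N0\<close> in auto)
qed

end

context compact_riemann_surface_with_boundary
begin

lemma V_locally_path_connected:
  assumes x: "x \<in> V" and N: "open N" "x \<in> N"
  shows "\<exists>B. open B \<and> x \<in> B \<and> (\<forall>y\<in>B \<inter> V. \<exists>p. path p \<and> p 0 = x \<and> p 1 = y \<and> path_image p \<subseteq> N \<inter> V)"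
proof -
  obtain A \<psi> where A: "x \<in> A" "adapted_chart M atlas V (A, \<psi>)" using V_submanifold[OF x] by blast
  have tc: "open A" "homeomorphism A (\<psi> ` A) \<psi> (inv_into A \<psi>)" "open (\<psi> ` A)"
    and half: "V \<inter> A = {x \<in> A. Im (\<psi> x) \<ge> 0}"
    using A by (auto simp: adapted_chart_def topological_chart_def)
  have inv: "inv_into A \<psi> (\<psi> y) = y" if "y \<in> A" for y using tc(2) that by (auto simp: homeomorphism_def)
  have cont: "continuous_on A \<psi>" "continuous_on (\<psi> ` A) (inv_into A \<psi>)"
    using tc(2) by (auto simp: homeomorphism_def)
  have "open (\<psi> ` A \<inter> inv_into A \<psi> -` N)"
    by (rule continuous_open_preimage[OF cont(2) tc(3) N(1)])
  moreover have "\<psi> x \<in> \<psi> ` A \<inter> inv_into A \<psi> -` N" using A N inv by simp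
  ultimately obtain e where e: "e > 0" "ball (\<psi> x) e \<subseteq> \<psi> ` A \<inter> inv_into A \<psi> -` N" by (rule openE)
  have mem: "y \<in> V \<longleftrightarrow> 0 \<le> Im (\<psi> y)" if "y \<in> A" for y
  proof -
    have "y \<in> V \<inter> A \<longleftrightarrow> y \<in> {x \<in> A. Im (\<psi> x) \<ge> 0}" unfolding half ..
    then show ?thesis using that by simp
  qed
  show ?thesis
  proof (intro exI[of _ "A \<inter> \<psi> -` ball (\<psi> x) e"] conjI ballI)
    show "open (A \<inter> \<psi> -` ball (\<psi> x) e)" by (rule continuous_open_preimage[OF cont(1) tc(1) open_ball])
    show "x \<in> A \<inter> \<psi> -` ball (\<psi> x) e" using A e by simp
    fix y assume y: "y \<in> A \<inter> \<psi> -` ball (\<psi> x) e \<inter> V"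
    define l where "l = linepath (\<psi> x) (\<psi> y)"
    have seg: "closed_segment (\<psi> x) (\<psi> y) \<subseteq> ball (\<psi> x) e"
      using y e by (intro closed_segment_subset) auto
    have im: "l t \<in> ball (\<psi> x) e" "0 \<le> Im (l t)" if "t \<in> {0..1}" for t
    proof -
      show "l t \<in> ball (\<psi> x) e" using seg that linepath_in_path[of t] unfolding l_def by blast
      have "0 \<le> Im (\<psi> x)" "0 \<le> Im (\<psi> y)" using mem A(1) x y by blast+
      then show "0 \<le> Im (l t)" using that by (simp add: l_def linepath_def)
    qed
    define p where "p t = inv_into A \<psi> (l t)" for t
    have pt: "p t \<in> A" "\<psi> (p t) = l t" "p t \<in> N" if "t \<in> {0..1}" for t
    proof -
      have "l t \<in> \<psi> ` A \<inter> inv_into A \<psi> -` N" using im(1)[OF that] e(2) by blast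
      then show "p t \<in> A" "\<psi> (p t) = l t" "p t \<in> N" by (auto simp: p_def inv)
    qed
    show "\<exists>p. path p \<and> p 0 = x \<and> p 1 = y \<and> path_image p \<subseteq> N \<inter> V"
    proof (intro exI[of _ p] conjI)
      show "path p"
        unfolding path_def p_def
        by (rule continuous_on_compose2[OF cont(2)]) (use im(1) e(2) in \<open>auto simp: l_def\<close>)
      show "p 0 = x" "p 1 = y" using A y inv by (auto simp: p_def l_def linepath_def)
      show "path_image p \<subseteq> N \<inter> V"
        using pt im(2) mem by (auto simp: path_image_def)
    qed
  qed
qed

end

section \<open>A holomorphic function with large derivative\<close>

context pointed_bordered_surface
begin

text \<open>With \<open>g\<close> from \<open>green_approximation\<close>, the function \<open>exp (- g)\<close> is locally the modulus of a
  holomorphic function, also at \<open>pt\<close>, where it vanishes like \<open>\<bar>z\<bar>\<close>. For the exact Green function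
  in place of \<open>g\<close>, the resulting \<open>u\<close> would be a Riemann map of the interior of \<open>V\<close>.\<close>

proposition near_extremal_function:
  assumes sc: "simply_connected V"
    and l: "Lim (at pt) (\<lambda>x. green_function M atlas V pt (U0, z) x + ln (cmod (z x))) < l"
  obtains N u where "open N" "V \<subseteq> N" "N \<subseteq> M" "hol u N" "\<And>x. x \<in> N \<Longrightarrow> cmod (u x) \<le> 1" "u pt = 0"
    "exp (- l) < cmod (deriv (u \<circ> inv_into U0 z) 0)"
proof -
  obtain W g h s where W: "open W" "V \<subseteq> W" "W \<subseteq> M" and g: "\<And>x. x \<in> W - {pt} \<Longrightarrow> harmonic_at g x"
    "\<And>x. x \<in> W - {pt} \<Longrightarrow> 0 \<le> g x" and s: "0 < s" "s \<le> \<rho>" and h: "\<And>x. x \<in> odisc s \<Longrightarrow> harmonic_at h x"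
    "\<And>x. x \<in> odisc s - {pt} \<Longrightarrow> g x = h x - ln (cmod (z x))" "h pt < l"
    by (rule green_approximation[OF l]) (rule that)
  define E where "E x = (if x = pt then 0 else exp (- g x))" for x
  have E0: "E x \<noteq> 0" if "x \<noteq> pt" for x using that by (simp add: E_def)
  have Eh: "E x = cmod (z x) * exp (- h x)" if x: "x \<in> odisc s" for x
  proof (cases "x = pt")
    case False
    then have "cmod (z x) > 0" using x z_zero by (auto simp: odisc_def)
    moreover have "- g x = ln (cmod (z x)) + (- h x)" using False x h(2)[of x] by simp
    ultimately show ?thesis using False by (simp only: E_def if_False exp_add exp_ln)
  qed (simp add: E_def z_pt)
  interpret E: modulus_sheaf M atlas W E
  proof
    show "open W" "W \<subseteq> M" by (rule W)+
    show "\<exists>N f. open N \<and> x \<in> N \<and> N \<subseteq> W \<and> hol f N \<and> (\<forall>y\<in>N. cmod (f y) = E y)" if x: "x \<in> W" for x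
    proof (cases "x = pt")
      case False
      then obtain N f where N: "open N" "x \<in> N" "N \<subseteq> M" "hol f N" "\<forall>y\<in>N. g y = Re (f y)"
        using g(1)[of x] x unfolding harmonic_at_def by blast
      have "hol (\<lambda>y. exp (- f y)) (N \<inter> W - {pt})"
        by (rule hol_compose[OF hol_subset[OF N(4)], of _ "\<lambda>w. exp (- w)" UNIV]) (auto intro!: holomorphic_intros)
      moreover have "cmod (exp (- f y)) = E y" if "y \<in> N \<inter> W - {pt}" for y
        using N(5) that by (simp add: E_def)
      ultimately show ?thesis using N W x False
        by (intro exI[of _ "N \<inter> W - {pt}"] exI[of _ "\<lambda>y. exp (- f y)"]) (auto simp: open_delete)
    next
      case True
      obtain N f where N: "open N" "pt \<in> N" "N \<subseteq> M" "hol f N" "\<forall>y\<in>N. h y = Re (f y)"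
        using h(1)[OF pt_odisc[OF s(1)]] unfolding harmonic_at_def by blast
      have "hol (\<lambda>y. z y * exp (- f y)) (N \<inter> W \<inter> odisc s)"
      proof (rule hol_mult)
        show "hol z (N \<inter> W \<inter> odisc s)" by (rule hol_chart[OF zchart]) (auto simp: odisc_def)
        show "hol (\<lambda>y. exp (- f y)) (N \<inter> W \<inter> odisc s)"
          by (rule hol_compose[OF hol_subset[OF N(4)], of _ "\<lambda>w. exp (- w)" UNIV]) (auto intro!: holomorphic_intros)
      qed
      moreover have "cmod (z y * exp (- f y)) = E y" if "y \<in> N \<inter> W \<inter> odisc s" for y
        using N(5) that by (simp add: Eh norm_mult)
      moreover have "pt \<in> N \<inter> W \<inter> odisc s" "open (N \<inter> W \<inter> odisc s)" using N W x True pt_odisc[OF s(1)] odisc_open by auto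
      ultimately show ?thesis using True
        by (intro exI[of _ "N \<inter> W \<inter> odisc s"] exI[of _ "\<lambda>y. z y * exp (- f y)"]) auto
    qed
    show "\<not> (\<forall>\<^sub>F y in nhds x. E y = 0)" for x
    proof
      assume ev: "\<forall>\<^sub>F y in nhds x. E y = 0"
      then have "x = pt" using E0 eventually_nhds_x_imp_x[OF ev] by blast
      with ev have "\<forall>\<^sub>F y in at pt. False"
        unfolding eventually_at_filter using E0 by (auto elim!: eventually_mono)
      then show False using at_pt_nontrivial by (simp add: eventually_False)
    qed
  qed
  have ptV: "pt \<in> V" using pt_interior interior_subset by blast
  obtain N u where N: "open N" "V \<subseteq> N" "N \<subseteq> W" and u: "hol u N" "\<And>x. x \<in> N \<Longrightarrow> cmod (u x) = E x"
    by (rule E.global_modulus[OF sc W(2) _ V_compact V_locally_path_connected])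
       (use ptV in blast, assumption, assumption, assumption, rule that)
  have NM: "N \<subseteq> M" using N W by blast
  have ptN: "pt \<in> N" using ptV N by blast
  have upt: "u pt = 0" using u(2)[OF ptN] by (simp add: E_def)
  define u' where "u' = u \<circ> inv_into U0 z"
  have op: "open (z ` (U0 \<inter> (N \<inter> odisc s)))" by (rule compatible_chart_open_image[OF zchart open_Int[OF N(1) odisc_open]])
  have zero: "0 \<in> z ` (U0 \<inter> (N \<inter> odisc s))" using pt_U0 ptN pt_odisc[OF s(1)] z_pt by (metis IntI imageI)
  have hu': "u' holomorphic_on z ` (U0 \<inter> (N \<inter> odisc s))"
    unfolding u'_def by (rule holomorphic_on_subset[OF hol_compatible_chart[OF zchart N(1) NM u(1)]]) blast
  have inv0: "inv_into U0 z 0 = pt" using compatible_chart_inv[OF zchart pt_U0] z_pt by simp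
  have "(u' has_field_derivative deriv u' 0) (at 0)"
    using holomorphic_derivI[OF hu' op zero] .
  then have "(\<lambda>w. (u' w - u' 0) / (w - 0)) \<midarrow>0\<rightarrow> deriv u' 0"
    by (simp add: has_field_derivative_iff)
  then have lim1: "(\<lambda>w. cmod ((u' w - u' 0) / (w - 0))) \<midarrow>0\<rightarrow> cmod (deriv u' 0)"
    by (rule tendsto_norm)
  have "isCont (inv_into U0 z) 0"
    using continuous_on_eq_continuous_at[OF compatible_chart_image[OF zchart], of "inv_into U0 z"]
      compatible_chart_inv_cont[OF zchart] zero by blast
  moreover have "isCont h (inv_into U0 z 0)"
    unfolding inv0 by (rule harmonic_at_isCont[OF h(1)[OF pt_odisc[OF s(1)]]])
  ultimately have "isCont (\<lambda>w. exp (- h (inv_into U0 z w))) 0"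
    by (intro continuous_intros isCont_o2[where f = "inv_into U0 z" and g = h])
  then have lim2: "(\<lambda>w. exp (- h (inv_into U0 z w))) \<midarrow>0\<rightarrow> exp (- h pt)"
    by (simp add: isCont_def inv0)
  have "\<forall>\<^sub>F w in at 0. w \<in> z ` (U0 \<inter> (N \<inter> odisc s)) \<and> w \<noteq> 0"
    using op zero by (auto simp: eventually_at_topological)
  then have "\<forall>\<^sub>F w in at 0. cmod ((u' w - u' 0) / (w - 0)) = exp (- h (inv_into U0 z w))"
  proof eventually_elim
    case (elim w)
    then obtain x where x: "x \<in> U0" "x \<in> N" "x \<in> odisc s" "w = z x" by blast
    then have "cmod (u' w) = cmod w * exp (- h x)"
      using u(2) Eh compatible_chart_inv[OF zchart] by (simp add: u'_def)
    then show ?case using elim x compatible_chart_inv[OF zchart x(1)] upt inv0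
      by (simp add: norm_divide u'_def)
  qed
  from tendsto_cong[OF this] lim1 have "(\<lambda>w. exp (- h (inv_into U0 z w))) \<midarrow>0\<rightarrow> cmod (deriv u' 0)"
    by blast
  then have "cmod (deriv u' 0) = exp (- h pt)" using lim2 by (rule LIM_unique)
  then have "exp (- l) < cmod (deriv u' 0)" using h(3) by simp
  moreover have "cmod (u x) \<le> 1" if "x \<in> N" for x
    using u(2)[OF that] g(2)[of x] that N by (auto simp: E_def)
  ultimately show thesis using that[OF N(1,2) NM u(1) _ upt] by (simp add: u'_def)
qed

end

section \<open>Power series with integral coefficients\<close>

text \<open>Coefficients \<open>a\<close> of a series \<open>A\<close> starting with order \<open>m\<close> such that twice the real part of
  \<open>A \<circ> \<psi>\<close> is integral. As \<open>\<psi> ^ n\<close> starts with \<open>\<psi>'(0) ^ n\<close>, the \<open>n\<close>-th coefficient of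
  \<open>A \<circ> \<psi>\<close> is a sum over the previous coefficients of \<open>A\<close> plus \<open>a n * \<psi>'(0) ^ n\<close>, and
  rounding requires only a contribution of size at most 1 from the last term.\<close>

fun integral_coeffs :: "complex fps \<Rightarrow> nat \<Rightarrow> nat \<Rightarrow> complex" where
  "integral_coeffs \<psi> m n =
     (let S = 2 * Re (\<Sum>k<n. integral_coeffs \<psi> m k * fps_nth (\<psi> ^ k) n)
      in of_real (if n < m then 0 else if n = m then 1 else of_int \<lceil>S\<rceil> - S) / (2 * fps_nth \<psi> 1 ^ n))"

declare integral_coeffs.simps [simp del]

lemma integral_coeffs:
  assumes \<psi>0: "fps_nth \<psi> 0 = 0" and \<psi>1: "fps_nth \<psi> 1 \<noteq> 0"
  shows "k < m \<Longrightarrow> integral_coeffs \<psi> m k = 0"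
    and "cmod (integral_coeffs \<psi> m k) \<le> 1 / (2 * cmod (fps_nth \<psi> 1) ^ k)"
    and "2 * Re (fps_nth (fps_compose (Abs_fps (integral_coeffs \<psi> m)) \<psi>) n) \<in> \<int>"
    and "2 * Re (fps_nth (fps_compose (Abs_fps (integral_coeffs \<psi> m)) \<psi>) m) = 1"
    and "k < m \<Longrightarrow> fps_nth (fps_compose (Abs_fps (integral_coeffs \<psi> m)) \<psi>) k = 0"
proof -
  define a where "a = integral_coeffs \<psi> m"
  define S where "S n = 2 * Re (\<Sum>k<n. a k * fps_nth (\<psi> ^ k) n)" for n
  define r where "r n = (if n < m then 0 else if n = m then 1 else of_int \<lceil>S n\<rceil> - S n)" for n
  have a: "a n = of_real (r n) / (2 * fps_nth \<psi> 1 ^ n)" for n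
    unfolding a_def by (subst integral_coeffs.simps) (simp add: Let_def r_def S_def a_def)
  have a0: "a k = 0" if "k < m" for k using that by (simp add: a r_def)
  then show "k < m \<Longrightarrow> integral_coeffs \<psi> m k = 0" by (simp add: a_def)
  have r: "\<bar>r n\<bar> \<le> 1" for n unfolding r_def by (auto simp: abs_le_iff) linarith+
  show "cmod (integral_coeffs \<psi> m k) \<le> 1 / (2 * cmod (fps_nth \<psi> 1) ^ k)"
    unfolding a_def[symmetric] a using r[of k]
    by (auto simp: norm_divide norm_mult norm_power intro!: divide_right_mono)
  have nth: "fps_nth (fps_compose (Abs_fps a) \<psi>) n = (\<Sum>k<n. a k * fps_nth (\<psi> ^ k) n) + a n * fps_nth \<psi> 1 ^ n" for n
    using startsby_zero_power_nth_same[OF \<psi>0, of n]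
    by (simp add: fps_compose_nth atLeast0AtMost lessThan_Suc_atMost[symmetric])
  have nth2: "2 * Re (fps_nth (fps_compose (Abs_fps a) \<psi>) n) = S n + r n" for n
  proof -
    have "a n * fps_nth \<psi> 1 ^ n = of_real (r n) / 2" using \<psi>1 by (simp add: a)
    then have "Re (a n * fps_nth \<psi> 1 ^ n) = r n / 2" by (simp only: Re_divide_numeral Re_complex_of_real)
    then show ?thesis unfolding nth S_def plus_complex.sel by simp
  qed
  have S0: "S n = 0" if "n \<le> m" for n
    unfolding S_def using a0 that by (simp add: sum.neutral)
  show "2 * Re (fps_nth (fps_compose (Abs_fps (integral_coeffs \<psi> m)) \<psi>) n) \<in> \<int>"
    unfolding a_def[symmetric] nth2 using S0[of n] by (auto simp: r_def)
  show "2 * Re (fps_nth (fps_compose (Abs_fps (integral_coeffs \<psi> m)) \<psi>) m) = 1"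
    unfolding a_def[symmetric] nth2 using S0[of m] by (simp add: r_def)
  show "fps_nth (fps_compose (Abs_fps (integral_coeffs \<psi> m)) \<psi>) k = 0" if "k < m"
    unfolding a_def[symmetric] nth using a0 that by (simp add: sum.neutral)
qed

lemma cnj_fps_nth [simp]: "fps_nth (cnj_fps F) n = cnj (fps_nth F n)"
  by (simp add: cnj_fps_def)

lemma cnj_fps_cnj [simp]: "cnj_fps (cnj_fps F) = F"
  by (simp add: fps_eq_iff)

lemma cnj_fps_mult: "cnj_fps (F * G) = cnj_fps F * cnj_fps G"
  by (simp add: fps_eq_iff fps_mult_nth)

lemma cnj_fps_power: "cnj_fps (F ^ n) = cnj_fps F ^ n"
proof (induction n)
  case 0
  show ?case by (simp add: fps_eq_iff)
qed (simp add: cnj_fps_mult)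

lemma cnj_fps_compose: "cnj_fps (fps_compose F G) = fps_compose (cnj_fps F) (cnj_fps G)"
  by (simp add: fps_eq_iff fps_compose_nth flip: cnj_fps_power)

lemma fps_conv_radius_cnj [simp]: "fps_conv_radius (cnj_fps F) = fps_conv_radius F"
  by (simp add: fps_conv_radius_def conv_radius_def)

lemma eval_fps_cnj:
  assumes "norm w < fps_conv_radius F"
  shows "eval_fps (cnj_fps F) w = cnj (eval_fps F (cnj w))"
proof -
  have "summable (\<lambda>n. fps_nth F n * cnj w ^ n)"
    using summable_fps[of "cnj w" F] assms by simp
  then have "(\<lambda>n. cnj (fps_nth F n * cnj w ^ n)) sums cnj (eval_fps F (cnj w))"
    unfolding sums_cnj eval_fps_def by (rule summable_sums)
  then show ?thesis by (simp add: eval_fps_def sums_iff)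
qed

lemma has_fps_expansion_cnj:
  assumes "f has_fps_expansion F"
  shows "(cnj \<circ> f \<circ> cnj) has_fps_expansion cnj_fps F"
  unfolding has_fps_expansion_def
proof
  have r: "0 < fps_conv_radius F" and ev: "\<forall>\<^sub>F w in nhds 0. eval_fps F w = f w"
    using assms by (auto simp: has_fps_expansion_def)
  show "0 < fps_conv_radius (cnj_fps F)" using r by simp
  obtain S where S: "open S" "0 \<in> S" "\<And>w. w \<in> S \<Longrightarrow> eval_fps F w = f w"
    using ev unfolding eventually_nhds by blast
  have "open (cnj -` S \<inter> eball 0 (fps_conv_radius F))"
    using continuous_open_preimage[of UNIV cnj S] S by (auto intro!: continuous_intros open_Int)
  moreover have "eval_fps (cnj_fps F) w = (cnj \<circ> f \<circ> cnj) w"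
    if "w \<in> cnj -` S \<inter> eball 0 (fps_conv_radius F)" for w
    using that S(3)[of "cnj w"] eval_fps_cnj[of w F] by (simp add: dist_norm)
  ultimately show "\<forall>\<^sub>F w in nhds 0. eval_fps (cnj_fps F) w = (cnj \<circ> f \<circ> cnj) w"
    unfolding eventually_nhds using S(2) r
    by (intro exI[of _ "cnj -` S \<inter> eball 0 (fps_conv_radius F)"]) (auto simp: zero_ereal_def)
qed

lemma eval_fps_tail_bound:
  fixes a :: "nat \<Rightarrow> complex"
  assumes L: "L > 1" and a: "\<And>k. k < m \<Longrightarrow> a k = 0" "\<And>k. cmod (a k) \<le> 1 / (2 * L ^ k)"
    and w: "cmod w \<le> 1"
  shows "cmod (eval_fps (Abs_fps a) w) \<le> (1 / L) ^ m / (1 - 1 / L) / 2"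
proof -
  let ?q = "1 / L"
  have q: "0 < ?q" "?q < 1" using L by auto
  have le: "norm (a k * w ^ k) \<le> (if k < m then 0 else ?q ^ k / 2)" for k
  proof (cases "k < m")
    case False
    have "norm (a k * w ^ k) \<le> 1 / (2 * L ^ k) * 1"
      unfolding norm_mult norm_power using a(2)[of k] w L
      by (intro mult_mono) (auto simp: power_le_one)
    then show ?thesis using False by (simp add: power_one_over field_simps)
  qed (use a in auto)
  have "(\<lambda>k. ?q ^ (k + m) / 2) sums (?q ^ m / (1 - ?q) / 2)"
    using sums_mult[OF geometric_sums[of ?q], of "?q ^ m / 2"] q by (simp add: power_add mult_ac)
  then have "(\<lambda>k. (if k + m < m then 0 else ?q ^ (k + m) / 2)) sums (?q ^ m / (1 - ?q) / 2)" by simp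
  then have sums: "(\<lambda>k. (if k < m then 0 else ?q ^ k / 2)) sums (?q ^ m / (1 - ?q) / 2)"
    by (subst (asm) sums_iff_shift) simp
  have "norm (\<Sum>k. a k * w ^ k) \<le> (\<Sum>k. (if k < m then 0 else ?q ^ k / 2))"
    by (rule norm_suminf_le[OF le]) (use sums in \<open>simp add: sums_iff\<close>)
  then show ?thesis using sums by (simp add: eval_fps_def sums_iff)
qed

lemma fps_conv_radius_ge_1:
  fixes a :: "nat \<Rightarrow> complex"
  assumes L: "L > 1" and a: "\<And>k. cmod (a k) \<le> 1 / (2 * L ^ k)"
  shows "1 \<le> fps_conv_radius (Abs_fps a)"
proof -
  have "summable (\<lambda>k. a k * 1 ^ k)"
  proof (rule summable_comparison_test)
    show "\<exists>N. \<forall>n\<ge>N. norm (a n * 1 ^ n) \<le> (1 / L) ^ n"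
    proof (intro exI[of _ 0] allI impI)
      fix n
      have "1 / (2 * L ^ n) \<le> (1 / L) ^ n" using L by (simp add: power_one_over field_simps)
      then show "norm (a n * 1 ^ n) \<le> (1 / L) ^ n" using a[of n] by simp
    qed
    show "summable (\<lambda>n. (1 / L) ^ n)" using L by (intro summable_geometric) auto
  qed
  from conv_radius_geI[OF this] show ?thesis by (simp add: fps_conv_radius_def one_ereal_def)
qed

section \<open>The real structure and the integral function\<close>

context riemann_surface
begin

lemma hol_antiholomorphic_compose:
  assumes c: "antiholomorphic_map_on M atlas c W" and W: "open W" "W \<subseteq> M" and N: "open N" "N \<subseteq> M" and f: "hol f N"
  shows "hol (\<lambda>x. cnj (f (c x))) (W \<inter> c -` N)" and "open (W \<inter> c -` N)"
proof -
  have cont: "continuous_on W c" and cM: "c ` W \<subseteq> M"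
    and anti: "\<And>U \<phi> U' \<phi>'. (U, \<phi>) \<in> atlas \<Longrightarrow> (U', \<phi>') \<in> atlas \<Longrightarrow>
        (cnj \<circ> \<phi>' \<circ> c \<circ> inv_into U \<phi>) holomorphic_on \<phi> ` {x \<in> U \<inter> W. c x \<in> U'}"
    using c by (auto simp: antiholomorphic_map_on_def)
  show op: "open (W \<inter> c -` N)" by (rule continuous_open_preimage[OF cont W(1) N(1)])
  show "hol (\<lambda>x. cnj (f (c x))) (W \<inter> c -` N)"
  proof (rule hol_local)
    fix x assume x: "x \<in> W \<inter> c -` N"
    then have "c x \<in> M" using cM by blast
    then obtain U' \<phi>' where A': "(U', \<phi>') \<in> atlas" "c x \<in> U'" by (rule atlas_at)
    have L': "compatible_chart (U', \<phi>')" using A' compatible_chart_atlas by blast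
    define Y where "Y = W \<inter> c -` (N \<inter> U')"
    have "open Y" unfolding Y_def
      by (rule continuous_open_preimage[OF cont W(1) open_Int[OF N(1) compatible_chart_open[OF L']]])
    moreover have "x \<in> Y" using x A' by (simp add: Y_def)
    moreover have "hol (\<lambda>x. cnj (f (c x))) Y"
      unfolding holomorphic_on_surface_def
    proof safe
      fix U \<phi> assume A: "(U, \<phi>) \<in> atlas"
      have L: "compatible_chart (U, \<phi>)" using A compatible_chart_atlas by blast
      define S where "S = \<phi>' ` (U' \<inter> N)"
      have S: "open S" "(f \<circ> inv_into U' \<phi>') holomorphic_on S"
        unfolding S_def using compatible_chart_open_image[OF L' N(1)] hol_compatible_chart[OF L' N f] by auto
      have im: "cnj ` cnj ` S = S" by (simp add: image_image)
      have opc: "open (cnj ` S)"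
      proof -
        have "cnj ` S = cnj -` S" by (auto simp: image_iff) (metis complex_cnj_cnj)
        then show ?thesis using continuous_open_preimage[of UNIV cnj S] S(1) by (auto intro!: continuous_intros)
      qed
      have 1: "cnj \<circ> (f \<circ> inv_into U' \<phi>') \<circ> cnj holomorphic_on cnj ` S"
        by (rule holomorphic_on_compose_cnj_cnj[OF _ opc]) (simp add: im S)
      have 2: "(cnj \<circ> \<phi>' \<circ> c \<circ> inv_into U \<phi>) holomorphic_on \<phi> ` (U \<inter> Y)"
        by (rule holomorphic_on_subset[OF anti[OF A A'(1)]]) (auto simp: Y_def)
      have "((cnj \<circ> (f \<circ> inv_into U' \<phi>') \<circ> cnj) \<circ> (cnj \<circ> \<phi>' \<circ> c \<circ> inv_into U \<phi>)) holomorphic_on \<phi> ` (U \<inter> Y)"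
        by (rule holomorphic_on_compose_gen[OF 2 1]) (auto simp: Y_def S_def compatible_chart_inv[OF L])
      then show "((\<lambda>x. cnj (f (c x))) \<circ> inv_into U \<phi>) holomorphic_on \<phi> ` (U \<inter> Y)"
        by (rule holomorphic_transform) (auto simp: Y_def compatible_chart_inv[OF L] compatible_chart_inv[OF L'])
    qed
    ultimately show "\<exists>N. open N \<and> x \<in> N \<and> hol (\<lambda>x. cnj (f (c x))) N" by blast
  qed
qed

end


lemma (in pointed_bordered_surface) has_fps_expansion_taylor:
  assumes N: "open N" "pt \<in> N" "N \<subseteq> M" and f: "hol f N"
  shows "(f \<circ> inv_into U0 z) has_fps_expansion taylor_at (U0, z) f"
proof -
  have "0 \<in> z ` (U0 \<inter> N)" using pt_U0 N(2) z_pt by (metis IntI imageI)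
  then show ?thesis
    unfolding taylor_at_def prod.case
    using has_fps_expansion_fps_expansion[OF compatible_chart_open_image[OF zchart N(1)] _ hol_compatible_chart[OF zchart N(1,3) f]]
    by blast
qed

text \<open>In the coordinate, \<open>c\<close> is \<open>w \<mapsto> F (cnj w)\<close>, so \<open>cnj \<circ> f \<circ> c\<close> has the series \<open>cnj T \<circ> cnj F\<close> if \<open>f\<close>
  has the series \<open>T\<close>; and \<open>cnj F \<circ> \<iota> = cnj \<iota>\<close> by the compatibility of \<open>\<iota>\<close> with the real
  structures.\<close>

lemma (in pointed_bordered_surface) taylor_conjugate:
  assumes c: "antiholomorphic_map_on M atlas c W" "open W" "W \<subseteq> M" "pt \<in> W" "c pt = pt"
    and N: "open N" "N \<subseteq> M" "pt \<in> N" and f: "hol f N"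
    and \<iota>: "fps_nth \<iota> 0 = 0" "fps_compose (conj_in_coordinate (U0, z) c) (cnj_fps \<iota>) = \<iota>"
  shows "fps_compose (taylor_at (U0, z) (\<lambda>x. cnj (f (c x)))) \<iota> =
    cnj_fps (fps_compose (taylor_at (U0, z) f) \<iota>)"
proof -
  let ?i = "inv_into U0 z"
  define F where "F = conj_in_coordinate (U0, z) c"
  \<comment> \<open>the coordinate expression of the involution, conjugated, is holomorphic\<close>
  have hz: "hol (\<lambda>x. cnj (z (c x))) (W \<inter> c -` U0)" "open (W \<inter> c -` U0)"
    using hol_antiholomorphic_compose[OF c(1-3) U0_open U0_sub hol_chart[OF zchart]] by auto
  have pt1: "pt \<in> W \<inter> c -` U0" "W \<inter> c -` U0 \<subseteq> M" using c pt_U0 by auto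
  have Q: "((\<lambda>x. cnj (z (c x))) \<circ> ?i) has_fps_expansion taylor_at (U0, z) (\<lambda>x. cnj (z (c x)))"
    by (rule has_fps_expansion_taylor[OF hz(2) pt1 hz(1)])
  have "z \<circ> c \<circ> ?i \<circ> cnj = cnj \<circ> ((\<lambda>x. cnj (z (c x))) \<circ> ?i) \<circ> cnj" by (simp add: fun_eq_iff)
  then have exp': "(z \<circ> c \<circ> ?i \<circ> cnj) has_fps_expansion cnj_fps (taylor_at (U0, z) (\<lambda>x. cnj (z (c x))))"
    using has_fps_expansion_cnj[OF Q] by simp
  have "fps_expansion (z \<circ> c \<circ> ?i \<circ> cnj) 0 = cnj_fps (taylor_at (U0, z) (\<lambda>x. cnj (z (c x))))"
    using fps_nth_fps_expansion[OF exp'] by (simp add: fps_eq_iff fps_expansion_def)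
  then have Qser: "taylor_at (U0, z) (\<lambda>x. cnj (z (c x))) = cnj_fps F"
    by (simp add: F_def conj_in_coordinate_def)
  have inv0: "?i 0 = pt" using compatible_chart_inv[OF zchart pt_U0] z_pt by simp
  have F0: "fps_nth (cnj_fps F) 0 = 0"
    using has_fps_expansion_imp_0_eq_fps_nth_0[OF Q] by (simp add: Qser inv0 c z_pt)
  have hv: "hol (\<lambda>x. cnj (f (c x))) (W \<inter> c -` N)" "open (W \<inter> c -` N)"
    using hol_antiholomorphic_compose[OF c(1-3) N(1,2) f] by auto
  have pt2: "pt \<in> W \<inter> c -` N" "W \<inter> c -` N \<subseteq> M" using c N by auto
  have T: "((\<lambda>x. cnj (f (c x))) \<circ> ?i) has_fps_expansion taylor_at (U0, z) (\<lambda>x. cnj (f (c x)))"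
    by (rule has_fps_expansion_taylor[OF hv(2) pt2 hv(1)])
  have "((cnj \<circ> (f \<circ> ?i) \<circ> cnj) \<circ> ((\<lambda>x. cnj (z (c x))) \<circ> ?i)) has_fps_expansion
      fps_compose (cnj_fps (taylor_at (U0, z) f)) (cnj_fps F)"
    using has_fps_expansion_compose[OF has_fps_expansion_cnj[OF has_fps_expansion_taylor[OF N(1,3,2) f]] Q] F0
    by (simp add: Qser)
  moreover have "\<forall>\<^sub>F w in nhds 0. ((cnj \<circ> (f \<circ> ?i) \<circ> cnj) \<circ> ((\<lambda>x. cnj (z (c x))) \<circ> ?i)) w =
      ((\<lambda>x. cnj (f (c x))) \<circ> ?i) w"
  proof -
    have "open (z ` (U0 \<inter> (W \<inter> c -` U0)))" by (rule compatible_chart_open_image[OF zchart hz(2)])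
    moreover have "0 \<in> z ` (U0 \<inter> (W \<inter> c -` U0))" using pt_U0 pt1(1) z_pt by (metis IntI imageI)
    ultimately have "\<forall>\<^sub>F w in nhds 0. w \<in> z ` (U0 \<inter> (W \<inter> c -` U0))"
      using eventually_nhds by blast
    then show ?thesis
      by eventually_elim (auto simp: compatible_chart_inv[OF zchart])
  qed
  ultimately have "((\<lambda>x. cnj (f (c x))) \<circ> ?i) has_fps_expansion
      fps_compose (cnj_fps (taylor_at (U0, z) f)) (cnj_fps F)"
    using has_fps_expansion_cong[OF _ refl] by blast
  then have "taylor_at (U0, z) (\<lambda>x. cnj (f (c x))) = fps_compose (cnj_fps (taylor_at (U0, z) f)) (cnj_fps F)"
    using T fps_expansion_unique_complex by blast
  then have "fps_compose (taylor_at (U0, z) (\<lambda>x. cnj (f (c x)))) \<iota> =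
      fps_compose (cnj_fps (taylor_at (U0, z) f)) (fps_compose (cnj_fps F) \<iota>)"
    using fps_compose_assoc[of \<iota> "cnj_fps F" "cnj_fps (taylor_at (U0, z) f)"] \<iota>(1) F0 by simp
  also have "fps_compose (cnj_fps F) \<iota> = cnj_fps \<iota>"
  proof -
    have "cnj_fps (fps_compose F (cnj_fps \<iota>)) = fps_compose (cnj_fps F) \<iota>"
      by (simp add: cnj_fps_compose)
    then show ?thesis using \<iota>(2) by (simp add: F_def)
  qed
  finally show ?thesis by (simp add: cnj_fps_compose)
qed

theorem proposition6p4p3:
  fixes M V :: "'a::t2_space set" and atlas :: "'a chart set"
    and c :: "'a \<Rightarrow> 'a" and pt :: 'a and coord :: "'a chart" and \<iota> :: "complex fps"
  assumes "smooth_formal_analytic_surface M atlas V c pt coord \<iota>"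
    and "simply_connected V"
    and "degree_normal_bundle M atlas V pt coord \<iota> < 0"
  shows "\<exists>\<alpha> \<in> fa_functions M atlas V coord \<iota>.
    \<not> fa_constant V \<alpha> \<and> fps_nth (fst \<alpha>) 0 = 0 \<and> snd \<alpha> ` V \<subseteq> ball 0 1"
proof -
  interpret S: smooth_formal_analytic_surface M atlas V c pt coord \<iota> by fact
  obtain U0 z where coord: "coord = (U0, z)" by (cases coord)
  have L: "S.compatible_chart (U0, z)" "pt \<in> U0" "z pt = 0"
    using S.coordinate by (auto simp: coord local_coordinate_at_def S.compatible_chart_def)
  have "open (z ` (U0 \<inter> interior V))" by (rule S.compatible_chart_open_image[OF L(1) open_interior])
  moreover have "0 \<in> z ` (U0 \<inter> interior V)" using L S.pt_interior by (metis IntI imageI)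
  ultimately obtain \<rho> where \<rho>: "\<rho> > 0" "cball 0 \<rho> \<subseteq> z ` (U0 \<inter> interior V)"
    using open_contains_cball by blast
  interpret P: pointed_bordered_surface M atlas V pt U0 z \<rho>
    by unfold_locales (use S.coordinate \<rho> coord in auto)
  define G where "G = Lim (at pt) (\<lambda>x. green_function M atlas V pt (U0, z) x + ln (cmod (z x)))"
  have i1: "cmod (fps_nth \<iota> 1) > 0" using S.iota_1 by simp
  have "0 < ln (cmod (fps_nth \<iota> 1) * exp (- G))"
    using assms(3) by (simp add: degree_normal_bundle_def capacitary_norm_def coord G_def)
  also have "ln (cmod (fps_nth \<iota> 1) * exp (- G)) = ln (cmod (fps_nth \<iota> 1)) - G"
    using i1 by (simp add: ln_mult)
  finally have G: "G < ln (cmod (fps_nth \<iota> 1))" by simp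
  obtain N u where N: "open N" "V \<subseteq> N" "N \<subseteq> M" and u: "S.hol u N" "\<And>x. x \<in> N \<Longrightarrow> cmod (u x) \<le> 1" "u pt = 0"
    and du: "exp (- ln (cmod (fps_nth \<iota> 1))) < cmod (deriv (u \<circ> inv_into U0 z) 0)"
    by (rule P.near_extremal_function[OF assms(2) G[unfolded G_def]]) (rule that)
  define d where "d = cmod (deriv (u \<circ> inv_into U0 z) 0) * cmod (fps_nth \<iota> 1)"
  have d: "d > 1" using du i1 by (simp add: d_def exp_minus field_simps)
  \<comment> \<open>\<open>\<bar>u\<bar>\<close> may reach 1; scaling makes room without spoiling the linear coefficient of \<open>u \<circ> \<iota>\<close>\<close>
  define \<kappa> where "\<kappa> = (1 + 1 / d) / 2"
  have \<kappa>: "0 < \<kappa>" "\<kappa> < 1" "1 < \<kappa> * d" using d by (auto simp: \<kappa>_def field_simps)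
  define v where "v x = of_real \<kappa> * u x" for x
  have v: "S.hol v N" unfolding v_def by (intro S.hol_mult S.hol_const u)
  have vle: "cmod (v x) \<le> \<kappa>" if "x \<in> N" for x
    using u(2)[OF that] \<kappa> by (simp add: v_def norm_mult)
  have ptV: "pt \<in> V" using P.pt_interior interior_subset by blast
  have ptN: "pt \<in> N" using ptV N by blast
  have inv0: "inv_into U0 z 0 = pt" using S.compatible_chart_inv[OF L(1,2)] L(3) by simp
  define T where "T = taylor_at (U0, z) v"
  have Texp: "(v \<circ> inv_into U0 z) has_fps_expansion T"
    unfolding T_def by (rule P.has_fps_expansion_taylor[OF N(1) ptN N(3) v])
  have uexp: "(u \<circ> inv_into U0 z) has_fps_expansion taylor_at (U0, z) u"
    by (rule P.has_fps_expansion_taylor[OF N(1) ptN N(3) u(1)])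
  have T0: "fps_nth T 0 = 0"
    using has_fps_expansion_imp_0_eq_fps_nth_0[OF Texp] by (simp add: inv0 v_def u)
  have "(\<lambda>w. of_real \<kappa> * (u \<circ> inv_into U0 z) w) has_fps_expansion fps_const (of_real \<kappa>) * taylor_at (U0, z) u"
    by (intro fps_expansion_intros uexp)
  then have "T = fps_const (of_real \<kappa>) * taylor_at (U0, z) u"
    using Texp fps_expansion_unique_complex by (fastforce simp: v_def o_def)
  then have T1: "fps_nth T 1 = of_real \<kappa> * deriv (u \<circ> inv_into U0 z) 0"
    using fps_nth_fps_expansion[OF uexp, of 1] by simp
  define \<psi> where "\<psi> = fps_compose T \<iota>"
  have \<psi>0: "fps_nth \<psi> 0 = 0" using T0 by (simp add: \<psi>_def)
  have "fps_nth \<psi> 1 = fps_nth T 1 * fps_nth \<iota> 1"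
    using T0 by (simp add: \<psi>_def fps_compose_nth)
  then have "cmod (fps_nth \<psi> 1) = cmod (fps_nth T 1) * cmod (fps_nth \<iota> 1)"
    by (simp only: norm_mult)
  moreover have "cmod (fps_nth T 1) = \<kappa> * cmod (deriv (u \<circ> inv_into U0 z) 0)"
    using \<kappa> by (simp only: T1 norm_mult norm_of_real abs_of_pos)
  ultimately have "cmod (fps_nth \<psi> 1) = \<kappa> * d" by (simp only: d_def mult.assoc)
  then have \<psi>1: "cmod (fps_nth \<psi> 1) > 1" "fps_nth \<psi> 1 \<noteq> 0" using \<kappa> by auto
  define \<Lambda> where "\<Lambda> = cmod (fps_nth \<psi> 1)"
  have \<Lambda>: "\<Lambda> > 1" using \<psi>1 by (simp add: \<Lambda>_def)
  \<comment> \<open>the order of vanishing \<open>m\<close> is chosen so large that the geometric tail bounding \<open>A\<close> is below \<open>1/2\<close>\<close>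
  have "(\<lambda>m. (1 / \<Lambda>) ^ m) \<longlonglongrightarrow> 0" using \<Lambda> by (intro LIMSEQ_power_zero) auto
  then have "\<forall>\<^sub>F m in sequentially. (1 / \<Lambda>) ^ m < 1 - 1 / \<Lambda>"
    by (rule order_tendstoD) (use \<Lambda> in auto)
  then obtain m0 where m0: "\<And>m. m \<ge> m0 \<Longrightarrow> (1 / \<Lambda>) ^ m < 1 - 1 / \<Lambda>"
    unfolding eventually_sequentially by blast
  define m where "m = Suc m0"
  have m: "m > 0" "(1 / \<Lambda>) ^ m < 1 - 1 / \<Lambda>" using m0[of m] by (auto simp: m_def)
  define a where "a = integral_coeffs \<psi> m"
  note ic = integral_coeffs[OF \<psi>0 \<psi>1(2), where m = m]
  have a: "\<And>k. k < m \<Longrightarrow> a k = 0" "\<And>k. cmod (a k) \<le> 1 / (2 * \<Lambda> ^ k)"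
    using ic(1,2) by (auto simp: a_def \<Lambda>_def)
  define A where "A = Abs_fps a"
  have radius: "1 \<le> fps_conv_radius A" unfolding A_def by (rule fps_conv_radius_ge_1[OF \<Lambda> a(2)])
  have radius': "ball (0::complex) 1 \<subseteq> eball 0 (fps_conv_radius A)"
  proof
    fix w :: complex assume "w \<in> ball 0 1"
    then have "ereal (norm w) < 1" by simp
    also note radius
    finally show "w \<in> eball 0 (fps_conv_radius A)" by simp
  qed
  have Abound: "cmod (eval_fps A w) < 1 / 2" if "cmod w \<le> 1" for w
  proof -
    have "cmod (eval_fps A w) \<le> (1 / \<Lambda>) ^ m / (1 - 1 / \<Lambda>) / 2"
      unfolding A_def by (rule eval_fps_tail_bound[OF \<Lambda> a that])
    also have "\<dots> < 1 / 2" using m(2) \<Lambda> by (simp add: divide_less_eq)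
    finally show ?thesis .
  qed
  \<comment> \<open>\<open>v'\<close> is holomorphic again, and its series in \<open>X\<close> is the complex conjugate of \<open>\<psi>\<close>\<close>
  obtain W where W: "open W" "V \<subseteq> W" "W \<subseteq> M" "antiholomorphic_map_on M atlas c W"
    using S.c_antiholomorphic by blast
  define v' where "v' x = cnj (v (c x))" for x
  define N' where "N' = W \<inter> c -` N"
  have v': "S.hol v' N'" "open N'"
    unfolding v'_def N'_def using S.hol_antiholomorphic_compose[OF W(4,1,3) N(1,3) v] by auto
  have VN': "V \<subseteq> N'" unfolding N'_def using W(2) N(2) S.c_maps by blast
  have v'le: "cmod (v' x) \<le> \<kappa>" if "x \<in> N'" for x using that vle by (simp add: v'_def N'_def)
  define T' where "T' = taylor_at (U0, z) v'"
  have T'exp: "(v' \<circ> inv_into U0 z) has_fps_expansion T'"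
    unfolding T'_def by (rule P.has_fps_expansion_taylor[OF v'(2) _ _ v'(1)]) (use VN' ptV W in \<open>auto simp: N'_def\<close>)
  have T'0: "fps_nth T' 0 = 0"
    using has_fps_expansion_imp_0_eq_fps_nth_0[OF T'exp] by (simp add: inv0 v'_def v_def S.pt_real u)
  have T'\<iota>: "fps_compose T' \<iota> = cnj_fps \<psi>"
    unfolding T'_def v'_def \<psi>_def T_def
    by (rule P.taylor_conjugate[OF W(4,1,3) _ S.pt_real N(1,3) ptN v S.iota_0])
       (use W(2) ptV S.iota_real coord in auto)
  \<comment> \<open>adding the conjugate term makes the series of \<open>h\<close> in \<open>X\<close> equal to twice the real part of
    \<open>A \<circ> \<psi>\<close>, hence integral\<close>
  define h where "h x = eval_fps A (v x) + eval_fps (cnj_fps A) (v' x)" for x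
  have radiusc: "ball (0::complex) 1 \<subseteq> eball 0 (fps_conv_radius (cnj_fps A))" using radius' by simp
  have "S.hol h (N \<inter> N')"
    unfolding h_def
  proof (rule S.hol_add)
    show "S.hol (\<lambda>x. eval_fps A (v x)) (N \<inter> N')"
      by (rule S.hol_compose[OF S.hol_subset[OF v] holomorphic_on_eval_fps[OF radius']])
         (use vle \<kappa> in force)+
    show "S.hol (\<lambda>x. eval_fps (cnj_fps A) (v' x)) (N \<inter> N')"
      by (rule S.hol_compose[OF S.hol_subset[OF v'(1)] holomorphic_on_eval_fps[OF radiusc]])
         (use v'le \<kappa> in force)+
  qed
  note hol_h = this
  have "(0::ereal) < 1" by simp
  then have pos: "0 < fps_conv_radius A" using radius by (rule less_le_trans)
  have hexp: "(h \<circ> inv_into U0 z) has_fps_expansion fps_compose A T + fps_compose (cnj_fps A) T'"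
  proof -
    have "(\<lambda>w. (eval_fps A \<circ> (v \<circ> inv_into U0 z)) w + (eval_fps (cnj_fps A) \<circ> (v' \<circ> inv_into U0 z)) w)
        has_fps_expansion fps_compose A T + fps_compose (cnj_fps A) T'"
      by (intro has_fps_expansion_add has_fps_expansion_compose eval_fps_has_fps_expansion Texp T'exp T0 T'0)
         (use pos in simp_all)
    then show ?thesis by (simp add: h_def o_def)
  qed
  have taylor_h: "taylor_at coord h = fps_compose A T + fps_compose (cnj_fps A) T'"
  proof -
    have "(h \<circ> inv_into U0 z) has_fps_expansion taylor_at (U0, z) h"
      by (rule P.has_fps_expansion_taylor[OF _ _ _ hol_h]) (use N v'(2) VN' ptV in auto)
    then show ?thesis using hexp fps_expansion_unique_complex coord by blast
  qed
  define B where "B = fps_compose A \<psi>"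
  have comp_h: "fps_compose (taylor_at coord h) \<iota> = B + cnj_fps B"
  proof -
    have "fps_compose (fps_compose A T) \<iota> = B"
      unfolding B_def \<psi>_def using fps_compose_assoc[of \<iota> T A] S.iota_0 T0 by simp
    moreover have "fps_compose (fps_compose (cnj_fps A) T') \<iota> = cnj_fps B"
      using fps_compose_assoc[of \<iota> T' "cnj_fps A"] S.iota_0 T'0 T'\<iota> by (simp add: B_def cnj_fps_compose)
    ultimately show ?thesis by (simp add: taylor_h fps_compose_add_distrib)
  qed
  have re: "fps_nth (B + cnj_fps B) n = of_real (2 * Re (fps_nth B n))" for n
    by (simp add: complex_add_cnj)
  define f where "f = Abs_fps (\<lambda>n. \<lfloor>2 * Re (fps_nth B n)\<rfloor>)"
  have "complexify f = B + cnj_fps B"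
  proof (rule fps_ext)
    fix n
    have "2 * Re (fps_nth B n) \<in> \<int>" using ic(3)[of n] by (simp add: B_def A_def a_def)
    then have "of_int \<lfloor>2 * Re (fps_nth B n)\<rfloor> = 2 * Re (fps_nth B n)" by (rule of_int_floor)
    then have "complex_of_real (of_int \<lfloor>2 * Re (fps_nth B n)\<rfloor>) = of_real (2 * Re (fps_nth B n))" by (rule arg_cong)
    then show "fps_nth (complexify f) n = fps_nth (B + cnj_fps B) n"
      unfolding re by (simp add: complexify_def f_def)
  qed
  then have mem: "(f, h) \<in> fa_functions M atlas V coord \<iota>"
    unfolding fa_functions_def using comp_h hol_h N v'(2) VN' by auto
  have fm: "fps_nth f m = 1" using ic(4) by (simp add: f_def B_def A_def a_def)
  have f0: "fps_nth f 0 = 0" using ic(5)[of 0] m(1) by (simp add: f_def B_def A_def a_def)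
  have "\<not> fa_constant V (f, h)"
    using fm m(1) by (auto simp: fa_constant_def)
  moreover have "h ` V \<subseteq> ball 0 1"
  proof safe
    fix x assume x: "x \<in> V"
    have "cmod (v x) \<le> 1" "cmod (v' x) \<le> 1" using vle[of x] v'le[of x] x N VN' \<kappa> by force+
    then have "cmod (eval_fps A (v x)) < 1 / 2" "cmod (eval_fps (cnj_fps A) (v' x)) < 1 / 2"
      using Abound[of "v x"] Abound[of "cnj (v' x)"] eval_fps_cnj[of "v' x" A] radius'
        v'le[of x] x VN' \<kappa> by (auto simp: subset_eq)
    then have "cmod (h x) < 1"
      unfolding h_def using norm_triangle_ineq[of "eval_fps A (v x)" "eval_fps (cnj_fps A) (v' x)"] by linarith
    then show "h x \<in> ball 0 1" by simp
  qed
  ultimately show ?thesis using mem f0 by (intro bexI[of _ "(f, h)"]) auto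
qed

end
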